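(* Let $u_\infty$ be a limit solution in $\Omega$. There exists a constant $0<\xi=\xi(N,\ell)\le1$ such that $$\mathcal H^{N-\xi}\left(\partial\{u_\infty>0\}\cap B_{\frac12}\right)<\infty .$$
   Context: $\mathcal H^{s}$ is $s$-dimensional Hausdorff measure in $\mathbb R^N$ and $B_{1/2}$ is the ball of radius $1/2$ centered at $0$. Limit solution in a regular bounded domain $\Omega\subset\mathbb R^N$: let $\lambda_0$ be a bounded function on $\Omega$ with $0<\inf_\Omega\lambda_0\le\sup_\Omega\lambda_0<\infty$, let $0\le g\in\mathrm{Lip}(\partial\Omega)$, and for $p\ge2$ let $0\le q(p)<p-1$ be such that $\ell:=\lim_{p\to\infty}q(p)/p\in[0,1)$ exists. Let $u_p$ be the nonnegative weak solution of $-\mathrm{div}(|\nabla u_p|^{p-2}\nabla u_p)+\lambda_0(u_p)_+^{q(p)}=0$ in $\Omega$, $u_p=g$ on $\partial\Omega$ (weak solution: $u_p\in W^{1,p}_{\rm loc}(\Omega)$ with $\int_\Omega|\nabla u_p|^{p-2}\nabla u_p\cdot\nabla\varphi\,dx=-\int_\Omega\lambda_0(u_p)_+^{q(p)}\varphi\,dx$ for all $0\le\varphi\in C^1_0(\Omega)$; $s_+=\max\{s,0\}$, and $s_+^0$ means $1$ if $s>0$ and $0$ otherwise). A limit solution is a function $u_\infty$ such that $u_{p_j}\to u_\infty$ uniformly in $\overline\Omega$ for some sequence $p_j\to\infty$. *)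

theory Defs
  imports "HOL-Analysis.Analysis"
begin

section \<open>Hausdorff measure\<close>

text \<open>The usual normalisation by the volume of the unit ball makes \<open>\<H>\<^sup>N\<close> Lebesgue measure on
  \<open>\<real>\<^sup>N\<close>.  The case \<open>s = 0\<close> (counting measure) is separated because \<open>0 powr 0 = 0\<close>.\<close>

definition hausdorff_gauge :: "real \<Rightarrow> 'a::metric_space set \<Rightarrow> ennreal" where
  "hausdorff_gauge s A =
     (if A = {} then 0
      else if s = 0 then 1
      else ennreal (unit_ball_vol s * (diameter A / 2) powr s))"

text \<open>Boundedness of the covering sets is required explicitly: \<open>diameter\<close> is a real supremum and
  has no meaningful value on unbounded sets.\<close>

definition hausdorff_content :: "real \<Rightarrow> real \<Rightarrow> 'a::metric_space set \<Rightarrow> ennreal" where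
  "hausdorff_content s \<delta> E =
     (INF A \<in> {A :: nat \<Rightarrow> 'a set. E \<subseteq> (\<Union>i. A i) \<and> (\<forall>i. bounded (A i) \<and> diameter (A i) \<le> \<delta>)}.
        (\<Sum>i. hausdorff_gauge s (A i)))"

definition hausdorff_measure :: "real \<Rightarrow> 'a::metric_space set \<Rightarrow> ennreal" where
  "hausdorff_measure s E = (SUP \<delta> \<in> {0<..}. hausdorff_content s \<delta> E)"


section \<open>Regular bounded domains\<close>

text \<open>Near each boundary point, and after a rotation taking \<open>e\<close> to the last coordinate direction,
  the set lies strictly above the graph of a Lipschitz function of the other coordinates;
  \<open>x - (x \<bullet> e) *\<^sub>R e\<close> is the projection of \<open>x\<close> onto the hyperplane orthogonal to \<open>e\<close>.\<close>

definition lipschitz_boundary :: "'a::euclidean_space set \<Rightarrow> bool" where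
  "lipschitz_boundary \<Omega> \<longleftrightarrow>
     (\<forall>z \<in> frontier \<Omega>. \<exists>e r L. \<exists>\<gamma> :: 'a \<Rightarrow> real.
        norm e = 1 \<and> 0 < r \<and> L-lipschitz_on UNIV \<gamma> \<and>
        \<Omega> \<inter> ball z r = {x \<in> ball z r. \<gamma> (x - (x \<bullet> e) *\<^sub>R e) < x \<bullet> e})"

definition regular_bounded_domain :: "'a::euclidean_space set \<Rightarrow> bool" where
  "regular_bounded_domain \<Omega> \<longleftrightarrow>
     open \<Omega> \<and> connected \<Omega> \<and> \<Omega> \<noteq> {} \<and> bounded \<Omega> \<and> lipschitz_boundary \<Omega>"


section \<open>Test functions and local Sobolev spaces\<close>

definition grad :: "('a::euclidean_space \<Rightarrow> real) \<Rightarrow> 'a \<Rightarrow> 'a" where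
  "grad \<phi> x = (THE D. GDERIV \<phi> x :> D)"

text \<open>Functions are total; an element of \<open>C\<^sup>1\<^sub>0(\<Omega>)\<close> is represented by its extension by zero.\<close>

definition C1_0 :: "'a::euclidean_space set \<Rightarrow> ('a \<Rightarrow> real) set" where
  "C1_0 \<Omega> =
     {\<phi>. (\<forall>x. GDERIV \<phi> x :> grad \<phi> x) \<and> continuous_on UNIV (grad \<phi>) \<and>
         compact (closure {x. \<phi> x \<noteq> 0}) \<and> closure {x. \<phi> x \<noteq> 0} \<subseteq> \<Omega>}"

definition Lp_loc :: "real \<Rightarrow> 'a::euclidean_space set \<Rightarrow> ('a \<Rightarrow> 'b::euclidean_space) set" where
  "Lp_loc p \<Omega> =
     {f. set_borel_measurable lebesgue \<Omega> f \<and>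
         (\<forall>K. compact K \<and> K \<subseteq> \<Omega> \<longrightarrow> set_integrable lebesgue K (\<lambda>x. norm (f x) powr p))}"

text \<open>Integration by parts for all partial derivatives at once, as an identity of vectors.\<close>

definition weak_gradient ::
  "'a::euclidean_space set \<Rightarrow> ('a \<Rightarrow> real) \<Rightarrow> ('a \<Rightarrow> 'a) \<Rightarrow> bool" where
  "weak_gradient \<Omega> u G \<longleftrightarrow>
     (\<forall>\<phi> \<in> C1_0 \<Omega>.
        (LINT x:\<Omega>|lebesgue. u x *\<^sub>R grad \<phi> x) = - (LINT x:\<Omega>|lebesgue. \<phi> x *\<^sub>R G x))"

text \<open>\<open>u \<in> W^{1,p}_loc(\<Omega>)\<close> with weak gradient \<open>G\<close> (which is unique almost everywhere).\<close>

definition W1p_loc ::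
  "real \<Rightarrow> 'a::euclidean_space set \<Rightarrow> ('a \<Rightarrow> real) \<Rightarrow> ('a \<Rightarrow> 'a) \<Rightarrow> bool" where
  "W1p_loc p \<Omega> u G \<longleftrightarrow> u \<in> Lp_loc p \<Omega> \<and> G \<in> Lp_loc p \<Omega> \<and> weak_gradient \<Omega> u G"


section \<open>The dead core problem and its limit solutions\<close>

text \<open>Since \<open>0 powr a = 0\<close> for every \<open>a\<close> and \<open>t powr 0 = 1\<close> for \<open>t > 0\<close>, the term
  \<open>max (u x) 0 powr q\<close> obeys the convention that \<open>s\<^sub>+\<^sup>0\<close> is \<open>1\<close> for \<open>s > 0\<close> and \<open>0\<close> otherwise.\<close>

definition weak_solution ::
  "'a::euclidean_space set \<Rightarrow> ('a \<Rightarrow> real) \<Rightarrow> real \<Rightarrow> real \<Rightarrow> ('a \<Rightarrow> real) \<Rightarrow> bool" where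
  "weak_solution \<Omega> lam p q u \<longleftrightarrow>
     (\<exists>G. W1p_loc p \<Omega> u G \<and>
        (\<forall>\<phi> \<in> C1_0 \<Omega>. (\<forall>x. 0 \<le> \<phi> x) \<longrightarrow>
           (LINT x:\<Omega>|lebesgue. norm (G x) powr (p - 2) * (G x \<bullet> grad \<phi> x)) =
           - (LINT x:\<Omega>|lebesgue. lam x * max (u x) 0 powr q * \<phi> x)))"

text \<open>The boundary condition is attained pointwise by a solution continuous up to the boundary.\<close>

definition dead_core_solution ::
  "'a::euclidean_space set \<Rightarrow> ('a \<Rightarrow> real) \<Rightarrow> ('a \<Rightarrow> real) \<Rightarrow> real \<Rightarrow> real \<Rightarrow> ('a \<Rightarrow> real) \<Rightarrow> bool"
where
  "dead_core_solution \<Omega> lam g p q u \<longleftrightarrow>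
     weak_solution \<Omega> lam p q u \<and> (\<forall>x \<in> \<Omega>. 0 \<le> u x) \<and>
     continuous_on (closure \<Omega>) u \<and> (\<forall>x \<in> frontier \<Omega>. u x = g x)"

text \<open>The solutions are only asked for along the sequence of exponents that is used.\<close>

definition limit_solution ::
  "'a::euclidean_space set \<Rightarrow> ('a \<Rightarrow> real) \<Rightarrow> ('a \<Rightarrow> real) \<Rightarrow> (real \<Rightarrow> real) \<Rightarrow> ('a \<Rightarrow> real) \<Rightarrow> bool"
where
  "limit_solution \<Omega> lam g q u_inf \<longleftrightarrow>
     (\<exists>(p :: nat \<Rightarrow> real) (u :: real \<Rightarrow> 'a \<Rightarrow> real).
        (\<forall>j. 2 \<le> p j) \<and> filterlim p at_top sequentially \<and>
        (\<forall>j. dead_core_solution \<Omega> lam g (p j) (q (p j)) (u (p j))) \<and>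
        uniform_limit (closure \<Omega>) (\<lambda>j. u (p j)) u_inf sequentially)"

end

theory Submission
  imports Defs
begin

text \<open>
  Around a point \<open>x \<in> \<Omega>\<close> of the free boundary \<open>F = \<partial>{u\<^sub>\<infinity> > 0}\<close>, radial comparison
  functions show that every ball \<open>B\<^sub>r(x)\<close> inside \<open>\<Omega>\<close> contains a ball of radius \<open>c r\<close>, \<open>c = (1 - l) / 32\<close>, that
  does not meet \<open>F\<close>.  A set with this porosity property has finite measure in some dimension below
  \<open>N\<close> that depends on \<open>c\<close> and \<open>N\<close> only.

  \<^emph>\<open>Porosity.\<close>  Write \<open>u\<close> for \<open>u\<^sub>p\<close>, \<open>q\<close> for \<open>q(p)\<close> and \<open>\<beta> = p / (p - 1 - q)\<close>, so that \<open>\<beta> \<longlonglongrightarrow> 1 / (1 - l)\<close>.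
  \<^item> If \<open>k\<^bsup>1-l\<^esup> < 1 - l\<close>, then for large \<open>p\<close> the function \<open>k (\<bar>x - y\<bar>\<^sup>2 + \<tau>\<^sup>2)\<^bsup>\<beta>/2\<^esup>\<close> is a strict
    supersolution.  Hence \<open>u\<^sub>\<infinity>\<close> cannot stay below \<open>k \<rho>\<^bsup>1/(1-l)\<^esup>\<close> on a sphere of radius \<open>\<rho>\<close> about a point
    where it is positive (\<open>limit_nondegenerate\<close>).
  \<^item> If \<open>M\<^bsup>1-l\<^esup> > R\<close>, then for large \<open>p\<close> the slightly bent cone \<open>M - M (\<bar>x - y\<bar> / R)\<^bsup>1-\<alpha>\<^esup>\<close>, with
    \<open>\<alpha> = N / (p - 1)\<close>, is a strict subsolution away from \<open>y\<close>.  Hence \<open>u\<^sub>\<infinity>(y) > M\<close> forces \<open>u\<^sub>\<infinity> > 0\<close> in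
    \<open>B\<^sub>R(y)\<close> (\<open>limit_positive_in_ball\<close>).

  The first fact yields a point \<open>z\<close> at distance about \<open>r/4\<close> with \<open>u\<^sub>\<infinity>(z)\<close> of order \<open>r\<^bsup>1/(1-l)\<^esup>\<close>, and the
  second one a ball about \<open>z\<close>, of radius proportional to \<open>r\<close>, on which \<open>u\<^sub>\<infinity>\<close> is positive
  (\<open>free_boundary_porous\<close>).

  \<^emph>\<open>Comparison.\<close>  Both facts need a comparison principle between a continuous weak solution
  and a classical strict sub- or supersolution \<open>w\<close> (\<open>weak_comparison\<close>).  The natural test function
  \<open>(u - w - \<epsilon>)\<^sub>+\<close> is not \<open>C\<^sup>1\<close>; the proof uses \<open>((u\<^sub>d - w - 2\<epsilon>)\<^sub>+)\<^sup>2\<close> with a mollification \<open>u\<^sub>d\<close> of \<open>u\<close>.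
  Replacing \<open>\<nabla>u\<^sub>d\<close> by the weak gradient costs an error that vanishes with \<open>d\<close>, because translations are
  continuous in \<open>L\<^sup>p\<close> (\<open>weighted_mollification_error\<close>).  Monotonicity of \<open>a \<mapsto> \<bar>a\<bar>\<^bsup>p-2\<^esup> a\<close> gives the sign of
  the main term.

  \<^emph>\<open>Dimension.\<close>  Subdivide space into cubes of side \<open>m\<^bsup>-k\<^esup>\<close>.  If \<open>m\<close> is large compared with \<open>N / c\<close>,
  each cube that meets \<open>F\<close> away from \<open>\<partial>\<Omega>\<close> has a child that misses \<open>F\<close>, so only \<open>D = m\<^sup>N - 1\<close> of its
  \<open>m\<^sup>N\<close> children matter.  Cubes within distance \<open>m\<^bsup>-k\<^esup>\<close> of the Lipschitz boundary \<open>\<partial>\<Omega>\<close> may be worse,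
  but there are at most \<open>C m\<^bsup>k(N-1)\<^esup>\<close> of them (\<open>boundary_cell_count\<close>).  Since \<open>m\<^bsup>N-1\<^esup> < D\<close>, the number
  of cubes that meet \<open>F\<close> is still \<open>O(D\<^sup>k)\<close>, which is finiteness of the measure of dimension
  \<open>N - \<xi> = log\<^sub>m D\<close> (\<open>porous_hausdorff_measure_finite\<close>).
\<close>

section \<open>Translations in \<open>L\<^sup>p\<close>\<close>

lemma nn_integral_translate:
  fixes f :: "'a::euclidean_space \<Rightarrow> ennreal"
  assumes [measurable]: "f \<in> borel_measurable borel"
  shows "(\<integral>\<^sup>+y. f (x + y) \<partial>lborel) = (\<integral>\<^sup>+y. f y \<partial>lborel)"
  by (subst (2) lborel_distr_plus[of x, symmetric], subst nn_integral_distr) auto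

lemma powr_add_le:
  fixes a b p :: real
  assumes "0 \<le> a" "0 \<le> b" "0 < p"
  shows "(a + b) powr p \<le> 2 powr p * (a powr p + b powr p)"
proof -
  have "(a + b) powr p \<le> (2 * max a b) powr p"
    using assms by (intro powr_mono2) auto
  also have "\<dots> = 2 powr p * (max a b) powr p"
    using assms by (simp add: powr_mult)
  also have "(max a b) powr p \<le> a powr p + b powr p"
    by (auto simp: max_def)
  finally show ?thesis by simp
qed

lemma nn_integral_powr_triangle:
  fixes f g :: "'a::euclidean_space \<Rightarrow> 'b::euclidean_space"
  assumes [measurable]: "f \<in> borel_measurable borel" "g \<in> borel_measurable borel" and "0 < p"
  shows "(\<integral>\<^sup>+x. norm (f x + g x) powr p \<partial>lborel)
     \<le> 2 powr p * ((\<integral>\<^sup>+x. norm (f x) powr p \<partial>lborel) + (\<integral>\<^sup>+x. norm (g x) powr p \<partial>lborel))"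
proof -
  have "(\<integral>\<^sup>+x. norm (f x + g x) powr p \<partial>lborel)
     \<le> (\<integral>\<^sup>+x. ennreal (2 powr p) * (ennreal (norm (f x) powr p) + ennreal (norm (g x) powr p)) \<partial>lborel)"
  proof (rule nn_integral_mono)
    fix x
    have "norm (f x + g x) powr p \<le> (norm (f x) + norm (g x)) powr p"
      using assms by (intro powr_mono2 norm_triangle_ineq) auto
    also have "\<dots> \<le> 2 powr p * (norm (f x) powr p + norm (g x) powr p)"
      using assms by (intro powr_add_le) auto
    finally show "ennreal (norm (f x + g x) powr p) \<le>
      ennreal (2 powr p) * (ennreal (norm (f x) powr p) + ennreal (norm (g x) powr p))"
      by (simp add: ennreal_leI flip: ennreal_mult' ennreal_plus)
  qed
  also have "\<dots> = 2 powr p * ((\<integral>\<^sup>+x. norm (f x) powr p \<partial>lborel) + (\<integral>\<^sup>+x. norm (g x) powr p \<partial>lborel))"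
    by (subst nn_integral_cmult, simp, subst nn_integral_add) auto
  finally show ?thesis .
qed

definition truncation :: "real \<Rightarrow> 'b::real_normed_vector \<Rightarrow> 'b" where
  "truncation M v = (M / max M (norm v)) *\<^sub>R v"

lemma norm_truncation_le: "0 < M \<Longrightarrow> norm (truncation M v) \<le> M"
  by (auto simp: truncation_def field_simps max_def)

lemma truncation_eq: "norm v \<le> M \<Longrightarrow> truncation M v = v"
  by (cases "M = 0") (auto simp: truncation_def max_def)

lemma norm_truncation_diff_le:
  assumes "0 < M" shows "norm (truncation M v - v) \<le> norm v"
proof (cases "norm v \<le> M")
  case False
  have "truncation M v - v = (M / norm v - 1) *\<^sub>R v"
    using False by (simp add: truncation_def max_def algebra_simps)
  moreover have "0 \<le> M / norm v" "M / norm v \<le> 1"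
    using False assms by (auto simp: divide_le_eq_1)
  then have "\<bar>M / norm v - 1\<bar> \<le> 1"
    by simp
  ultimately show ?thesis
    by (simp add: mult_left_le_one_le)
qed (simp add: truncation_eq)

lemma continuous_truncation: "0 < M \<Longrightarrow> continuous_on UNIV (truncation M)"
  unfolding truncation_def by (intro continuous_intros) auto

lemma isCont_truncation:
  fixes x :: "'b::real_normed_vector"
  shows "0 < M \<Longrightarrow> isCont (truncation M) x"
  using continuous_truncation[of M, where ?'a = 'b] by (simp add: continuous_on_eq_continuous_at)

lemma measurable_truncation [measurable]:
  "0 < M \<Longrightarrow> truncation M \<in> borel_measurable (borel :: 'b::euclidean_space measure)"
  by (intro borel_measurable_continuous_onI continuous_truncation)

text \<open>Truncate \<open>f\<close> at a high level, then truncate continuous functions that converge to \<open>f\<close> almost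
  everywhere; both steps converge in \<open>L\<^sup>p\<close> by dominated convergence.\<close>

lemma Lp_dense_continuous:
  fixes f :: "'a::euclidean_space \<Rightarrow> 'b::euclidean_space"
  assumes [measurable]: "f \<in> borel_measurable borel"
    and p: "0 < p" and int: "(\<integral>\<^sup>+x. norm (f x) powr p \<partial>lborel) < \<infinity>"
    and supp: "\<And>x. R < norm x \<Longrightarrow> f x = 0" and e: "0 < (e::real)"
  obtains b where "continuous_on UNIV b" "\<And>x. R + 1 < norm x \<Longrightarrow> b x = 0"
    "(\<integral>\<^sup>+x. norm (f x - b x) powr p \<partial>lborel) < e"
proof -
  define c where "c = e / (2 * 2 powr p)"
  have c: "0 < c" using e by (simp add: c_def)
  have "(\<lambda>n. \<integral>\<^sup>+x. norm (f x - truncation (real (Suc n)) (f x)) powr p \<partial>lborel)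
     \<longlonglongrightarrow> (\<integral>\<^sup>+x. 0 \<partial>(lborel :: 'a measure))"
  proof (rule nn_integral_dominated_convergence[where w = "\<lambda>x. ennreal (norm (f x) powr p)"])
    show "AE x in lborel. ennreal (norm (f x - truncation (real (Suc j)) (f x)) powr p)
       \<le> ennreal (norm (f x) powr p)" for j
      using p norm_truncation_diff_le[of "real (Suc j)"]
      by (intro AE_I2 ennreal_leI powr_mono2) (simp_all add: norm_minus_commute)
    have "eventually (\<lambda>n. ennreal (norm (f x - truncation (real (Suc n)) (f x)) powr p) = 0) sequentially" for x
    proof -
      obtain N where "norm (f x) \<le> real N" using real_arch_simple by blast
      then show ?thesis
        by (intro eventually_sequentiallyI[of N]) (simp add: truncation_eq)
    qed
    then show "AE x in lborel. (\<lambda>n. ennreal (norm (f x - truncation (real (Suc n)) (f x)) powr p)) \<longlonglongrightarrow> 0"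
      by (intro AE_I2 tendsto_eventually)
  qed (use int in simp_all)
  then have "eventually (\<lambda>n. (\<integral>\<^sup>+x. norm (f x - truncation (real (Suc n)) (f x)) powr p \<partial>lborel) < c) sequentially"
    by (intro order_tendstoD) (use c in auto)
  then obtain n where n: "(\<integral>\<^sup>+x. norm (f x - truncation (real (Suc n)) (f x)) powr p \<partial>lborel) < c"
    by (auto simp: eventually_sequentially)
  define M where "M = real (Suc n)"
  have M: "0 < M" by (simp add: M_def)
  have "f \<in> borel_measurable lebesgue"
    using assms(1) by (simp add: measurable_completion)
  then have "f measurable_on UNIV"
    by (rule lebesgue_measurable_imp_measurable_on) simp
  then obtain N g where N: "negligible N" and g: "\<And>n. continuous_on UNIV (g n)"
    and lim: "\<And>x. x \<notin> N \<Longrightarrow> (\<lambda>n. g n x) \<longlonglongrightarrow> f x"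
    by (auto simp: measurable_on_def)
  define \<eta> :: "'a \<Rightarrow> real" where "\<eta> x = max 0 (min 1 (R + 1 - norm x))" for x
  have \<eta>: "0 \<le> \<eta> x" "\<eta> x \<le> 1" "norm x \<le> R \<Longrightarrow> \<eta> x = 1" "R + 1 < norm x \<Longrightarrow> \<eta> x = 0" for x
    by (auto simp: \<eta>_def)
  have c\<eta>: "continuous_on UNIV \<eta>"
    unfolding \<eta>_def by (intro continuous_intros)
  define h where "h k x = \<eta> x *\<^sub>R truncation M (g k x)" for k x
  have h: "continuous_on UNIV (h k)" for k
    unfolding h_def
    by (intro continuous_intros c\<eta> continuous_on_compose2[OF continuous_truncation[OF M] g]) auto
  have [measurable]: "h k \<in> borel_measurable borel" for k
    by (intro borel_measurable_continuous_onI h)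
  have mT: "truncation M \<in> borel_measurable (borel :: 'b measure)"
    by (rule measurable_truncation[OF M])
  have mD: "(\<lambda>x. norm (truncation M (f x) - h k x) powr p) \<in> borel_measurable borel" for k
  proof -
    have [measurable]: "(\<lambda>x. truncation M (f x)) \<in> borel_measurable borel"
      by (rule measurable_compose[OF assms(1) mT])
    show ?thesis by (intro powr_real_measurable borel_measurable_norm borel_measurable_diff) simp_all
  qed
  have nh: "norm (h k x) \<le> M" for k x
    using mult_mono[OF \<eta>(2)[of x] norm_truncation_le[OF M, of "g k x"]] \<eta>(1)[of x]
    by (simp add: h_def)
  have f\<eta>: "\<eta> x *\<^sub>R truncation M (f x) = truncation M (f x)" for x
    using \<eta>(3)[of x] supp[of x] by (cases "norm x \<le> R") (auto simp: truncation_def)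
  have AEN: "AE x in lborel. x \<notin> N"
    using AE_not_in[of N lebesgue] N by (simp add: negligible_iff_null_sets AE_completion_iff)
  have "(\<lambda>k. \<integral>\<^sup>+x. norm (truncation M (f x) - h k x) powr p \<partial>lborel)
     \<longlonglongrightarrow> (\<integral>\<^sup>+x. 0 \<partial>(lborel :: 'a measure))"
  proof (rule nn_integral_dominated_convergence[where
        w = "\<lambda>x. ennreal ((2 * M) powr p) * indicator (cball 0 (R + 1)) x"])
    show "AE x in lborel. ennreal (norm (truncation M (f x) - h j x) powr p)
       \<le> ennreal ((2 * M) powr p) * indicator (cball 0 (R + 1)) x" for j
    proof (rule AE_I2)
      fix x
      have "norm (truncation M (f x) - h j x) \<le> 2 * M"
        using norm_triangle_ineq4[of "truncation M (f x)" "h j x"] nh[of j x] norm_truncation_le[OF M, of "f x"]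
        by simp
      then have "norm (truncation M (f x) - h j x) powr p \<le> (2 * M) powr p"
        using p by (intro powr_mono2) auto
      moreover have "truncation M (f x) - h j x = 0" if "R + 1 < norm x"
        using that supp[of x] \<eta>(4)[of x] by (simp add: h_def truncation_def)
      ultimately show "ennreal (norm (truncation M (f x) - h j x) powr p)
       \<le> ennreal ((2 * M) powr p) * indicator (cball 0 (R + 1)) x"
        by (cases "R + 1 < norm x") (auto simp: indicator_def ennreal_leI)
    qed
    show "AE x in lborel. (\<lambda>k. ennreal (norm (truncation M (f x) - h k x) powr p)) \<longlonglongrightarrow> 0"
      using AEN
    proof eventually_elim
      case (elim x)
      have "(\<lambda>k. truncation M (g k x)) \<longlonglongrightarrow> truncation M (f x)"
        using isCont_tendsto_compose[OF isCont_truncation[OF M] lim[OF elim]] .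
      then have "(\<lambda>k. h k x) \<longlonglongrightarrow> \<eta> x *\<^sub>R truncation M (f x)"
        unfolding h_def by (intro tendsto_intros)
      then have "(\<lambda>k. norm (truncation M (f x) - h k x) powr p) \<longlonglongrightarrow> norm (truncation M (f x) - truncation M (f x)) powr p"
        unfolding f\<eta> using p
        by (intro tendsto_powr2 tendsto_norm tendsto_diff tendsto_const) auto
      from tendsto_ennrealI[OF this] show ?case
        by simp
    qed
    show "(\<integral>\<^sup>+x. ennreal ((2 * M) powr p) * indicator (cball 0 (R + 1)) x \<partial>(lborel :: 'a measure)) < \<infinity>"
      using emeasure_lborel_cball_finite[of "0::'a" "R+1"]
      by (subst nn_integral_cmult_indicator) (simp, simp add: ennreal_mult_less_top)
    show "(\<lambda>x. ennreal ((2 * M) powr p) * indicator (cball 0 (R + 1)) x) \<in> borel_measurable (lborel :: 'a measure)"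
      by (intro borel_measurable_times_ennreal borel_measurable_const borel_measurable_indicator) simp
    show "(\<lambda>x. ennreal (norm (truncation M (f x) - h k x) powr p)) \<in> borel_measurable lborel" for k
      using measurable_compose[OF mD[of k] measurable_ennreal] by simp
    show "(\<lambda>x. 0) \<in> borel_measurable (lborel :: 'a measure)"
      by (rule borel_measurable_const)
  qed
  then have "eventually (\<lambda>k. (\<integral>\<^sup>+x. norm (truncation M (f x) - h k x) powr p \<partial>lborel) < c) sequentially"
    by (intro order_tendstoD) (use c in auto)
  then obtain k where k: "(\<integral>\<^sup>+x. norm (truncation M (f x) - h k x) powr p \<partial>lborel) < c"
    by (auto simp: eventually_sequentially)
  have "(\<integral>\<^sup>+x. norm (f x - h k x) powr p \<partial>lborel) =
     (\<integral>\<^sup>+x. norm ((f x - truncation M (f x)) + (truncation M (f x) - h k x)) powr p \<partial>lborel)"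
    by simp
  also have "\<dots> \<le> 2 powr p * ((\<integral>\<^sup>+x. norm (f x - truncation M (f x)) powr p \<partial>lborel) +
       (\<integral>\<^sup>+x. norm (truncation M (f x) - h k x) powr p \<partial>lborel))"
    by (rule nn_integral_powr_triangle) (use M p in auto)
  also have "\<dots> < ennreal (2 powr p) * (ennreal c + ennreal c)"
    using n k by (intro ennreal_mult_strict_left_mono add_strict_mono) (auto simp: M_def)
  also have "\<dots> = e"
    using c by (simp add: c_def flip: ennreal_mult' ennreal_plus)
  finally show ?thesis
    using that[of "h k"] h \<eta>(4) by (auto simp: h_def)
qed

text \<open>True for continuous functions of bounded support by uniform continuity, and the translates of the
  approximation error have the norm of that error.\<close>

lemma Lp_translation_continuous:
  fixes f :: "'a::euclidean_space \<Rightarrow> 'b::euclidean_space"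
  assumes [measurable]: "f \<in> borel_measurable borel"
    and p: "0 < p" and int: "(\<integral>\<^sup>+x. norm (f x) powr p \<partial>lborel) < \<infinity>"
    and supp: "\<And>x. R < norm x \<Longrightarrow> f x = 0" and e: "0 < (e::real)"
  obtains d where "0 < d" "\<And>z. norm z < d \<Longrightarrow> (\<integral>\<^sup>+x. norm (f (z + x) - f x) powr p \<partial>lborel) < e"
proof -
  define c where "c = e / (4 * 4 powr p)"
  have c: "0 < c" using e by (simp add: c_def)
  obtain b where b: "continuous_on UNIV b" and b0: "\<And>x. R + 1 < norm x \<Longrightarrow> b x = 0"
    and fb: "(\<integral>\<^sup>+x. norm (f x - b x) powr p \<partial>lborel) < c"
    using Lp_dense_continuous[OF assms(1-4) c] by metis
  have [measurable]: "b \<in> borel_measurable borel"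
    by (intro borel_measurable_continuous_onI b)
  define V where "V = measure lborel (cball (0::'a) (R + 2))"
  have V: "0 \<le> V" "emeasure lborel (cball (0::'a) (R + 2)) = ennreal V"
    using emeasure_lborel_cball_finite[of "0::'a" "R+2"]
    by (auto simp: V_def emeasure_eq_ennreal_measure)
  define t where "t = (c / (V + 1)) powr (1 / p)"
  have t: "0 < t" using c V by (simp add: t_def)
  have tp: "t powr p = c / (V + 1)"
    using c V p by (simp add: t_def powr_powr)
  have "uniformly_continuous_on (cball 0 (R + 3)) b"
    using b by (intro compact_uniformly_continuous) (auto intro: continuous_on_subset)
  then obtain d where d: "0 < d" and ud: "\<And>x y. x \<in> cball 0 (R + 3) \<Longrightarrow> y \<in> cball 0 (R + 3) \<Longrightarrow>
      dist y x < d \<Longrightarrow> dist (b y) (b x) < t"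
    using t unfolding uniformly_continuous_on_def by meson
  have "(\<integral>\<^sup>+x. norm (f (z + x) - f x) powr p \<partial>lborel) < e" if z: "norm z < min d 1" for z
  proof -
    have tr: "(\<integral>\<^sup>+x. norm (f (z + x) - b (z + x)) powr p \<partial>lborel) < c"
      using nn_integral_translate[of "\<lambda>x. ennreal (norm (f x - b x) powr p)" z] fb by simp
    have fb': "(\<integral>\<^sup>+x. norm (b x - f x) powr p \<partial>lborel) < c"
      using fb by (simp add: norm_minus_commute)
    have "(\<integral>\<^sup>+x. norm (b (z + x) - b x) powr p \<partial>lborel)
        \<le> (\<integral>\<^sup>+x. ennreal (t powr p) * indicator (cball 0 (R + 2)) x \<partial>(lborel :: 'a measure))"
    proof (rule nn_integral_mono)
      fix x
      show "ennreal (norm (b (z + x) - b x) powr p) \<le> ennreal (t powr p) * indicator (cball 0 (R + 2)) x"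
      proof (cases "norm x \<le> R + 2")
        case True
        then have "dist (b (z + x)) (b x) < t"
          using z norm_triangle_ineq[of z x] by (intro ud) (auto simp: mem_cball_0 dist_commute[of x] dist_norm[of "z + x"] simp del: mem_cball)
        then have "norm (b (z + x) - b x) powr p \<le> t powr p"
          using p by (intro powr_mono2) (auto simp: dist_norm)
        then show ?thesis using True by (simp add: ennreal_leI)
      next
        case False
        then show ?thesis
          using z b0[of x] b0[of "z + x"] norm_triangle_ineq4[of "z + x" z] by simp
      qed
    qed
    also have "\<dots> = ennreal (t powr p * V)"
      using V t by (subst nn_integral_cmult_indicator) (auto simp: ennreal_mult')
    also have "\<dots> \<le> c"
      using c V by (intro ennreal_leI) (simp add: tp field_simps)
    finally have bb: "(\<integral>\<^sup>+x. norm (b (z + x) - b x) powr p \<partial>lborel) \<le> c" .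
    have "(\<integral>\<^sup>+x. norm (f (z + x) - f x) powr p \<partial>lborel) =
      (\<integral>\<^sup>+x. norm ((f (z + x) - b (z + x)) + ((b (z + x) - b x) + (b x - f x))) powr p \<partial>lborel)"
      by simp
    also have "\<dots> \<le> 2 powr p * ((\<integral>\<^sup>+x. norm (f (z + x) - b (z + x)) powr p \<partial>lborel) +
       (\<integral>\<^sup>+x. norm ((b (z + x) - b x) + (b x - f x)) powr p \<partial>lborel))"
      by (rule nn_integral_powr_triangle) (use p in auto)
    also have "\<dots> \<le> 2 powr p * (c + 2 powr p * ((\<integral>\<^sup>+x. norm (b (z + x) - b x) powr p \<partial>lborel) +
       (\<integral>\<^sup>+x. norm (b x - f x) powr p \<partial>lborel)))"
      by (intro mult_left_mono add_mono nn_integral_powr_triangle) (use p tr in auto)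
    also have "\<dots> \<le> ennreal (2 powr p) * (ennreal c + ennreal (2 powr p) * (ennreal c + ennreal c))"
      by (intro mult_left_mono add_mono) (use p bb fb' in auto)
    also have "\<dots> = ennreal (2 powr p * (c + 2 powr p * (c + c)))"
      using c by (simp flip: ennreal_mult' ennreal_plus)
    also have "\<dots> < ennreal e"
    proof (rule ennreal_lessI[OF e])
      have 4: "4 powr p = 2 powr p * (2 powr p :: real)"
        by (simp add: powr_mult[of 2 2 p, simplified])
      have "2 powr p \<le> (4::real) powr p" using p by (intro powr_mono2) auto
      moreover have "c * 4 powr p = e / 4" by (simp add: c_def)
      ultimately have "2 powr p * c \<le> e / 4"
        using mult_left_mono[of "2 powr p" "4 powr p" c] c by (smt (verit) mult.commute)
      moreover have "2 powr p * (2 powr p * (c + c)) = e / 2"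
        using \<open>c * 4 powr p = e / 4\<close> unfolding 4 by (simp add: algebra_simps)
      ultimately show "2 powr p * (c + 2 powr p * (c + c)) < e"
        using e by (simp add: distrib_left)
    qed
    finally show ?thesis .
  qed
  with that[of "min d 1"] d show thesis by simp
qed

text \<open>A substitute for Young's inequality, obtained by comparing \<open>D\<close> with \<open>t s\<close>: the factor \<open>t\<close> makes the
  term in \<open>s\<close> small, at the price of a large constant in front of \<open>D\<^sup>p\<close>.\<close>

lemma powr_product_split:
  fixes s D t p :: real
  assumes "0 \<le> s" "0 \<le> D" "0 < t" "1 \<le> p"
  shows "s powr (p - 1) * D \<le> t * s powr p + t powr (1 - p) * D powr p"
proof (cases "D \<le> t * s")
  case True
  have "s powr (p - 1) * D \<le> s powr (p - 1) * (t * s)"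
    using True by (intro mult_left_mono) auto
  also have "\<dots> = t * s powr p"
    using assms powr_add[of s "p - 1" 1] by (cases "s = 0") auto
  finally show ?thesis
    by (smt (verit) mult_nonneg_nonneg powr_ge_zero)
next
  case False
  then have D: "0 < D" using assms by (smt (verit) mult_nonneg_nonneg)
  have "s powr (p - 1) \<le> (D / t) powr (p - 1)"
    using False assms by (intro powr_mono2) (auto simp: field_simps)
  also have "\<dots> = D powr (p - 1) * t powr (1 - p)"
    using assms D powr_minus[of t "p - 1"] powr_divide[of D t "p - 1"] by (simp only: divide_inverse) simp
  finally have "s powr (p - 1) * D \<le> D powr (p - 1) * t powr (1 - p) * D"
    using assms by (intro mult_right_mono) auto
  also have "\<dots> = t powr (1 - p) * D powr p"
    using assms D powr_add[of D "p - 1" 1] by simp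
  finally show ?thesis
    using assms by (smt (verit) mult_nonneg_nonneg powr_ge_zero)
qed

text \<open>The weight \<open>a\<close> stands for \<open>\<bar>A - V\<bar>\<close>, where \<open>A = \<bar>g\<bar>\<^bsup>p-2\<^esup> g\<close> is only in the dual space of \<open>L\<^sup>p\<close> and \<open>V\<close> is
  bounded.  Splitting the product pointwise with a small factor \<open>t\<close> (\<open>powr_product_split\<close>) leaves only the
  translation error of \<open>g\<close> in \<open>L\<^sup>p\<close>.\<close>

lemma weighted_translation_continuous:
  fixes g :: "'a::euclidean_space \<Rightarrow> 'b::euclidean_space"
  assumes [measurable]: "g \<in> borel_measurable borel" "a \<in> borel_measurable borel"
    and p: "1 \<le> p" and int: "(\<integral>\<^sup>+x. norm (g x) powr p \<partial>lborel) < \<infinity>"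
    and supp: "\<And>x. R < norm x \<Longrightarrow> g x = 0"
    and a: "\<And>x. a x \<le> norm (g x) powr (p - 1) + C * indicator (cball 0 R) x" and C: "0 \<le> C"
    and e: "0 < (e::real)"
  obtains d where "0 < d"
    "\<And>z. norm z < d \<Longrightarrow> (\<integral>\<^sup>+x. a x * norm (g (z + x) - g x) \<partial>lborel) \<le> e"
proof -
  define V where "V = measure lborel (cball (0::'a) R)"
  have V: "0 \<le> V" "emeasure lborel (cball (0::'a) R) = ennreal V"
    using emeasure_lborel_cball_finite[of "0::'a" R]
    by (auto simp: V_def emeasure_eq_ennreal_measure)
  obtain I where I: "0 \<le> I" "(\<integral>\<^sup>+x. norm (g x) powr p \<partial>lborel) = ennreal I"
    using int by (cases "(\<integral>\<^sup>+x. norm (g x) powr p \<partial>lborel)") auto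
  define t where "t = e / (2 * (I + C * V + 1))"
  have den: "0 < I + C * V + 1" using I V C by (smt (verit) mult_nonneg_nonneg)
  have t: "0 < t" using e den by (simp add: t_def)
  have t2: "t * (I + C * V) \<le> e / 2"
    using e den by (simp add: t_def field_simps)
  define s where "s = t powr (1 - p) * (1 + C)"
  have s: "0 < s" using t C by (simp add: s_def)
  obtain d where d: "0 < d" and dz: "\<And>z. norm z < d \<Longrightarrow>
      (\<integral>\<^sup>+x. norm (g (z + x) - g x) powr p \<partial>lborel) < ennreal (e / (2 * s))"
    using Lp_translation_continuous[of g p R "e / (2 * s)"] assms s by auto
  have "(\<integral>\<^sup>+x. a x * norm (g (z + x) - g x) \<partial>lborel) \<le> e" if z: "norm z < d" for z
  proof -
    define D where "D x = norm (g (z + x) - g x)" for x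
    have D0: "0 \<le> D x" for x by (simp add: D_def)
    have [measurable]: "D \<in> borel_measurable borel" unfolding D_def by measurable
    have pt: "a x * D x \<le> t * (norm (g x) powr p + C * indicator (cball 0 R) x) + s * D x powr p" for x
    proof -
      have "a x * D x \<le> (norm (g x) powr (p - 1) + C * indicator (cball 0 R) x) * D x"
        using a D0 by (intro mult_right_mono)
      also have "\<dots> = norm (g x) powr (p - 1) * D x + C * indicator (cball 0 R) x * D x"
        by (simp add: algebra_simps)
      also have "\<dots> \<le> (t * norm (g x) powr p + t powr (1 - p) * D x powr p) +
           C * (t * indicator (cball 0 R) x + t powr (1 - p) * D x powr p)"
      proof (rule add_mono)
        show "norm (g x) powr (p - 1) * D x \<le> t * norm (g x) powr p + t powr (1 - p) * D x powr p"
          using powr_product_split[of "norm (g x)" "D x" t p] t p D0 by simp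
        have "indicator (cball 0 R) x * D x \<le> t * indicator (cball 0 R) x + t powr (1 - p) * D x powr p"
          using powr_product_split[of 1 "D x" t p] t p D0 by (auto simp: indicator_def)
        then show "C * indicator (cball 0 R) x * D x \<le>
            C * (t * indicator (cball 0 R) x + t powr (1 - p) * D x powr p)"
          using C by (simp add: mult_left_mono mult.assoc)
      qed
      also have "\<dots> = t * (norm (g x) powr p + C * indicator (cball 0 R) x) + s * D x powr p"
        by (simp add: s_def algebra_simps)
      finally show ?thesis .
    qed
    have "(\<integral>\<^sup>+x. a x * D x \<partial>lborel) \<le> (\<integral>\<^sup>+x. ennreal t * (ennreal (norm (g x) powr p) +
        ennreal C * indicator (cball 0 R) x) + ennreal s * ennreal (D x powr p) \<partial>(lborel :: 'a measure))"
    proof (rule nn_integral_mono)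
      fix x
      have "ennreal (a x * D x) \<le> ennreal (t * (norm (g x) powr p + C * indicator (cball 0 R) x) + s * D x powr p)"
        using pt by (rule ennreal_leI)
      also have "\<dots> = ennreal t * (ennreal (norm (g x) powr p) +
        ennreal C * indicator (cball 0 R) x) + ennreal s * ennreal (D x powr p)"
        using t s C by (simp add: ennreal_mult' ennreal_plus indicator_def)
      finally show "ennreal (a x * D x) \<le> ennreal t * (ennreal (norm (g x) powr p) +
        ennreal C * indicator (cball 0 R) x) + ennreal s * ennreal (D x powr p)" .
    qed
    also have "\<dots> = ennreal t * ((\<integral>\<^sup>+x. norm (g x) powr p \<partial>lborel) +
        ennreal C * emeasure lborel (cball (0::'a) R)) + ennreal s * (\<integral>\<^sup>+x. D x powr p \<partial>lborel)"
    proof -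
      define u w i where "u x = ennreal (norm (g x) powr p)" and "w x = ennreal (D x powr p)"
        and "i = (indicator (cball 0 R) :: 'a \<Rightarrow> ennreal)" for x
      have [measurable]: "u \<in> borel_measurable borel" "w \<in> borel_measurable borel"
        unfolding u_def w_def by measurable
      have [measurable]: "i \<in> borel_measurable borel"
        unfolding i_def by (rule borel_measurable_indicator) simp
      have "(\<integral>\<^sup>+x. ennreal t * (u x + ennreal C * i x) + ennreal s * w x \<partial>lborel) =
          (\<integral>\<^sup>+x. ennreal t * (u x + ennreal C * i x) \<partial>lborel) + (\<integral>\<^sup>+x. ennreal s * w x \<partial>lborel)"
        by (rule nn_integral_add) measurable
      also have "(\<integral>\<^sup>+x. ennreal t * (u x + ennreal C * i x) \<partial>lborel) =
          ennreal t * (\<integral>\<^sup>+x. u x + ennreal C * i x \<partial>lborel)"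
        by (rule nn_integral_cmult) measurable
      also have "(\<integral>\<^sup>+x. u x + ennreal C * i x \<partial>lborel) =
          (\<integral>\<^sup>+x. u x \<partial>lborel) + (\<integral>\<^sup>+x. ennreal C * i x \<partial>lborel)"
        by (rule nn_integral_add) measurable
      also have "(\<integral>\<^sup>+x. ennreal C * i x \<partial>lborel) = ennreal C * emeasure lborel (cball (0::'a) R)"
        unfolding i_def by (rule nn_integral_cmult_indicator) simp
      also have "(\<integral>\<^sup>+x. ennreal s * w x \<partial>lborel) = ennreal s * (\<integral>\<^sup>+x. w x \<partial>lborel)"
        by (rule nn_integral_cmult) measurable
      finally show ?thesis by (simp add: u_def w_def i_def)
    qed
    also have "\<dots> \<le> ennreal t * (ennreal I + ennreal C * ennreal V) + ennreal s * ennreal (e / (2 * s))"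
      unfolding I V D_def by (intro add_mono mult_left_mono order_refl less_imp_le dz z) (use C t s in auto)
    also have "\<dots> = ennreal (t * (I + C * V) + s * (e / (2 * s)))"
      using t I C V s e by (simp flip: ennreal_mult' ennreal_plus)
    also have "\<dots> \<le> ennreal e"
      using t2 s by (intro ennreal_leI) (simp add: field_simps)
    finally show ?thesis by (simp add: D_def)
  qed
  with that d show thesis by blast
qed

lemma integrable_translate:
  fixes g :: "'a::euclidean_space \<Rightarrow> 'b::euclidean_space"
  assumes "integrable lborel g"
  shows "integrable lborel (\<lambda>z. g (x + z))"
proof -
  have "integrable (distr lborel borel ((+) x)) g"
    using assms by (simp add: lborel_distr_plus)
  then show ?thesis
    using borel_measurable_integrable[OF assms] by (subst (asm) integrable_distr_eq) auto
qed

text \<open>The error is linear in \<open>g\<close> before taking norms, so Fubini's theorem reduces it to an average over \<open>z\<close>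
  of the translation errors.\<close>

lemma weighted_mollification_error:
  fixes g :: "'a::euclidean_space \<Rightarrow> 'b::euclidean_space"
  assumes g: "integrable lborel g" and [measurable]: "a \<in> borel_measurable borel"
    and a: "\<And>x. 0 \<le> a x"
    and k: "continuous_on UNIV k" "\<And>z. 0 \<le> k z" "\<And>z. k z \<le> B" "\<And>z. d \<le> norm z \<Longrightarrow> k z = 0"
      "(\<integral>\<^sup>+z. k z \<partial>lborel) = 1"
    and dz: "\<And>z. norm z < d \<Longrightarrow> (\<integral>\<^sup>+x. a x * norm (g (z + x) - g x) \<partial>lborel) \<le> e"
  shows "(\<integral>\<^sup>+x. a x * norm ((LINT z|lborel. k z *\<^sub>R g (z + x)) - g x) \<partial>lborel) \<le> e"
proof -
  have [measurable]: "g \<in> borel_measurable borel"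
    using borel_measurable_integrable[OF g] by simp
  have [measurable]: "k \<in> borel_measurable borel"
    using k(1) by (rule borel_measurable_continuous_onI)
  have ik: "integrable lborel k"
    by (rule integrableI_nonneg) (use k in auto)
  have k1: "(LINT z|lborel. k z) = 1"
    using k by (subst integral_eq_nn_integral) auto
  have pt: "ennreal (a x * norm ((LINT z|lborel. k z *\<^sub>R g (z + x)) - g x)) \<le>
      (\<integral>\<^sup>+z. ennreal (a x * (k z * norm (g (z + x) - g x))) \<partial>lborel)" for x
  proof -
    have gx: "integrable lborel (\<lambda>z. g (z + x))"
      using integrable_translate[OF g, of x] by (simp add: add.commute)
    have i1: "integrable lborel (\<lambda>z. k z *\<^sub>R g (z + x))"
    proof (rule Bochner_Integration.integrable_bound[where f = "\<lambda>z. B *\<^sub>R g (z + x)"])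
      show "AE z in lborel. norm (k z *\<^sub>R g (z + x)) \<le> norm (B *\<^sub>R g (z + x))"
      proof (intro AE_I2)
        fix z
        have "k z \<le> \<bar>B\<bar>" using k(3)[of z] by linarith
        then show "norm (k z *\<^sub>R g (z + x)) \<le> norm (B *\<^sub>R g (z + x))"
          using k(2)[of z] by (simp add: mult_right_mono)
      qed
    qed (use gx in auto)
    have i2: "integrable lborel (\<lambda>z. k z *\<^sub>R g x)"
      using ik by (rule integrable_scaleR_left)
    have "(LINT z|lborel. k z *\<^sub>R g (z + x)) - g x = (LINT z|lborel. k z *\<^sub>R (g (z + x) - g x))"
      using i1 i2 k1 ik by (simp add: scaleR_diff_right)
    then have "ennreal (norm ((LINT z|lborel. k z *\<^sub>R g (z + x)) - g x)) \<le>
        (\<integral>\<^sup>+z. norm (k z *\<^sub>R (g (z + x) - g x)) \<partial>lborel)"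
      using integral_norm_bound_ennreal[of lborel "\<lambda>z. k z *\<^sub>R (g (z + x) - g x)"] i1 i2
      by (simp add: scaleR_diff_right)
    also have "\<dots> = (\<integral>\<^sup>+z. k z * norm (g (z + x) - g x) \<partial>lborel)"
      using k by simp
    finally have "ennreal (a x) * ennreal (norm ((LINT z|lborel. k z *\<^sub>R g (z + x)) - g x)) \<le>
      ennreal (a x) * (\<integral>\<^sup>+z. k z * norm (g (z + x) - g x) \<partial>lborel)"
      by (rule mult_left_mono) simp
    also have "\<dots> = (\<integral>\<^sup>+z. ennreal (a x) * ennreal (k z * norm (g (z + x) - g x)) \<partial>lborel)"
      by (rule nn_integral_cmult[symmetric]) measurable
    finally show ?thesis
      using a by (simp add: ennreal_mult')
  qed
  have "(\<integral>\<^sup>+x. a x * norm ((LINT z|lborel. k z *\<^sub>R g (z + x)) - g x) \<partial>lborel)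
     \<le> (\<integral>\<^sup>+x. (\<integral>\<^sup>+z. ennreal (a x * (k z * norm (g (z + x) - g x))) \<partial>lborel) \<partial>lborel)"
    by (intro nn_integral_mono pt)
  also have "\<dots> = (\<integral>\<^sup>+z. (\<integral>\<^sup>+x. ennreal (a x * (k z * norm (g (z + x) - g x))) \<partial>lborel) \<partial>lborel)"
    by (rule lborel_pair.Fubini') measurable
  also have "\<dots> \<le> (\<integral>\<^sup>+z. ennreal (k z) * e \<partial>lborel)"
  proof (rule nn_integral_mono)
    fix z
    have "(\<integral>\<^sup>+x. ennreal (a x * (k z * norm (g (z + x) - g x))) \<partial>lborel) =
       (\<integral>\<^sup>+x. ennreal (k z) * ennreal (a x * norm (g (z + x) - g x)) \<partial>lborel)"
      by (simp add: mult.left_commute[of "a _"] ennreal_mult'[OF k(2)])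
    also have "\<dots> = ennreal (k z) * (\<integral>\<^sup>+x. ennreal (a x * norm (g (z + x) - g x)) \<partial>lborel)"
      by (rule nn_integral_cmult) measurable
    also have "\<dots> \<le> ennreal (k z) * e"
      using dz[of z] k(4)[of z] by (cases "norm z < d") (auto intro: mult_left_mono)
    finally show "(\<integral>\<^sup>+x. ennreal (a x * (k z * norm (g (z + x) - g x))) \<partial>lborel) \<le> ennreal (k z) * e" .
  qed
  also have "\<dots> = (\<integral>\<^sup>+z. k z \<partial>lborel) * e"
    by (rule nn_integral_multc) measurable
  finally show ?thesis
    using k by simp
qed

section \<open>Mollification and integration by parts\<close>

lemma grad_eqI:
  assumes "GDERIV f x :> D" shows "grad f x = D"
  unfolding grad_def
proof (rule the_equality)
  show "GDERIV f x :> D" by (rule assms)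
  fix D' assume "GDERIV f x :> D'"
  then have "(\<lambda>h. h \<bullet> D') = (\<lambda>h. h \<bullet> D)"
    using assms unfolding gderiv_def by (rule has_derivative_unique)
  then have "\<forall>h. h \<bullet> D' = h \<bullet> D" by (auto dest: fun_cong)
  then show "D' = D" by (simp add: vector_eq_ldot)
qed

text \<open>A \<open>C\<^sup>1\<close> replacement for the positive part.\<close>

definition sqpos :: "real \<Rightarrow> real" where "sqpos t = (max 0 t)\<^sup>2"

lemma sqpos_nonneg: "0 \<le> sqpos t" by (simp add: sqpos_def)

lemma sqpos_eq_0_iff: "sqpos t = 0 \<longleftrightarrow> t \<le> 0" by (auto simp: sqpos_def max_def)

lemma sqpos_mono: "s \<le> t \<Longrightarrow> sqpos s \<le> sqpos t"
  unfolding sqpos_def by (intro power_mono) auto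

lemma continuous_sqpos: "continuous_on UNIV sqpos"
  unfolding sqpos_def by (intro continuous_intros)

lemma DERIV_sqpos: "DERIV sqpos t :> 2 * max 0 t"
proof -
  consider "t < 0" | "t = 0" | "0 < t" by linarith
  then show ?thesis
  proof cases
    case 1
    have "DERIV (\<lambda>t. 0) t :> (2 * max 0 t)" using 1 by (simp add: max_def)
    then show ?thesis
      by (rule has_field_derivative_transform_within_open[of _ _ _ "{..<0}"])
        (use 1 in \<open>auto simp: sqpos_def\<close>)
  next
    case 2
    have "(\<lambda>h. sqpos h / h) \<midarrow>0\<rightarrow> 0"
    proof (rule Lim_null_comparison[where g = "\<lambda>h. \<bar>h\<bar>"])
      show "eventually (\<lambda>h. norm (sqpos h / h) \<le> \<bar>h\<bar>) (at 0)"
        by (rule always_eventually) (auto simp: sqpos_def max_def power2_eq_square)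
      show "((\<lambda>h::real. \<bar>h\<bar>) \<longlongrightarrow> 0) (at 0)"
        by (auto intro!: tendsto_eq_intros)
    qed
    then show ?thesis
      unfolding DERIV_def 2 by (simp add: sqpos_def)
  next
    case 3
    have "DERIV (\<lambda>t. t\<^sup>2) t :> (2 * max 0 t)"
      using 3 by (auto intro!: derivative_eq_intros)
    then show ?thesis
      by (rule has_field_derivative_transform_within_open[of _ _ _ "{0<..}"])
        (use 3 in \<open>auto simp: sqpos_def\<close>)
  qed
qed

lemma integrable_continuous_bounded_support:
  fixes f :: "'a::euclidean_space \<Rightarrow> 'b::euclidean_space"
  assumes f: "continuous_on UNIV f" and f0: "\<And>y. y \<notin> cbox a b \<Longrightarrow> f y = 0"
  shows "integrable lborel f" "(LINT y|lborel. f y) = integral (cbox a b) f"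
proof -
  have eq: "(\<lambda>x. indicator (cbox a b) x *\<^sub>R f x) = f"
    using f0 by (auto simp: fun_eq_iff indicator_def)
  have i: "integrable lborel (\<lambda>x. indicator (cbox a b) x *\<^sub>R f x)"
    by (rule borel_integrable_compact) (auto intro: continuous_on_subset[OF f])
  then show "integrable lborel f" unfolding eq .
  have "(LINT y:cbox a b|lborel. f y) = integral (cbox a b) f"
    by (rule set_borel_integral_eq_integral) (use i in \<open>simp add: set_integrable_def\<close>)
  then show "(LINT y|lborel. f y) = integral (cbox a b) f"
    by (simp add: set_lebesgue_integral_def eq)
qed

lemma integral_translate:
  fixes f :: "'a::euclidean_space \<Rightarrow> 'b::euclidean_space"
  assumes [measurable]: "f \<in> borel_measurable borel"
  shows "(LINT y|lborel. f (x + y)) = (LINT y|lborel. f y)"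
  by (subst (2) lborel_distr_plus[of x, symmetric], subst integral_distr) auto

text \<open>One derivative suffices for \<open>C\<^sup>1\<close> test functions, so the kernel is a multiple of
  \<open>((d\<^sup>2 - \<bar>z\<bar>\<^sup>2)\<^sub>+)\<^sup>2\<close>.\<close>

lemma bump_kernel_exists:
  fixes d :: real
  assumes d: "0 < d"
  obtains k :: "'a::euclidean_space \<Rightarrow> real" and k' B where
    "\<And>z. GDERIV k z :> k' z" "continuous_on UNIV k" "continuous_on UNIV k'"
    "\<And>z. 0 \<le> k z" "\<And>z. k z \<le> B" "\<And>z. d \<le> norm z \<Longrightarrow> k z = 0"
    "\<And>z. d \<le> norm z \<Longrightarrow> k' z = 0" "(\<integral>\<^sup>+z. k z \<partial>lborel) = 1"
proof -
  define h :: "'a \<Rightarrow> real" where "h z = sqpos (d\<^sup>2 - z \<bullet> z)" for z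
  define h' :: "'a \<Rightarrow> 'a" where "h' z = (2 * max 0 (d\<^sup>2 - z \<bullet> z)) *\<^sub>R (- (2 *\<^sub>R z))" for z
  have dh: "GDERIV h z :> h' z" for z
    unfolding h_def h'_def
  proof (rule GDERIV_DERIV_compose[OF _ DERIV_sqpos])
    show "GDERIV (\<lambda>z. d\<^sup>2 - z \<bullet> z) z :> - (2 *\<^sub>R z)"
      unfolding gderiv_def
      by (auto intro!: derivative_eq_intros simp: inner_commute)
  qed
  have ch: "continuous_on UNIV h"
    unfolding h_def by (intro continuous_on_compose2[OF continuous_sqpos] continuous_intros) auto
  have ch': "continuous_on UNIV h'"
    unfolding h'_def by (intro continuous_intros)
  have out: "d\<^sup>2 - z \<bullet> z \<le> 0" if "d \<le> norm z" for z :: 'a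
    using power_mono[OF that, of 2] d by (simp add: power2_norm_eq_inner)
  have h0: "h z = 0" "h' z = 0" if "d \<le> norm z" for z
    using out[OF that] by (auto simp: h_def h'_def sqpos_eq_0_iff)
  have hB: "h z \<le> sqpos (d\<^sup>2)" for z
    unfolding h_def by (intro sqpos_mono) auto
  have hnn: "0 \<le> h z" for z by (simp add: h_def sqpos_nonneg)
  obtain a :: 'a where a: "cball 0 d \<subseteq> cbox (-a) a"
    using bounded_subset_cbox_symmetric[OF bounded_cball] by blast
  have ih: "integrable lborel h"
    by (rule integrable_continuous_bounded_support(1)[OF ch, of "-a" a])
      (use a h0(1) in \<open>force simp: subset_iff\<close>)
  define I where "I = (LINT z|lborel. h z)"
  have I: "0 < I"
  proof -
    have "0 \<le> I" unfolding I_def using hnn by (intro integral_nonneg_AE) auto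
    moreover have "I \<noteq> 0"
    proof
      assume "I = 0"
      then have "AE z in lborel. h z = 0"
        unfolding I_def using ih hnn by (subst (asm) integral_nonneg_eq_0_iff_AE) auto
      moreover have "h z \<noteq> 0" if "z \<in> ball 0 d" for z
        using that d unfolding h_def sqpos_eq_0_iff
        by (simp add: power2_norm_eq_inner[symmetric] not_le power_strict_mono)
      ultimately have "AE z in lborel. z \<notin> ball (0::'a) d"
        by (auto elim: eventually_mono)
      then have "emeasure lborel (ball (0::'a) d) = 0"
        by (subst (asm) AE_iff_measurable[of "ball 0 d"]) auto
      then show False
        using d unit_ball_vol_pos[of "real DIM('a)"] by (simp add: emeasure_ball)
    qed
    ultimately show ?thesis by simp
  qed
  define k where "k z = h z / I" for z
  define k' where "k' z = (1 / I) *\<^sub>R h' z" for z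
  have "GDERIV k z :> k' z" for z
    using dh[of z] I unfolding gderiv_def k_def k'_def
    by (auto intro!: derivative_eq_intros)
  moreover have "continuous_on UNIV k" "continuous_on UNIV k'"
    using I unfolding k_def k'_def by (auto intro!: continuous_intros ch ch')
  moreover have "(\<integral>\<^sup>+z. k z \<partial>lborel) = 1"
  proof -
    have "(\<integral>\<^sup>+z. k z \<partial>lborel) = ennreal (LINT z|lborel. k z)"
      by (rule nn_integral_eq_integral) (use ih hnn I in \<open>auto simp: k_def\<close>)
    then show ?thesis using I by (simp add: k_def I_def[symmetric])
  qed
  ultimately show thesis
    using that[of k k' "sqpos (d\<^sup>2) / I"] h0 hB hnn I
    by (auto simp: k_def k'_def divide_right_mono)
qed

text \<open>Differentiation under the integral sign, carried out on a box that contains the supports of all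
  \<open>k (y - x)\<close> with \<open>x\<close> near a given point.\<close>

lemma GDERIV_mollification:
  fixes U k :: "'a::euclidean_space \<Rightarrow> real" and k' :: "'a \<Rightarrow> 'a"
  assumes U: "continuous_on UNIV U" and k: "\<And>z. GDERIV k z :> k' z" "continuous_on UNIV k" "continuous_on UNIV k'"
    and k0: "\<And>z. d \<le> norm z \<Longrightarrow> k z = 0" "\<And>z. d \<le> norm z \<Longrightarrow> k' z = 0"
  shows "GDERIV (\<lambda>x. LINT y|lborel. k (y - x) * U y) x :> - (LINT y|lborel. U y *\<^sub>R k' (y - x))"
    and "continuous_on UNIV (\<lambda>x. LINT y|lborel. U y *\<^sub>R k' (y - x))"
proof -
  note [continuous_intros] = continuous_on_compose2[OF U] continuous_on_compose2[OF k(2)]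
    continuous_on_compose2[OF k(3)]
  have local: "GDERIV (\<lambda>x. LINT y|lborel. k (y - x) * U y) x0 :> - (LINT y|lborel. U y *\<^sub>R k' (y - x0)) \<and>
      continuous_on (ball x0 1) (\<lambda>x. LINT y|lborel. U y *\<^sub>R k' (y - x))" for x0
  proof -
    obtain a b where ab: "ball x0 (1 + d) \<subseteq> cbox a b"
      using bounded_subset_cbox_symmetric[OF bounded_ball] by blast
    have far: "d \<le> norm (y - x)" if "x \<in> ball x0 1" "y \<notin> cbox a b" for x y
    proof -
      have "y \<notin> ball x0 (1 + d)" using that ab by auto
      then show ?thesis
        using that norm_triangle_ineq[of "y - x" "x - x0"] by (auto simp: dist_norm norm_minus_commute)
    qed
    have e1: "(LINT y|lborel. k (y - x) * U y) = integral (cbox a b) (\<lambda>y. k (y - x) * U y)"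
      if "x \<in> ball x0 1" for x
      by (rule integrable_continuous_bounded_support(2))
        (use far[OF that] k0 in \<open>auto intro!: continuous_intros\<close>)
    have e2: "(LINT y|lborel. U y *\<^sub>R k' (y - x)) = integral (cbox a b) (\<lambda>y. U y *\<^sub>R k' (y - x))"
      if "x \<in> ball x0 1" for x
      by (rule integrable_continuous_bounded_support(2))
        (use far[OF that] k0 in \<open>auto intro!: continuous_intros\<close>)
    have int2: "(\<lambda>y. U y *\<^sub>R k' (y - x)) integrable_on cbox a b" for x
      by (intro integrable_continuous continuous_intros) auto
    define fx where "fx x y = blinfun_inner_left (- (U y *\<^sub>R k' (y - x)))" for x y
    have "((\<lambda>x. integral (cbox a b) (\<lambda>y. k (y - x) * U y)) has_derivative
        blinfun_apply (integral (cbox a b) (fx x0))) (at x0 within ball x0 1)"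
    proof (rule leibniz_rule)
      fix x t
      have "((\<lambda>x. k (t - x)) has_derivative (\<lambda>h. (- h) \<bullet> k' (t - x))) (at x)"
        by (rule has_derivative_compose[of "\<lambda>x. t - x" "\<lambda>h. - h" x UNIV k])
          (use k(1)[of "t - x"] in \<open>auto intro!: derivative_eq_intros simp: gderiv_def\<close>)
      from has_derivative_mult_left[OF this, of "U t"]
      have "((\<lambda>x. k (t - x) * U t) has_derivative blinfun_apply (fx x t)) (at x)"
        by (rule has_derivative_eq_rhs) (auto simp: fx_def fun_eq_iff)
      then show "((\<lambda>x. k (t - x) * U t) has_derivative blinfun_apply (fx x t)) (at x within ball x0 1)"
        by (rule has_derivative_at_withinI)
    next
      fix x show "(\<lambda>y. k (y - x) * U y) integrable_on cbox a b"
        by (intro integrable_continuous continuous_intros) auto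
    next
      show "continuous_on (ball x0 1 \<times> cbox a b) (\<lambda>(x, t). fx x t)"
        unfolding fx_def split_beta
        by (intro continuous_intros bounded_linear.continuous_on[OF bounded_linear_blinfun_inner_left]) auto
    qed auto
    moreover have "integral (cbox a b) (fx x0) = blinfun_inner_left (- integral (cbox a b) (\<lambda>y. U y *\<^sub>R k' (y - x0)))"
      unfolding fx_def integral_neg[symmetric]
      by (subst integral_linear[OF _ bounded_linear_blinfun_inner_left, symmetric])
        (use int2[of x0] in \<open>auto simp: o_def integrable_neg\<close>)
    ultimately have "((\<lambda>x. integral (cbox a b) (\<lambda>y. k (y - x) * U y)) has_derivative
        (\<lambda>h. h \<bullet> - integral (cbox a b) (\<lambda>y. U y *\<^sub>R k' (y - x0)))) (at x0)"
      using at_within_open[of x0 "ball x0 1"] by (simp add: inner_minus_right)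
    then have "((\<lambda>x. LINT y|lborel. k (y - x) * U y) has_derivative
        (\<lambda>h. h \<bullet> - integral (cbox a b) (\<lambda>y. U y *\<^sub>R k' (y - x0)))) (at x0)"
      by (rule has_derivative_transform_within_open[of _ _ _ _ "ball x0 1"]) (auto simp: e1)
    moreover have "continuous_on (ball x0 1) (\<lambda>x. integral (cbox a b) (\<lambda>y. U y *\<^sub>R k' (y - x)))"
      by (rule integral_continuous_on_param) (unfold split_beta, intro continuous_intros, auto)
    then have "continuous_on (ball x0 1) (\<lambda>x. LINT y|lborel. U y *\<^sub>R k' (y - x))"
      by (rule continuous_on_eq) (simp add: e2)
    ultimately show ?thesis
      using e2[of x0] by (simp add: gderiv_def)
  qed
  then show "GDERIV (\<lambda>x. LINT y|lborel. k (y - x) * U y) x :> - (LINT y|lborel. U y *\<^sub>R k' (y - x))"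
    by blast
  show "continuous_on UNIV (\<lambda>x. LINT y|lborel. U y *\<^sub>R k' (y - x))"
    unfolding continuous_on_eq_continuous_at[OF open_UNIV]
    using local by (metis UNIV_I centre_in_ball continuous_on_eq_continuous_at open_ball zero_less_one)
qed

lemma mollification_error:
  fixes U k :: "'a::euclidean_space \<Rightarrow> real"
  assumes U: "continuous_on UNIV U" and k: "continuous_on UNIV k" "\<And>z. 0 \<le> k z"
     "\<And>z. d \<le> norm z \<Longrightarrow> k z = 0" "(\<integral>\<^sup>+z. k z \<partial>lborel) = 1"
    and osc: "\<And>y. norm (y - x) < d \<Longrightarrow> \<bar>U y - U x\<bar> \<le> e"
  shows "\<bar>(LINT y|lborel. k (y - x) * U y) - U x\<bar> \<le> e"
proof -
  note [continuous_intros] = continuous_on_compose2[OF U] continuous_on_compose2[OF k(1)]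
  have km: "k \<in> borel_measurable borel" using k(1) by (rule borel_measurable_continuous_onI)
  obtain a b where ab: "ball x d \<subseteq> cbox a b"
    using bounded_subset_cbox_symmetric[OF bounded_ball] by blast
  have far: "k (y - x) = 0" if "y \<notin> cbox a b" for y
    using that ab k(3)[of "y - x"] by (force simp: dist_norm norm_minus_commute)
  have i1: "integrable lborel (\<lambda>y. k (y - x) * U y)" "integrable lborel (\<lambda>y. k (y - x))"
    by (rule integrable_continuous_bounded_support(1)[of _ a b];
        use far in \<open>auto intro!: continuous_intros\<close>)+
  have "(LINT y|lborel. k (y - x)) = (LINT y|lborel. k y)"
    using integral_translate[OF km, of "- x"] by (simp add: add.commute)
  also have "\<dots> = 1"
    using k km by (subst integral_eq_nn_integral) auto
  finally have k1: "(LINT y|lborel. k (y - x)) = 1" .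
  have "(LINT y|lborel. k (y - x) * U y) - U x = (LINT y|lborel. k (y - x) * (U y - U x))"
    using i1 k1 by (simp add: right_diff_distrib)
  also have "\<bar>\<dots>\<bar> \<le> (LINT y|lborel. \<bar>k (y - x) * (U y - U x)\<bar>)"
    by (rule integral_abs_bound)
  also have "\<dots> \<le> (LINT y|lborel. k (y - x) * e)"
  proof (rule integral_mono)
    show "integrable lborel (\<lambda>y. \<bar>k (y - x) * (U y - U x)\<bar>)"
      using i1 by (auto simp: right_diff_distrib)
    show "\<bar>k (y - x) * (U y - U x)\<bar> \<le> k (y - x) * e" for y
      using osc[of y] k(2)[of "y - x"] k(3)[of "y - x"]
      by (cases "norm (y - x) < d") (auto simp: abs_mult mult_left_mono)
  qed (use i1 in auto)
  also have "\<dots> = e" using k1 by simp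
  finally show ?thesis .
qed

text \<open>The integral of \<open>x \<mapsto> f (x + t b)\<close> does not depend on \<open>t\<close>, by translation invariance; the left-hand
  side is its derivative at \<open>t = 0\<close>.\<close>

lemma integral_directional_derivative_eq_0:
  fixes f :: "'a::euclidean_space \<Rightarrow> real" and f' :: "'a \<Rightarrow> 'a"
  assumes f: "\<And>x. GDERIV f x :> f' x" and f': "continuous_on UNIV f'"
    and supp: "\<And>x. R < norm x \<Longrightarrow> f x = 0" "\<And>x. R < norm x \<Longrightarrow> f' x = 0"
  shows "(LINT x|lborel. f' x \<bullet> b) = 0"
proof -
  have cf: "continuous_on UNIV f"
    using f unfolding gderiv_def by (intro continuous_at_imp_continuous_on) (auto intro: has_derivative_continuous)
  note [continuous_intros] = continuous_on_compose2[OF cf] continuous_on_compose2[OF f']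
  obtain a c where ac: "cball (0::'a) (R + norm b) \<subseteq> cbox a c"
    using bounded_subset_cbox_symmetric[OF bounded_cball] by blast
  have far: "R < norm (x + t *\<^sub>R b)" if "t \<in> {-1<..<1}" "x \<notin> cbox a c" for x t
  proof -
    have "x \<notin> cball 0 (R + norm b)" using that ac by auto
    moreover have "norm (t *\<^sub>R b) \<le> norm b" using that by (auto simp: mult_left_le_one_le)
    ultimately show ?thesis
      using norm_triangle_ineq4[of "x + t *\<^sub>R b" "t *\<^sub>R b"] by auto
  qed
  have e1: "integral (cbox a c) (\<lambda>x. f (x + t *\<^sub>R b)) = (LINT x|lborel. f x)" if "t \<in> {-1<..<1}" for t
  proof -
    have "(LINT x|lborel. f (x + t *\<^sub>R b)) = integral (cbox a c) (\<lambda>x. f (x + t *\<^sub>R b))"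
      by (rule integrable_continuous_bounded_support(2))
        (use far[OF that] supp in \<open>auto intro!: continuous_intros\<close>)
    then show ?thesis
      using integral_translate[OF borel_measurable_continuous_onI[OF cf], of "t *\<^sub>R b"]
      by (simp add: add.commute)
  qed
  have "((\<lambda>t. integral (cbox a c) (\<lambda>x. f (x + t *\<^sub>R b))) has_field_derivative
     integral (cbox a c) (\<lambda>x. f' (x + 0 *\<^sub>R b) \<bullet> b)) (at 0 within {-1<..<1})"
  proof (rule leibniz_rule_field_derivative)
    fix t :: real and x :: 'a
    have "((\<lambda>t. f (x + t *\<^sub>R b)) has_derivative (\<lambda>h. (h *\<^sub>R b) \<bullet> f' (x + t *\<^sub>R b))) (at t)"
      by (rule has_derivative_compose[of "\<lambda>t. x + t *\<^sub>R b" "\<lambda>h. h *\<^sub>R b" t UNIV f])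
        (use f[of "x + t *\<^sub>R b"] in \<open>auto intro!: derivative_eq_intros simp: gderiv_def\<close>)
    then show "((\<lambda>t. f (x + t *\<^sub>R b)) has_field_derivative f' (x + t *\<^sub>R b) \<bullet> b) (at t within {-1<..<1})"
      unfolding has_field_derivative_def
      by (rule has_derivative_at_withinI[OF has_derivative_eq_rhs]) (auto simp: inner_commute)
  next
    fix t :: real show "(\<lambda>x. f (x + t *\<^sub>R b)) integrable_on cbox a c"
      by (intro integrable_continuous continuous_intros) auto
  next
    show "continuous_on ({-1<..<1} \<times> cbox a c) (\<lambda>(t, x). f' (x + t *\<^sub>R b) \<bullet> b)"
      unfolding split_beta by (intro continuous_intros) auto
  qed auto
  then have "((\<lambda>t. integral (cbox a c) (\<lambda>x. f (x + t *\<^sub>R b))) has_field_derivative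
     integral (cbox a c) (\<lambda>x. f' x \<bullet> b)) (at 0)"
    using at_within_open[of 0 "{-1<..<1::real}"] by simp
  then have "((\<lambda>t. LINT x|lborel. f x) has_field_derivative integral (cbox a c) (\<lambda>x. f' x \<bullet> b)) (at 0)"
    by (rule has_field_derivative_transform_within_open[of _ _ _ "{-1<..<1}"]) (auto simp: e1)
  then have "integral (cbox a c) (\<lambda>x. f' x \<bullet> b) = 0"
    by (rule DERIV_unique) simp
  moreover have "(LINT x|lborel. f' x \<bullet> b) = integral (cbox a c) (\<lambda>x. f' x \<bullet> b)"
    by (rule integrable_continuous_bounded_support(2))
      (use far[of 0] supp in \<open>auto intro!: continuous_intros\<close>)
  ultimately show ?thesis by simp
qed

lemma GDERIV_zero_off_closed:
  fixes f :: "'a::euclidean_space \<Rightarrow> real"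
  assumes "closed K" "\<And>x. x \<notin> K \<Longrightarrow> f x = 0" "x \<notin> K" "GDERIV f x :> D"
  shows "D = 0"
proof -
  have "((\<lambda>x. 0::real) has_derivative (\<lambda>h. h \<bullet> D)) (at x)"
    by (rule has_derivative_transform_within_open[of f _ _ _ "- K"])
      (use assms in \<open>auto simp: gderiv_def\<close>)
  then have "GDERIV (\<lambda>x. 0) x :> D" by (simp add: gderiv_def)
  then show ?thesis
    using grad_eqI[of "\<lambda>x. 0" x D] grad_eqI[OF GDERIV_const[of 0 x]] by simp
qed

text \<open>The product \<open>\<phi> (V \<bullet> b)\<close>, extended by zero, is \<open>C\<^sup>1\<close> with bounded support, so its derivative in the
  direction \<open>b\<close> has integral zero.\<close>

lemma integration_by_parts:
  fixes V :: "'a::euclidean_space \<Rightarrow> 'a" and \<phi> :: "'a \<Rightarrow> real"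
  assumes U: "open U" and K: "compact K" "K \<subseteq> U"
    and \<phi>: "\<And>x. GDERIV \<phi> x :> \<phi>' x" "continuous_on UNIV \<phi>'" "\<And>x. x \<notin> K \<Longrightarrow> \<phi> x = 0"
    and V: "\<And>b x. b \<in> Basis \<Longrightarrow> x \<in> U \<Longrightarrow> GDERIV (\<lambda>x. V x \<bullet> b) x :> DV b x"
    and DV: "\<And>b. b \<in> Basis \<Longrightarrow> continuous_on U (DV b)"
  shows "(LINT x:K|lborel. V x \<bullet> \<phi>' x) = - (LINT x:K|lborel. \<phi> x * (\<Sum>b\<in>Basis. DV b x \<bullet> b))"
proof -
  have cK: "closed K" using K(1) by (rule compact_imp_closed)
  have \<phi>'0: "\<phi>' x = 0" if "x \<notin> K" for x
    using GDERIV_zero_off_closed[OF cK \<phi>(3) that \<phi>(1)] .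
  have c\<phi>: "continuous_on UNIV \<phi>"
    using \<phi>(1) unfolding gderiv_def by (intro continuous_at_imp_continuous_on) (auto intro: has_derivative_continuous)
  have cV: "continuous_on U (\<lambda>x. V x \<bullet> b)" if "b \<in> Basis" for b
    using V[OF that] unfolding gderiv_def by (intro continuous_at_imp_continuous_on) (auto intro: has_derivative_continuous)
  have UN: "U \<union> (- K) = UNIV" using K by auto
  obtain R where R: "\<And>x. x \<in> K \<Longrightarrow> norm x \<le> R"
    using compact_imp_bounded[OF K(1)] by (auto simp: bounded_iff)
  have sub: "continuous_on U \<phi>" "continuous_on U \<phi>'"
    using c\<phi> \<phi>(2) by (auto intro: continuous_on_subset)
  have int: "set_integrable lborel K g" if "continuous_on U g" for g :: "'a \<Rightarrow> real"
    unfolding set_integrable_def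
    by (rule borel_integrable_compact) (use K that in \<open>auto intro: continuous_on_subset\<close>)
  have *: "(LINT x:K|lborel. (V x \<bullet> b) * (\<phi>' x \<bullet> b)) = - (LINT x:K|lborel. \<phi> x * (DV b x \<bullet> b))"
    if b: "b \<in> Basis" for b
  proof -
    define f where "f x = (if x \<in> K then \<phi> x * (V x \<bullet> b) else 0)" for x
    define f' where "f' x = (if x \<in> K then \<phi> x *\<^sub>R DV b x + (V x \<bullet> b) *\<^sub>R \<phi>' x else 0)" for x
    have fU: "f x = \<phi> x * (V x \<bullet> b)" "f' x = \<phi> x *\<^sub>R DV b x + (V x \<bullet> b) *\<^sub>R \<phi>' x" for x
      using \<phi>(3)[of x] \<phi>'0[of x] by (auto simp: f_def f'_def)
    have "GDERIV f x :> f' x" for x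
    proof (cases "x \<in> U")
      case True
      show ?thesis unfolding fU
        using GDERIV_mult[OF \<phi>(1) V[OF b True]] by (simp add: fU fun_eq_iff gderiv_def)
    next
      case False
      then have "x \<notin> K" using K by auto
      have "((\<lambda>x. 0) has_derivative (\<lambda>h. h \<bullet> f' x)) (at x)"
        using \<open>x \<notin> K\<close> by (simp add: f'_def)
      then show ?thesis unfolding gderiv_def
        by (rule has_derivative_transform_within_open[of _ _ _ _ "- K"])
          (use \<open>x \<notin> K\<close> cK in \<open>auto simp: f_def\<close>)
    qed
    moreover have "continuous_on UNIV f'"
      unfolding UN[symmetric]
    proof (rule continuous_on_open_Un[OF U])
      show "continuous_on U f'"
        unfolding fU by (intro continuous_intros sub cV[OF b] DV[OF b])
      show "continuous_on (- K) f'"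
        by (rule continuous_on_eq[of _ "\<lambda>x. 0"]) (auto simp: f'_def)
    qed (use cK in auto)
    ultimately have "(LINT x|lborel. f' x \<bullet> b) = 0"
      by (rule integral_directional_derivative_eq_0[of _ _ R]) (use R in \<open>force simp: f_def f'_def\<close>)+
    moreover have "(LINT x|lborel. f' x \<bullet> b) =
        (LINT x:K|lborel. (V x \<bullet> b) * (\<phi>' x \<bullet> b) + \<phi> x * (DV b x \<bullet> b))"
      unfolding set_lebesgue_integral_def
      by (intro Bochner_Integration.integral_cong) (auto simp: f'_def inner_add_left)
    moreover have "set_integrable lborel K (\<lambda>x. (V x \<bullet> b) * (\<phi>' x \<bullet> b))"
      "set_integrable lborel K (\<lambda>x. \<phi> x * (DV b x \<bullet> b))"
      by (intro int continuous_intros sub cV[OF b] DV[OF b])+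
    ultimately show ?thesis
      by (simp add: set_integral_add)
  qed
  have ip: "V x \<bullet> \<phi>' x = (\<Sum>b\<in>Basis. (V x \<bullet> b) * (\<phi>' x \<bullet> b))" for x
    by (rule euclidean_inner)
  have "(LINT x:K|lborel. V x \<bullet> \<phi>' x) = (LINT x:K|lborel. \<Sum>b\<in>Basis. (V x \<bullet> b) * (\<phi>' x \<bullet> b))"
    by (simp only: ip)
  also have "\<dots> = (\<Sum>b\<in>Basis. LINT x:K|lborel. (V x \<bullet> b) * (\<phi>' x \<bullet> b))"
    unfolding set_lebesgue_integral_def scaleR_sum_right
    by (rule Bochner_Integration.integral_sum)
      (intro int[unfolded set_integrable_def] continuous_intros sub cV DV)
  also have "\<dots> = - (\<Sum>b\<in>Basis. LINT x:K|lborel. \<phi> x * (DV b x \<bullet> b))"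
    by (simp add: * sum_negf)
  also have "(\<Sum>b\<in>Basis. LINT x:K|lborel. \<phi> x * (DV b x \<bullet> b)) = (LINT x:K|lborel. \<Sum>b\<in>Basis. \<phi> x * (DV b x \<bullet> b))"
    unfolding set_lebesgue_integral_def scaleR_sum_right
    by (rule Bochner_Integration.integral_sum[symmetric])
      (intro int[unfolded set_integrable_def] continuous_intros sub cV DV)
  finally show ?thesis
    by (simp add: sum_distrib_left)
qed

section \<open>Comparison with weak solutions\<close>

text \<open>By the Cauchy-Schwarz inequality the product is at least
  \<open>(\<bar>a\<bar>\<^bsup>p-1\<^esup> - \<bar>b\<bar>\<^bsup>p-1\<^esup>) (\<bar>a\<bar> - \<bar>b\<bar>)\<close>, whose factors have the same sign.\<close>

lemma p_laplace_monotone: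
  fixes a b :: "'a::real_inner"
  assumes "2 \<le> p"
  shows "0 \<le> (norm a powr (p - 2) *\<^sub>R a - norm b powr (p - 2) *\<^sub>R b) \<bullet> (a - b)"
proof -
  define r s where "r = norm a powr (p - 2)" and "s = norm b powr (p - 2)"
  have rs: "0 \<le> r" "0 \<le> s" by (auto simp: r_def s_def)
  have mono: "0 \<le> (r * norm a - s * norm b) * (norm a - norm b)"
  proof (cases "norm a \<le> norm b")
    case True
    then have "r * norm a \<le> s * norm b"
      unfolding r_def s_def using assms by (intro mult_mono powr_mono2) auto
    then show ?thesis using True by (simp add: mult_nonpos_nonpos)
  next
    case False
    then have "s * norm b \<le> r * norm a"
      unfolding r_def s_def using assms by (intro mult_mono powr_mono2) auto
    then show ?thesis using False by simp
  qed
  have "(r + s) * (a \<bullet> b) \<le> (r + s) * (norm a * norm b)"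
    using rs by (intro mult_left_mono norm_cauchy_schwarz) auto
  moreover have "(r *\<^sub>R a - s *\<^sub>R b) \<bullet> (a - b) = r * (norm a * norm a) + s * (norm b * norm b) - (r + s) * (a \<bullet> b)"
    by (simp add: inner_diff_left inner_diff_right inner_commute[of b a] algebra_simps
        flip: power2_norm_eq_inner power2_eq_square)
  ultimately show ?thesis
    using mono unfolding r_def[symmetric] s_def[symmetric] by (simp add: algebra_simps)
qed

lemma borel_measurable_lebesgueI: "f \<in> borel_measurable borel \<Longrightarrow> f \<in> borel_measurable lebesgue"
  by (simp add: measurable_completion)

lemma lebesgue_borel_version:
  fixes f :: "'a::euclidean_space \<Rightarrow> 'b::euclidean_space"
  assumes "f \<in> borel_measurable lebesgue"
  obtains g where "g \<in> borel_measurable borel" "AE x in lborel. f x = g x"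
proof -
  have "\<exists>h. h \<in> borel_measurable lborel \<and> (AE x in lborel. f x \<bullet> b = h x)" for b
    using completion_ex_borel_measurable_real[of "\<lambda>x. f x \<bullet> b" lborel] assms by auto
  then obtain h where h: "\<And>b. h b \<in> borel_measurable lborel" "\<And>b. AE x in lborel. f x \<bullet> b = h b x"
    by metis
  define g where "g x = (\<Sum>b\<in>Basis. h b x *\<^sub>R b)" for x
  have [measurable]: "h b \<in> borel_measurable borel" for b using h(1)[of b] by simp
  have "AE x in lborel. \<forall>b\<in>Basis. f x \<bullet> b = h b x"
    by (intro AE_finite_allI finite_Basis h(2))
  then have "AE x in lborel. f x = g x"
  proof eventually_elim
    case (elim x)
    then have "g x = (\<Sum>b\<in>Basis. (f x \<bullet> b) *\<^sub>R b)"
      unfolding g_def by (intro sum.cong) auto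
    then show ?case by (simp add: euclidean_representation)
  qed
  moreover have "g \<in> borel_measurable borel"
    unfolding g_def by measurable
  ultimately show thesis using that by blast
qed

text \<open>The definition of the weak gradient, tested with the translated kernel \<open>y \<mapsto> k (y - x)\<close>: mollification
  commutes with taking gradients.\<close>

lemma mollified_weak_gradient:
  fixes u :: "'a::euclidean_space \<Rightarrow> real" and G :: "'a \<Rightarrow> 'a"
  assumes W: "weak_gradient \<Omega> u G" and G: "set_borel_measurable lebesgue \<Omega> G"
    and ball: "cball x d \<subseteq> \<Omega>"
    and U: "continuous_on UNIV U" "\<And>y. y \<in> cball x d \<Longrightarrow> U y = u y"
    and g: "g \<in> borel_measurable borel" "AE y in lborel. y \<in> cball x d \<longrightarrow> g y = G y"
    and k: "\<And>z. GDERIV k z :> k' z" "continuous_on UNIV k" "continuous_on UNIV k'"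
      "\<And>z. d \<le> norm z \<Longrightarrow> k z = 0" "\<And>z. d \<le> norm z \<Longrightarrow> k' z = 0"
  shows "- (LINT y|lborel. U y *\<^sub>R k' (y - x)) = (LINT z|lborel. k z *\<^sub>R g (z + x))"
proof -
  note [continuous_intros] = continuous_on_compose2[OF U(1)] continuous_on_compose2[OF k(2)]
    continuous_on_compose2[OF k(3)]
  have [measurable]: "g \<in> borel_measurable borel" "k \<in> borel_measurable borel"
    by (rule g, rule borel_measurable_continuous_onI[OF k(2)])
  define \<psi> where "\<psi> y = k (y - x)" for y
  have d\<psi>: "GDERIV \<psi> y :> k' (y - x)" for y
  proof -
    have "((\<lambda>y. k (y - x)) has_derivative (\<lambda>h. h \<bullet> k' (y - x))) (at y)"
      by (rule has_derivative_compose[of "\<lambda>y. y - x" "\<lambda>h. h" y UNIV k])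
        (use k(1)[of "y - x"] in \<open>auto intro!: derivative_eq_intros simp: gderiv_def\<close>)
    then show ?thesis by (simp add: gderiv_def \<psi>_def[abs_def])
  qed
  have gr: "grad \<psi> y = k' (y - x)" for y by (rule grad_eqI[OF d\<psi>])
  have out: "k (y - x) = 0" "k' (y - x) = 0" if "y \<notin> cball x d" for y
    using that k(4,5)[of "y - x"] by (auto simp: dist_norm norm_minus_commute)
  have supp: "closure {y. \<psi> y \<noteq> 0} \<subseteq> cball x d"
    by (rule closure_minimal[OF _ closed_cball]) (use out(1) in \<open>force simp: \<psi>_def\<close>)
  have \<psi>C: "\<psi> \<in> C1_0 \<Omega>"
    unfolding C1_0_def
  proof (intro CollectI conjI allI)
    show "GDERIV \<psi> y :> grad \<psi> y" for y unfolding gr by (rule d\<psi>)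
    show "continuous_on UNIV (grad \<psi>)"
      unfolding gr[abs_def] by (intro continuous_intros) auto
    show "compact (closure {y. \<psi> y \<noteq> 0})"
      using supp by (meson bounded_cball bounded_subset closed_closure compact_eq_bounded_closed)
  qed (use supp ball in auto)
  have eq: "(LINT y:\<Omega>|lebesgue. u y *\<^sub>R k' (y - x)) = - (LINT y:\<Omega>|lebesgue. \<psi> y *\<^sub>R G y)"
    using bspec[OF W[unfolded weak_gradient_def] \<psi>C] by (simp only: gr)
  have "(LINT y:\<Omega>|lebesgue. u y *\<^sub>R k' (y - x)) = (LINT y|lebesgue. U y *\<^sub>R k' (y - x))"
    unfolding set_lebesgue_integral_def
  proof (rule Bochner_Integration.integral_cong)
    fix y show "indicat_real \<Omega> y *\<^sub>R u y *\<^sub>R k' (y - x) = U y *\<^sub>R k' (y - x)"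
      using ball U(2)[of y] out[of y] by (cases "y \<in> cball x d") auto
  qed simp
  also have "\<dots> = (LINT y|lborel. U y *\<^sub>R k' (y - x))"
    by (rule integral_completion)
      (simp, intro borel_measurable_continuous_onI continuous_intros, auto)
  finally have l: "(LINT y:\<Omega>|lebesgue. u y *\<^sub>R k' (y - x)) = (LINT y|lborel. U y *\<^sub>R k' (y - x))" .
  have km: "(\<lambda>y. k (y - x) *\<^sub>R g y) \<in> borel_measurable borel" "(\<lambda>y. k (y - x)) \<in> borel_measurable borel"
    by measurable
  have "(LINT y:\<Omega>|lebesgue. \<psi> y *\<^sub>R G y) = (LINT y|lebesgue. k (y - x) *\<^sub>R g y)"
    unfolding set_lebesgue_integral_def
  proof (rule integral_cong_AE)
    have "(\<lambda>y. k (y - x)) \<in> borel_measurable lebesgue"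
      using km(2) by (simp add: measurable_completion)
    with G have "(\<lambda>y. k (y - x) *\<^sub>R (indicat_real \<Omega> y *\<^sub>R G y)) \<in> borel_measurable lebesgue"
      unfolding set_borel_measurable_def by (rule borel_measurable_scaleR[rotated])
    then show "(\<lambda>y. indicat_real \<Omega> y *\<^sub>R \<psi> y *\<^sub>R G y) \<in> borel_measurable lebesgue"
      by (simp add: \<psi>_def mult.commute)
    show "(\<lambda>y. k (y - x) *\<^sub>R g y) \<in> borel_measurable lebesgue"
      using km(1) by (simp add: measurable_completion)
    show "AE y in lebesgue. indicat_real \<Omega> y *\<^sub>R \<psi> y *\<^sub>R G y = k (y - x) *\<^sub>R g y"
      using AE_completion[OF g(2)]
    proof eventually_elim
      case (elim y)
      then show ?case
        using ball out[of y] by (cases "y \<in> cball x d") (auto simp: \<psi>_def)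
    qed
  qed
  also have "\<dots> = (LINT y|lborel. k (y - x) *\<^sub>R g y)"
    by (rule integral_completion) (use km(1) in simp)
  also have "\<dots> = (LINT z|lborel. k z *\<^sub>R g (z + x))"
    using integral_translate[OF km(1), of x] by (simp add: add.commute)
  finally show ?thesis using eq l by simp
qed

lemma cutoff_test_function:
  fixes h :: "'a::euclidean_space \<Rightarrow> real"
  assumes K: "closed K" and B: "open B" "K \<subseteq> B"
    and h: "\<And>x. x \<in> B \<Longrightarrow> GDERIV h x :> h' x" "continuous_on B h'"
    and off: "\<And>x. x \<in> B - K \<Longrightarrow> h x \<le> c"
    and \<phi>_def: "\<And>x. \<phi> x = (if x \<in> K then sqpos (h x - c) else 0)"
    and \<phi>'_def: "\<And>x. \<phi>' x = (if x \<in> K then (2 * max 0 (h x - c)) *\<^sub>R h' x else 0)"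
  shows "GDERIV \<phi> x :> \<phi>' x" "continuous_on UNIV \<phi>'"
proof -
  have on: "\<phi> x = sqpos (h x - c)" "\<phi>' x = (2 * max 0 (h x - c)) *\<^sub>R h' x" if "x \<in> B" for x
    using off[of x] that by (auto simp: \<phi>_def \<phi>'_def sqpos_eq_0_iff)
  show "GDERIV \<phi> x :> \<phi>' x"
  proof (cases "x \<in> B")
    case True
    have "GDERIV (\<lambda>x. h x - c) x :> h' x"
      using GDERIV_diff[OF h(1)[OF True] GDERIV_const] by simp
    from GDERIV_DERIV_compose[OF this DERIV_sqpos]
    have "((\<lambda>x. sqpos (h x - c)) has_derivative (\<lambda>y. y \<bullet> \<phi>' x)) (at x)"
      by (simp add: gderiv_def on[OF True])
    then show ?thesis
      unfolding gderiv_def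
      by (rule has_derivative_transform_within_open[OF _ B(1) True]) (simp add: on)
  next
    case False
    have "((\<lambda>x. 0) has_derivative (\<lambda>y. y \<bullet> \<phi>' x)) (at x)"
      using False B by (auto simp: \<phi>'_def)
    then show ?thesis
      unfolding gderiv_def
      by (rule has_derivative_transform_within_open[of _ _ _ _ "- K"])
        (use False B K in \<open>auto simp: \<phi>_def\<close>)
  qed
  have ch: "continuous_on B h"
    using h(1) unfolding gderiv_def by (intro continuous_at_imp_continuous_on) (auto intro: has_derivative_continuous)
  have "continuous_on B \<phi>'"
    by (rule continuous_on_eq[of _ "\<lambda>x. (2 * max 0 (h x - c)) *\<^sub>R h' x"])
      (auto intro!: continuous_intros ch h(2) simp: on)
  moreover have "continuous_on (- K) \<phi>'"
    by (rule continuous_on_eq[of _ "\<lambda>x. 0"]) (auto simp: \<phi>'_def)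
  ultimately have "continuous_on (B \<union> - K) \<phi>'"
    using B K by (intro continuous_on_open_Un) auto
  moreover have "B \<union> - K = UNIV" using B by auto
  ultimately show "continuous_on UNIV \<phi>'" by simp
qed

lemma compact_neighbourhood:
  fixes K :: "'a::euclidean_space set"
  assumes "compact K" shows "compact (\<Union>x\<in>K. cball x r)"
proof -
  have "(\<Union>x\<in>K. cball x r) = {x + y | x y. x \<in> K \<and> y \<in> cball 0 r}"
  proof safe
    fix x z assume "x \<in> K" "z \<in> cball x r"
    then show "\<exists>x' y. z = x' + y \<and> x' \<in> K \<and> y \<in> cball 0 r"
      by (intro exI[of _ x] exI[of _ "z - x"]) (auto simp: dist_norm norm_minus_commute)
  next
    fix x y :: 'a assume "x \<in> K" "y \<in> cball 0 r"
    then show "x + y \<in> (\<Union>x\<in>K. cball x r)"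
      by (intro UN_I[of x]) (auto simp: dist_norm)
  qed
  then show ?thesis using compact_sums[OF assms compact_cball[of 0 r]] by (simp only:)
qed

lemma integral_le_of_nn_integral_le:
  fixes f :: "'a \<Rightarrow> real"
  assumes "(\<integral>\<^sup>+x. f x \<partial>M) \<le> ennreal c" "0 \<le> c" "integrable M f"
  shows "(LINT x|M. f x) \<le> c"
proof -
  have "(LINT x|M. f x) \<le> enn2real (\<integral>\<^sup>+x. f x \<partial>M)"
    unfolding real_lebesgue_integral_def[OF assms(3)] by simp
  also have "\<dots> \<le> c" using assms by (intro enn2real_leI) auto
  finally show ?thesis .
qed


lemma integrable_lebesgue_bounded_support:
  fixes f :: "'a::euclidean_space \<Rightarrow> 'b::euclidean_space"
  assumes "f \<in> borel_measurable lebesgue" "compact K"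
    "\<And>x. x \<notin> K \<Longrightarrow> f x = 0" "AE x in lebesgue. norm (f x) \<le> B x"
    "integrable lebesgue (\<lambda>x. indicat_real K x * B x)"
  shows "integrable lebesgue f"
proof (rule Bochner_Integration.integrable_bound[OF assms(5,1)])
  show "AE x in lebesgue. norm (f x) \<le> norm (indicat_real K x * B x)"
    using assms(4)
  proof eventually_elim
    case (elim x)
    then show ?case using assms(3)[of x] by (cases "x \<in> K") auto
  qed
qed

text \<open>The sign \<open>s = \<plusminus>1\<close> covers both directions of comparison.  Suppose \<open>s (u - w)\<close> is positive somewhere and
  test the equation of \<open>u\<close> and the classical equation of \<open>w\<close> with \<open>\<phi> = ((s (M - w) - 2\<epsilon>)\<^sub>+)\<^sup>2\<close>, where \<open>M\<close> is
  a mollification of \<open>u\<close>.  The difference of the two identities has, by \<open>strict\<close>, one side bounded away from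
  zero uniformly in the mollification scale; the other side is at most the error of replacing the gradient
  of \<open>M\<close> by \<open>G\<close>, by \<open>p_laplace_monotone\<close>.  The set \<open>K\<close> keeps the support of \<open>\<phi>\<close> compact.\<close>

theorem weak_comparison:
  fixes u w :: "'a::euclidean_space \<Rightarrow> real" and G w' V :: "'a \<Rightarrow> 'a"
  assumes p: "2 \<le> p" and \<Omega>: "open \<Omega>" and W: "W1p_loc p \<Omega> u G"
    and eq: "\<And>\<phi>. \<phi> \<in> C1_0 \<Omega> \<Longrightarrow> (\<And>x. 0 \<le> \<phi> x) \<Longrightarrow>
       (LINT x:\<Omega>|lebesgue. norm (G x) powr (p - 2) * (G x \<bullet> grad \<phi> x)) = - (LINT x:\<Omega>|lebesgue. f x * \<phi> x)"
    and u: "continuous_on \<Omega> u"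
    and f: "set_borel_measurable lebesgue \<Omega> f" "\<And>K. compact K \<Longrightarrow> K \<subseteq> \<Omega> \<Longrightarrow> bounded (f ` K)"
    and U: "open U" "U \<subseteq> \<Omega>" and K: "compact K" "K \<subseteq> U"
    and w: "\<And>x. x \<in> U \<Longrightarrow> GDERIV w x :> w' x" "continuous_on U w'"
    and V: "\<And>x. x \<in> U \<Longrightarrow> V x = norm (w' x) powr (p - 2) *\<^sub>R w' x"
    and DV: "\<And>b x. b \<in> Basis \<Longrightarrow> x \<in> U \<Longrightarrow> GDERIV (\<lambda>x. V x \<bullet> b) x :> DV b x"
      "\<And>b. b \<in> Basis \<Longrightarrow> continuous_on U (DV b)"
    and s: "s * s = (1::real)"
    and off: "\<And>x. x \<in> U - K \<Longrightarrow> s * (u x - w x) \<le> 0"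
    and strict: "\<And>x. x \<in> U \<Longrightarrow> 0 < s * (u x - w x) \<Longrightarrow> s * ((\<Sum>b\<in>Basis. DV b x \<bullet> b) - f x) < 0"
    and x: "x \<in> U"
  shows "s * (u x - w x) \<le> 0"
proof (rule ccontr)
  define D where "D x = (\<Sum>b\<in>Basis. DV b x \<bullet> b)" for x
  assume neg: "\<not> s * (u x - w x) \<le> 0"
  have xK: "x \<in> K" using neg x off[of x] by auto
  define \<epsilon> where "\<epsilon> = s * (u x - w x) / 5"
  have \<epsilon>: "0 < \<epsilon>" using neg by (simp add: \<epsilon>_def)
  have sabs: "\<bar>s\<bar> = 1" using s by (metis abs_mult_self_eq abs_one power2_eq_1_iff power2_eq_square abs_minus_cancel)
  have cw: "continuous_on U w"
    using w(1) unfolding gderiv_def by (intro continuous_at_imp_continuous_on) (auto intro: has_derivative_continuous)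
  have cu: "continuous_on U u" using u U(2) by (rule continuous_on_subset)
  have cD: "continuous_on U D" unfolding D_def[abs_def] by (intro continuous_intros DV(2))
  have cV: "continuous_on U V"
  proof -
    have "continuous_on U (\<lambda>x. \<Sum>b\<in>Basis. (V x \<bullet> b) *\<^sub>R b)"
      using DV(1) unfolding gderiv_def
      by (intro continuous_on_sum continuous_on_scaleR continuous_on_const continuous_at_imp_continuous_on)
        (auto intro: has_derivative_continuous)
    then show ?thesis by (simp add: euclidean_representation)
  qed
  have clK: "closed K" using K(1) by (rule compact_imp_closed)
  have Kb: "K \<in> sets borel" using clK by simp
  \<comment> \<open>At points of \<open>B\<close>, mollification at scales up to \<open>r\<close> uses values on the compact set \<open>K2 \<subseteq> U\<close> only.\<close>
  obtain r0 where r0: "0 < r0" "(\<Union>x\<in>K. cball x r0) \<subseteq> U"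
    using compact_subset_open_imp_cball_epsilon_subset[OF K(1) U(1) K(2)] by blast
  define r where "r = r0 / 2"
  have r: "0 < r" using r0 by (simp add: r_def)
  define K2 where "K2 = (\<Union>x\<in>K. cball x r0)"
  define B where "B = (\<Union>x\<in>K. ball x r)"
  have B: "open B" "K \<subseteq> B" "B \<subseteq> K2" using r by (auto simp: B_def K2_def r_def)
  have BK2: "cball x d \<subseteq> K2" if xB: "x \<in> B" "d \<le> r" for x d
  proof
    fix y assume y: "y \<in> cball x d"
    obtain z where z: "z \<in> K" "dist z x < r" using xB by (auto simp: B_def)
    have "dist z y \<le> r0"
      using dist_triangle[of z y x] z y xB by (auto simp: r_def)
    then show "y \<in> K2" using z by (auto simp: K2_def)
  qed
  have K2: "compact K2" "K2 \<subseteq> U" "closed K2" "K2 \<subseteq> \<Omega>"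
    using compact_neighbourhood[OF K(1), of r0] r0 U by (auto simp: K2_def intro: compact_imp_closed)
  have KK2: "K \<subseteq> K2" using B by auto
  obtain R where R: "\<And>x. x \<in> K2 \<Longrightarrow> norm x \<le> R"
    using compact_imp_bounded[OF K2(1)] by (auto simp: bounded_iff)
  \<comment> \<open>Fubini's theorem is applied to Borel functions, hence the Borel version \<open>g\<close> of \<open>G\<close>; it vanishes off \<open>K2\<close>.\<close>
  have Gm: "set_borel_measurable lebesgue \<Omega> G"
    and Gi: "set_integrable lebesgue K2 (\<lambda>x. norm (G x) powr p)"
    and wg: "weak_gradient \<Omega> u G"
    using W K2 by (auto simp: W1p_loc_def Lp_loc_def)
  define G2 where "G2 x = indicat_real K2 x *\<^sub>R G x" for x
  have iK2: "indicat_real S \<in> borel_measurable lebesgue" if "S \<in> sets borel" for S :: "'a set"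
    using that by (intro borel_measurable_indicator) auto
  have G2m: "G2 \<in> borel_measurable lebesgue"
  proof -
    have "(\<lambda>x. indicat_real K2 x *\<^sub>R (indicat_real \<Omega> x *\<^sub>R G x)) \<in> borel_measurable lebesgue"
      using borel_measurable_scaleR[OF iK2[OF borel_closed[OF K2(3)]] Gm[unfolded set_borel_measurable_def]] .
    moreover have "(\<lambda>x. indicat_real K2 x *\<^sub>R (indicat_real \<Omega> x *\<^sub>R G x)) = G2"
      using K2(4) by (auto simp: G2_def fun_eq_iff indicator_def)
    ultimately show ?thesis by simp
  qed
  obtain g0 where g0: "g0 \<in> borel_measurable borel" "AE x in lborel. G2 x = g0 x"
    using lebesgue_borel_version[OF G2m] by blast
  define g where "g x = indicat_real K2 x *\<^sub>R g0 x" for x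
  have gm [measurable]: "g \<in> borel_measurable borel"
    unfolding g_def using g0(1) K2(3) by (intro borel_measurable_scaleR borel_measurable_indicator) auto
  have gG: "AE x in lborel. G2 x = g x"
    using g0(2) by eventually_elim (auto simp: g_def G2_def indicator_def)
  have g_supp: "g x = 0" if "x \<notin> K2" for x using that by (simp add: g_def)
  have g_supp': "g x = 0" if "R < norm x" for x using that R[of x] by (intro g_supp) auto
  have gp_int: "integrable lborel (\<lambda>x. norm (g x) powr p)"
  proof -
    have "integrable lebesgue (\<lambda>x. norm (G2 x) powr p)"
    proof -
      have "(\<lambda>x. norm (G2 x) powr p) = (\<lambda>x. indicat_real K2 x *\<^sub>R norm (G x) powr p)"
        by (auto simp: G2_def fun_eq_iff indicator_def)
      then show ?thesis using Gi by (simp add: set_integrable_def)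
    qed
    then have "integrable lebesgue (\<lambda>x. norm (g x) powr p)"
      by (rule integrable_cong_AE_imp) (use AE_completion[OF gG] in \<open>auto intro!: borel_measurable_lebesgueI\<close>)
    then show ?thesis by (subst (asm) integrable_completion) auto
  qed
  have gp: "(\<integral>\<^sup>+x. norm (g x) powr p \<partial>lborel) < \<infinity>"
    using gp_int by (simp add: integrable_iff_bounded)
  have iR: "integrable lborel (\<lambda>x. indicat_real (cball 0 R) x :: real)"
    by (intro integrable_real_indicator emeasure_lborel_cball_finite) auto
  have powr_bd: "t powr a \<le> 1 + t powr p" if "0 \<le> t" "0 \<le> a" "a \<le> p" for t a :: real
  proof (cases "t \<le> 1")
    case True
    then show ?thesis using that powr_mono2[of a t 1] by (smt (verit) powr_ge_zero powr_one_eq_one)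
  next
    case False
    then have "t powr a \<le> t powr p" using that by (intro powr_mono) auto
    then show ?thesis by simp
  qed
  have g_int: "integrable lborel g"
  proof (rule Bochner_Integration.integrable_bound[where f = "\<lambda>x. indicat_real (cball 0 R) x + norm (g x) powr p"])
    show "AE x in lborel. norm (g x) \<le> norm (indicat_real (cball 0 R) x + norm (g x) powr p)"
    proof (intro AE_I2)
      fix x
      show "norm (g x) \<le> norm (indicat_real (cball 0 R) x + norm (g x) powr p)"
        using powr_bd[of "norm (g x)" 1] g_supp'[of x] p by (cases "R < norm x") (auto simp: abs_if)
    qed
  qed (use iR gp_int in auto)
  define h where "h x = indicat_real K x * f x" for x
  have hm: "h \<in> borel_measurable lebesgue"
  proof -
    have "(\<lambda>x. indicat_real K x *\<^sub>R (indicat_real \<Omega> x *\<^sub>R f x)) \<in> borel_measurable lebesgue"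
      using borel_measurable_scaleR[OF iK2[OF Kb] f(1)[unfolded set_borel_measurable_def]] .
    moreover have "(\<lambda>x. indicat_real K x *\<^sub>R (indicat_real \<Omega> x *\<^sub>R f x)) = h"
      using K2(4) KK2 by (auto simp: h_def fun_eq_iff indicator_def)
    ultimately show ?thesis by simp
  qed
  obtain Bh where Bh: "\<And>x. x \<in> K \<Longrightarrow> \<bar>f x\<bar> \<le> Bh"
  proof -
    have "K \<subseteq> \<Omega>" using KK2 K2(4) by blast
    from f(2)[OF K(1) this] show thesis using that by (auto simp: bounded_iff)
  qed
  have bdd: "\<exists>C. \<forall>x\<in>K. norm (F x) \<le> C" if "continuous_on U F" for F :: "'a \<Rightarrow> 'c::real_normed_vector"
    using compact_imp_bounded[OF compact_continuous_image[OF continuous_on_subset[OF that K(2)] K(1)]]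
    by (auto simp: bounded_iff)
  obtain CV where CV: "\<And>x. x \<in> K \<Longrightarrow> norm (V x) \<le> CV" using bdd[OF cV] by blast
  obtain CD where CD: "\<And>x. x \<in> K \<Longrightarrow> \<bar>D x\<bar> \<le> CD" using bdd[OF cD] by auto
  obtain Cw where Cw: "\<And>x. x \<in> K \<Longrightarrow> norm (w' x) \<le> Cw" using bdd[OF w(2)] by blast
  obtain Cuw where Cuw: "\<And>x. x \<in> K \<Longrightarrow> \<bar>u x - w x\<bar> \<le> Cuw"
    using bdd[OF continuous_on_diff[OF cu cw]] by auto
  have K1: "integrable lebesgue (\<lambda>x. indicat_real K x * c)" for c :: real
    using emeasure_compact_finite[OF K(1)] Kb
    by (intro integrable_mult_left integrable_real_indicator) (auto simp: emeasure_completion)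
  have onK: "(\<lambda>x. indicat_real K x *\<^sub>R F x) \<in> borel_measurable borel"
    if "continuous_on U F" for F :: "'a \<Rightarrow> 'c::real_normed_vector"
    using borel_measurable_continuous_on_indicator[OF Kb continuous_on_subset[OF that K(2)]] .
  \<comment> \<open>The open set \<open>N\<close> is not empty, so strictness contributes a positive amount \<open>c0\<close>, whatever the mollification scale.\<close>
  define \<kappa> where "\<kappa> x = - (s * (D x - f x))" for x
  define N where "N = {x \<in> U. 4 * \<epsilon> < s * (u x - w x)}"
  have N: "open N" "N \<subseteq> K" "x \<in> N"
  proof -
    have "N = U \<inter> (\<lambda>x. s * (u x - w x)) -` {4 * \<epsilon><..}" by (auto simp: N_def)
    moreover have "open (U \<inter> (\<lambda>x. s * (u x - w x)) -` {4 * \<epsilon><..})"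
      using cu cw by (intro continuous_open_preimage continuous_intros U) auto
    ultimately show "open N" by simp
    show "N \<subseteq> K"
    proof
      fix y assume "y \<in> N" then show "y \<in> K" using off[of y] \<epsilon> by (cases "y \<in> K") (auto simp: N_def)
    qed
    show "x \<in> N" using x \<epsilon> by (simp add: N_def \<epsilon>_def)
  qed
  have \<kappa>pos: "0 < \<kappa> y" if "y \<in> U" "0 < s * (u y - w y)" for y
    using strict[OF that] by (simp add: \<kappa>_def D_def)
  have \<kappa>m: "(\<lambda>x. indicat_real K x * \<kappa> x) \<in> borel_measurable lebesgue"
  proof -
    have "(\<lambda>x. - (s * (indicat_real K x *\<^sub>R D x - h x))) \<in> borel_measurable lebesgue"
      using borel_measurable_lebesgueI[OF onK[OF cD]] hm
      by (intro borel_measurable_uminus borel_measurable_times borel_measurable_diff borel_measurable_const) auto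
    moreover have "(\<lambda>x. - (s * (indicat_real K x *\<^sub>R D x - h x))) = (\<lambda>x. indicat_real K x * \<kappa> x)"
    proof (rule ext)
      fix y show "- (s * (indicat_real K y *\<^sub>R D y - h y)) = indicat_real K y * \<kappa> y"
        by (cases "y \<in> K") (auto simp: h_def \<kappa>_def)
    qed
    ultimately show ?thesis by (simp only:)
  qed
  have \<kappa>b: "\<bar>\<kappa> y\<bar> \<le> CD + Bh" if "y \<in> K" for y
  proof -
    have "\<bar>\<kappa> y\<bar> = \<bar>D y - f y\<bar>" by (simp add: \<kappa>_def abs_mult sabs)
    then show ?thesis using CD[OF that] Bh[OF that] by linarith
  qed
  have N\<kappa>m: "(\<lambda>x. indicat_real N x * \<kappa> x) \<in> borel_measurable lebesgue"
  proof -
    have "(\<lambda>x. indicat_real N x * (indicat_real K x * \<kappa> x)) \<in> borel_measurable lebesgue"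
      by (rule borel_measurable_times[OF iK2[OF borel_open[OF N(1)]] \<kappa>m])
    moreover have "(\<lambda>x. indicat_real N x * (indicat_real K x * \<kappa> x)) = (\<lambda>x. indicat_real N x * \<kappa> x)"
      using N(2) by (auto simp: fun_eq_iff indicator_def)
    ultimately show ?thesis by simp
  qed
  have N\<kappa>i: "integrable lebesgue (\<lambda>x. indicat_real N x * \<kappa> x)"
  proof (rule integrable_lebesgue_bounded_support[OF N\<kappa>m K(1) _ _ K1[of "CD + Bh"]])
    show "AE x in lebesgue. norm (indicat_real N x * \<kappa> x) \<le> CD + Bh"
    proof (intro AE_I2)
      fix y show "norm (indicat_real N y * \<kappa> y) \<le> CD + Bh"
      proof (cases "y \<in> N")
        case True
        then show ?thesis using \<kappa>b[of y] N(2) by auto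
      next
        case False
        then show ?thesis using \<kappa>b[OF xK] by simp
      qed
    qed
  qed (use N(2) in \<open>auto simp: indicator_def\<close>)
  define c0 where "c0 = (LINT x|lebesgue. indicat_real N x * \<kappa> x)"
  have N\<kappa>nn: "0 \<le> indicat_real N y * \<kappa> y" for y
    using \<kappa>pos[of y] \<epsilon> by (auto simp: N_def indicator_def)
  have c0: "0 < c0"
  proof -
    have "0 \<le> c0" unfolding c0_def using N\<kappa>nn by (intro integral_nonneg_AE) auto
    moreover have "c0 \<noteq> 0"
    proof
      assume "c0 = 0"
      then have "AE y in lebesgue. indicat_real N y * \<kappa> y = 0"
        unfolding c0_def using N\<kappa>i N\<kappa>nn by (subst (asm) integral_nonneg_eq_0_iff_AE) auto
      then have "AE y in lebesgue. y \<notin> N"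
      proof eventually_elim
        case (elim y)
        then show ?case using \<kappa>pos[of y] \<epsilon> by (auto simp: N_def indicator_def)
      qed
      then have "negligible N"
        using N(1) by (simp add: negligible_iff_null_sets AE_iff_null_sets)
      then show False using N open_not_negligible by blast
    qed
    ultimately show ?thesis by simp
  qed
  \<comment> \<open>\<open>B0\<close> bounds the factor \<open>\<eta>\<close> for every scale \<open>d\<close>; so \<open>e\<close>, and then \<open>d\<close>, can be chosen to make the error \<open>B0 e\<close> smaller than \<open>\<epsilon>\<^sup>2 c0\<close>.\<close>
  define A where "A x = norm (g x) powr (p - 2) *\<^sub>R g x" for x
  have Am [measurable]: "A \<in> borel_measurable borel" unfolding A_def by measurable
  have nA: "norm (A x) = norm (g x) powr (p - 1)" for x
    using powr_add[of "norm (g x)" "p - 2" 1] p by (cases "g x = 0") (auto simp: A_def)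
  define a where "a x = norm (indicat_real K x *\<^sub>R A x - indicat_real K x *\<^sub>R V x)" for x
  have am [measurable]: "a \<in> borel_measurable borel"
  proof -
    have "(\<lambda>x. indicat_real K x *\<^sub>R A x - indicat_real K x *\<^sub>R V x) \<in> borel_measurable borel"
      using Kb by (intro borel_measurable_diff onK[OF cV] borel_measurable_scaleR[OF _ Am] borel_measurable_indicator)
        simp_all
    from measurable_compose[OF this borel_measurable_norm] show ?thesis
      by (simp add: a_def[abs_def])
  qed
  have CV0: "0 \<le> CV" using CV[OF xK] norm_ge_zero order_trans by blast
  have ab: "a x \<le> norm (g x) powr (p - 1) + CV * indicat_real (cball 0 R) x" for x
  proof (cases "x \<in> K")
    case True
    then have "norm x \<le> R" using R KK2 by auto
    then show ?thesis using True norm_triangle_ineq4[of "A x" "V x"] CV[OF True] by (simp add: a_def nA)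
  qed (use CV0 in \<open>simp add: a_def\<close>)
  define B0 where "B0 = 2 * (Cuw + \<epsilon>) + 1"
  have Cuw0: "0 \<le> Cuw" using Cuw[OF xK] by auto
  have B0: "0 < B0" using Cuw0 \<epsilon> by (simp add: B0_def)
  define e where "e = \<epsilon>\<^sup>2 * c0 / (2 * B0)"
  have e: "0 < e" using \<epsilon> c0 B0 by (simp add: e_def)
  obtain d1 where d1: "0 < d1"
    "\<And>z. norm z < d1 \<Longrightarrow> (\<integral>\<^sup>+x. a x * norm (g (z + x) - g x) \<partial>lborel) \<le> e"
    using weighted_translation_continuous[OF gm am _ gp g_supp' ab CV0 e] p by auto
  obtain Uu where Uu: "continuous_on UNIV Uu" "\<And>x. x \<in> K2 \<Longrightarrow> Uu x = u x"
  proof (rule Tietze_unbounded[of K2 u UNIV])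
    show "continuous_on K2 u" using cu K2(2) by (rule continuous_on_subset)
    show "closedin (top_of_set UNIV) K2" using K2(3) by simp
  qed blast
  have "uniformly_continuous_on K2 u"
    using K2 cu by (intro compact_uniformly_continuous) (auto intro: continuous_on_subset)
  then obtain d2 where d2: "0 < d2" "\<And>x y. x \<in> K2 \<Longrightarrow> y \<in> K2 \<Longrightarrow> dist y x < d2 \<Longrightarrow> dist (u y) (u x) < \<epsilon>"
    using \<epsilon> unfolding uniformly_continuous_on_def by meson
  define d where "d = min d1 (min d2 r)"
  have d: "0 < d" "d \<le> d1" "d \<le> d2" "d \<le> r" using d1 d2 r by (auto simp: d_def)
  obtain k :: "'a \<Rightarrow> real" and k' Bk where k: "\<And>z. GDERIV k z :> k' z" "continuous_on UNIV k" "continuous_on UNIV k'"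
    "\<And>z. 0 \<le> k z" "\<And>z. k z \<le> Bk" "\<And>z. d \<le> norm z \<Longrightarrow> k z = 0"
    "\<And>z. d \<le> norm z \<Longrightarrow> k' z = 0" "(\<integral>\<^sup>+z. k z \<partial>lborel) = 1"
    using bump_kernel_exists[OF d(1)] by metis
  define M where "M x = (LINT y|lborel. k (y - x) * Uu y)" for x
  define M' where "M' x = - (LINT y|lborel. Uu y *\<^sub>R k' (y - x))" for x
  have dM: "GDERIV M x :> M' x" for x
    unfolding M_def[abs_def] M'_def by (rule GDERIV_mollification(1)[OF Uu(1) k(1-3,6,7)])
  have cM': "continuous_on UNIV M'"
    unfolding M'_def[abs_def] by (intro continuous_on_minus GDERIV_mollification(2)[OF Uu(1) k(1-3,6,7)])
  have Mu: "\<bar>M x - u x\<bar> \<le> \<epsilon>" if "x \<in> B" for x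
  proof -
    have xK2: "x \<in> K2" using that B by auto
    have "\<bar>M x - Uu x\<bar> \<le> \<epsilon>"
      unfolding M_def
    proof (rule mollification_error[OF Uu(1) k(2,4,6,8)])
      fix y assume y: "norm (y - x) < d"
      then have "y \<in> K2" using BK2[OF that d(4)] by (auto simp: subset_iff dist_norm norm_minus_commute)
      then show "\<bar>Uu y - Uu x\<bar> \<le> \<epsilon>"
        using d2(2)[OF xK2] y d Uu(2) xK2 by (force simp: dist_norm)
    qed
    then show ?thesis using Uu(2)[OF xK2] by simp
  qed
  have M'g: "M' x = (LINT z|lborel. k z *\<^sub>R g (z + x))" if "x \<in> B" for x
    unfolding M'_def
  proof (rule mollified_weak_gradient[OF wg Gm _ Uu(1) _ gm _ k(1-3,6,7)])
    show "cball x d \<subseteq> \<Omega>" using BK2[OF that d(4)] K2(4) by auto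
    show "Uu y = u y" if "y \<in> cball x d" for y using BK2[OF \<open>x \<in> B\<close> d(4)] that Uu(2) by auto
    show "AE y in lborel. y \<in> cball x d \<longrightarrow> g y = G y"
      using gG
    proof eventually_elim
      case (elim y)
      then show ?case using BK2[OF that d(4)] by (auto simp: G2_def indicator_def split: if_splits)
    qed
  qed
  \<comment> \<open>Since \<open>\<bar>M - u\<bar> \<le> \<epsilon>\<close> on \<open>B\<close>, subtracting \<open>2\<epsilon>\<close> makes the test function vanish off \<open>K\<close>, while it is at least \<open>\<epsilon>\<^sup>2\<close> on \<open>N\<close>.\<close>
  define H where "H x = s * (M x - w x)" for x
  define H' where "H' x = s *\<^sub>R (M' x - w' x)" for x
  have BU: "B \<subseteq> U" using B K2 by auto
  have dH: "GDERIV H x :> H' x" if "x \<in> B" for x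
    using GDERIV_mult[OF GDERIV_const[of s] GDERIV_diff[OF dM w(1)]] that BU
    unfolding H_def[abs_def] H'_def by auto
  have cH': "continuous_on B H'"
    unfolding H'_def[abs_def]
    by (intro continuous_intros continuous_on_subset[OF cM'] continuous_on_subset[OF w(2) BU]) auto
  have HuB: "\<bar>H x - s * (u x - w x)\<bar> \<le> \<epsilon>" if "x \<in> B" for x
  proof -
    have "H x - s * (u x - w x) = s * (M x - u x)" by (simp add: H_def algebra_simps)
    then show ?thesis using Mu[OF that] sabs by (simp add: abs_mult)
  qed
  have Hoff: "H x \<le> 2 * \<epsilon>" if "x \<in> B - K" for x
    using HuB[of x] off[of x] that BU \<epsilon> by fastforce
  define \<eta> where "\<eta> x = (if x \<in> K then 2 * max 0 (H x - 2 * \<epsilon>) else 0)" for x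
  define \<phi> where "\<phi> x = (if x \<in> K then sqpos (H x - 2 * \<epsilon>) else 0)" for x
  define \<phi>' where "\<phi>' x = (if x \<in> K then (2 * max 0 (H x - 2 * \<epsilon>)) *\<^sub>R H' x else 0)" for x
  have d\<phi>: "GDERIV \<phi> x :> \<phi>' x" for x
    by (rule cutoff_test_function(1)[OF clK B(1,2) dH cH' Hoff \<phi>_def \<phi>'_def])
  have c\<phi>': "continuous_on UNIV \<phi>'"
    by (rule cutoff_test_function(2)[OF clK B(1,2) dH cH' Hoff \<phi>_def \<phi>'_def])
  have gr\<phi>: "grad \<phi> x = \<phi>' x" for x by (rule grad_eqI[OF d\<phi>])
  have \<phi>nn: "0 \<le> \<phi> x" for x by (simp add: \<phi>_def sqpos_nonneg)
  have supp: "closure {x. \<phi> x \<noteq> 0} \<subseteq> K"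
    by (rule closure_minimal) (auto simp: \<phi>_def clK)
  have \<phi>C: "\<phi> \<in> C1_0 \<Omega>"
    unfolding C1_0_def
  proof (intro CollectI conjI allI)
    show "GDERIV \<phi> x :> grad \<phi> x" for x unfolding gr\<phi> by (rule d\<phi>)
    show "continuous_on UNIV (grad \<phi>)" unfolding gr\<phi>[abs_def] by (rule c\<phi>')
    show "compact (closure {x. \<phi> x \<noteq> 0})"
      using supp K(1) by (meson bounded_subset closed_closure compact_eq_bounded_closed)
    show "closure {x. \<phi> x \<noteq> 0} \<subseteq> \<Omega>" using supp KK2 K2(4) by auto
  qed
  have c\<phi>: "continuous_on UNIV \<phi>"
    using d\<phi> unfolding gderiv_def by (intro continuous_at_imp_continuous_on) (auto intro: has_derivative_continuous)
  have \<phi>m: "\<phi> \<in> borel_measurable borel" "\<phi>' \<in> borel_measurable borel"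
    using c\<phi> c\<phi>' by (auto intro: borel_measurable_continuous_onI)
  obtain C1 where C1: "\<And>x. x \<in> K \<Longrightarrow> norm (\<phi>' x) \<le> C1"
    using bdd[OF continuous_on_subset[OF c\<phi>']] by auto
  obtain C2 where C2: "\<And>x. x \<in> K \<Longrightarrow> norm (\<phi> x) \<le> C2"
    using bdd[OF continuous_on_subset[OF c\<phi>]] by blast
  have \<phi>0: "\<phi> x = 0" "\<phi>' x = 0" "\<eta> x = 0" if "x \<notin> K" for x
    using that by (auto simp: \<phi>_def \<phi>'_def \<eta>_def)
  have I1: "(LINT x|lebesgue. A x \<bullet> \<phi>' x) = - (LINT x|lebesgue. h x * \<phi> x)"
  proof -
    have "(LINT x:\<Omega>|lebesgue. norm (G x) powr (p - 2) * (G x \<bullet> grad \<phi> x)) =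
        (LINT x|lebesgue. norm (G2 x) powr (p - 2) * (G2 x \<bullet> \<phi>' x))"
      unfolding set_lebesgue_integral_def gr\<phi>
    proof (rule Bochner_Integration.integral_cong)
      fix x show "indicat_real \<Omega> x *\<^sub>R (norm (G x) powr (p - 2) * (G x \<bullet> \<phi>' x)) =
          norm (G2 x) powr (p - 2) * (G2 x \<bullet> \<phi>' x)"
        using \<phi>0[of x] KK2 K2(4) by (cases "x \<in> K") (auto simp: G2_def indicator_def)
    qed simp
    also have "\<dots> = (LINT x|lebesgue. A x \<bullet> \<phi>' x)"
    proof (rule integral_cong_AE)
      show "(\<lambda>x. norm (G2 x) powr (p - 2) * (G2 x \<bullet> \<phi>' x)) \<in> borel_measurable lebesgue"
        using G2m borel_measurable_lebesgueI[OF \<phi>m(2)]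
        by (intro borel_measurable_times powr_real_measurable borel_measurable_norm borel_measurable_inner
            borel_measurable_const) auto
      show "(\<lambda>x. A x \<bullet> \<phi>' x) \<in> borel_measurable lebesgue"
        using \<phi>m Am by (intro borel_measurable_lebesgueI) (auto intro!: borel_measurable_inner)
      show "AE x in lebesgue. norm (G2 x) powr (p - 2) * (G2 x \<bullet> \<phi>' x) = A x \<bullet> \<phi>' x"
        using AE_completion[OF gG] by eventually_elim (simp add: A_def)
    qed
    finally have l: "(LINT x:\<Omega>|lebesgue. norm (G x) powr (p - 2) * (G x \<bullet> grad \<phi> x)) =
        (LINT x|lebesgue. A x \<bullet> \<phi>' x)" .
    have "(LINT x:\<Omega>|lebesgue. f x * \<phi> x) = (LINT x|lebesgue. h x * \<phi> x)"
      unfolding set_lebesgue_integral_def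
    proof (rule Bochner_Integration.integral_cong)
      fix x show "indicat_real \<Omega> x *\<^sub>R (f x * \<phi> x) = h x * \<phi> x"
        using \<phi>0[of x] KK2 K2(4) by (cases "x \<in> K") (auto simp: h_def indicator_def)
    qed simp
    with l eq[OF \<phi>C \<phi>nn] show ?thesis by simp
  qed
  have mV: "(\<lambda>x. indicat_real K x *\<^sub>R V x) \<in> borel_measurable borel" by (rule onK[OF cV])
  have mD: "(\<lambda>x. indicat_real K x *\<^sub>R D x) \<in> borel_measurable borel" by (rule onK[OF cD])
  have I2: "(LINT x|lebesgue. (indicat_real K x *\<^sub>R V x) \<bullet> \<phi>' x) = - (LINT x|lebesgue. (indicat_real K x *\<^sub>R D x) * \<phi> x)"
  proof -
    have "(LINT x:K|lborel. V x \<bullet> \<phi>' x) = - (LINT x:K|lborel. \<phi> x * D x)"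
      unfolding D_def
      using integration_by_parts[where V = V and DV = DV, OF U(1) K d\<phi> c\<phi>' \<phi>0(1) DV] .
    moreover have "(LINT x|lebesgue. (indicat_real K x *\<^sub>R V x) \<bullet> \<phi>' x) = (LINT x:K|lborel. V x \<bullet> \<phi>' x)"
    proof -
      have "(\<lambda>x. (indicat_real K x *\<^sub>R V x) \<bullet> \<phi>' x) \<in> borel_measurable lborel"
        using borel_measurable_inner[OF mV \<phi>m(2)] by simp
      from integral_completion[OF this] show ?thesis
        by (simp add: set_lebesgue_integral_def)
    qed
    moreover have "(LINT x|lebesgue. (indicat_real K x *\<^sub>R D x) * \<phi> x) = (LINT x:K|lborel. \<phi> x * D x)"
    proof -
      have "(\<lambda>x. (indicat_real K x *\<^sub>R D x) * \<phi> x) \<in> borel_measurable lborel"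
        using borel_measurable_times[OF mD \<phi>m(1)] by simp
      from integral_completion[OF this] show ?thesis
        by (simp add: set_lebesgue_integral_def mult_ac)
    qed
    ultimately show ?thesis by simp
  qed
  have gp_leb: "integrable lebesgue (\<lambda>x. indicat_real K x * (c * (1 + norm (g x) powr p)))" for c
  proof -
    have "integrable lebesgue (\<lambda>x. norm (g x) powr p)"
      using gp_int by (subst integrable_completion) auto
    then have "integrable lebesgue (\<lambda>x. indicat_real K x *\<^sub>R norm (g x) powr p)"
      using Kb by (intro integrable_mult_indicator) auto
    then have "integrable lebesgue (\<lambda>x. c * (indicat_real K x * 1 + indicat_real K x *\<^sub>R norm (g x) powr p))"
      by (intro integrable_mult_right Bochner_Integration.integrable_add K1)
    then show ?thesis by (simp add: algebra_simps)
  qed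
  have C10: "0 \<le> C1" using C1[OF xK] norm_ge_zero order_trans by blast
  have C20: "0 \<le> C2" using C2[OF xK] norm_ge_zero order_trans by blast
  have i1: "integrable lebesgue (\<lambda>x. A x \<bullet> \<phi>' x)"
  proof (rule integrable_lebesgue_bounded_support[OF _ K(1) _ _ gp_leb[of C1]])
    show "(\<lambda>x. A x \<bullet> \<phi>' x) \<in> borel_measurable lebesgue"
      using \<phi>m Am by (intro borel_measurable_lebesgueI) (auto intro!: borel_measurable_inner)
    show "AE x in lebesgue. norm (A x \<bullet> \<phi>' x) \<le> C1 * (1 + norm (g x) powr p)"
    proof (intro AE_I2)
      fix x
      have "norm (A x \<bullet> \<phi>' x) \<le> norm (A x) * norm (\<phi>' x)" by (simp add: Cauchy_Schwarz_ineq2)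
      also have "\<dots> \<le> (1 + norm (g x) powr p) * C1"
        using powr_bd[of "norm (g x)" "p - 1"] p C1[of x] \<phi>0[of x] C10 unfolding nA
        by (cases "x \<in> K") (auto intro!: mult_mono)
      finally show "norm (A x \<bullet> \<phi>' x) \<le> C1 * (1 + norm (g x) powr p)" by (simp add: mult.commute)
    qed
  qed (use \<phi>0 in auto)
  have i2: "integrable lebesgue (\<lambda>x. (indicat_real K x *\<^sub>R V x) \<bullet> \<phi>' x)"
  proof (rule integrable_lebesgue_bounded_support[OF _ K(1) _ _ K1[of "CV * C1"]])
    show "(\<lambda>x. (indicat_real K x *\<^sub>R V x) \<bullet> \<phi>' x) \<in> borel_measurable lebesgue"
      by (rule borel_measurable_lebesgueI[OF borel_measurable_inner[OF mV \<phi>m(2)]])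
    show "AE x in lebesgue. norm ((indicat_real K x *\<^sub>R V x) \<bullet> \<phi>' x) \<le> CV * C1"
    proof (intro AE_I2)
      fix x
      have "norm ((indicat_real K x *\<^sub>R V x) \<bullet> \<phi>' x) \<le> norm (indicat_real K x *\<^sub>R V x) * norm (\<phi>' x)"
        unfolding real_norm_def by (rule Cauchy_Schwarz_ineq2)
      also have "\<dots> \<le> CV * C1"
        using CV[of x] C1[of x] CV0 C10 by (cases "x \<in> K") (auto intro!: mult_mono)
      finally show "norm ((indicat_real K x *\<^sub>R V x) \<bullet> \<phi>' x) \<le> CV * C1" .
    qed
  qed (use \<phi>0 in auto)
  have i3: "integrable lebesgue (\<lambda>x. h x * \<phi> x)"
  proof (rule integrable_lebesgue_bounded_support[OF _ K(1) _ _ K1[of "Bh * C2"]])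
    show "(\<lambda>x. h x * \<phi> x) \<in> borel_measurable lebesgue"
      using hm borel_measurable_lebesgueI[OF \<phi>m(1)] by (intro borel_measurable_times) auto
    show "AE x in lebesgue. norm (h x * \<phi> x) \<le> Bh * C2"
    proof (intro AE_I2)
      fix x show "norm (h x * \<phi> x) \<le> Bh * C2"
        using Bh[of x] Bh[OF xK] C2[of x] C20 by (cases "x \<in> K") (auto simp: h_def abs_mult intro!: mult_mono)
    qed
  qed (use \<phi>0 in auto)
  have i4: "integrable lebesgue (\<lambda>x. (indicat_real K x *\<^sub>R D x) * \<phi> x)"
  proof (rule integrable_lebesgue_bounded_support[OF _ K(1) _ _ K1[of "CD * C2"]])
    show "(\<lambda>x. (indicat_real K x *\<^sub>R D x) * \<phi> x) \<in> borel_measurable lebesgue"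
      using mD \<phi>m by (intro borel_measurable_lebesgueI) (auto intro!: borel_measurable_times)
    show "AE x in lebesgue. norm ((indicat_real K x *\<^sub>R D x) * \<phi> x) \<le> CD * C2"
    proof (intro AE_I2)
      fix x show "norm ((indicat_real K x *\<^sub>R D x) * \<phi> x) \<le> CD * C2"
        using CD[of x] CD[OF xK] C2[of x] C20 by (cases "x \<in> K") (auto simp: abs_mult intro!: mult_mono)
    qed
  qed (use \<phi>0 in auto)
  define F where "F x = - s * (A x \<bullet> \<phi>' x - (indicat_real K x *\<^sub>R V x) \<bullet> \<phi>' x)" for x
  have Fi: "integrable lebesgue F"
    unfolding F_def[abs_def] using i1 i2 by auto
  have Fint: "(LINT x|lebesgue. F x) = (LINT x|lebesgue. indicat_real K x * \<kappa> x * \<phi> x)"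
  proof -
    have "(LINT x|lebesgue. F x) = - s * ((LINT x|lebesgue. A x \<bullet> \<phi>' x) - (LINT x|lebesgue. (indicat_real K x *\<^sub>R V x) \<bullet> \<phi>' x))"
      unfolding F_def using i1 i2 by simp
    also have "\<dots> = - s * ((LINT x|lebesgue. (indicat_real K x *\<^sub>R D x) * \<phi> x) - (LINT x|lebesgue. h x * \<phi> x))"
      unfolding I1 I2 by simp
    also have "\<dots> = (LINT x|lebesgue. - s * ((indicat_real K x *\<^sub>R D x) * \<phi> x - h x * \<phi> x))"
      using i3 i4 by simp
    also have "\<dots> = (LINT x|lebesgue. indicat_real K x * \<kappa> x * \<phi> x)"
      by (rule Bochner_Integration.integral_cong) (auto simp: h_def \<kappa>_def indicator_def algebra_simps)
    finally show ?thesis .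
  qed
  have i5: "integrable lebesgue (\<lambda>x. indicat_real K x * \<kappa> x * \<phi> x)"
  proof -
    have "integrable lebesgue (\<lambda>x. - s * ((indicat_real K x *\<^sub>R D x) * \<phi> x - h x * \<phi> x))"
      using i3 i4 by auto
    moreover have "(\<lambda>x. - s * ((indicat_real K x *\<^sub>R D x) * \<phi> x - h x * \<phi> x)) =
        (\<lambda>x. indicat_real K x * \<kappa> x * \<phi> x)"
    proof (rule ext)
      fix y show "- s * ((indicat_real K y *\<^sub>R D y) * \<phi> y - h y * \<phi> y) = indicat_real K y * \<kappa> y * \<phi> y"
        by (cases "y \<in> K") (auto simp: h_def \<kappa>_def algebra_simps)
    qed
    ultimately show ?thesis by (simp only:)
  qed
  have lower: "\<epsilon>\<^sup>2 * c0 \<le> (LINT x|lebesgue. F x)"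
  proof -
    have "\<epsilon>\<^sup>2 * c0 = (LINT x|lebesgue. \<epsilon>\<^sup>2 * (indicat_real N x * \<kappa> x))"
      using N\<kappa>i by (simp add: c0_def)
    also have "\<dots> \<le> (LINT x|lebesgue. indicat_real K x * \<kappa> x * \<phi> x)"
    proof (rule integral_mono)
      fix y
      show "\<epsilon>\<^sup>2 * (indicat_real N y * \<kappa> y) \<le> indicat_real K y * \<kappa> y * \<phi> y"
      proof (cases "y \<in> K")
        case True
        have HB: "\<bar>H y - s * (u y - w y)\<bar> \<le> \<epsilon>" using HuB B True by auto
        show ?thesis
        proof (cases "y \<in> N")
          case yN: True
          then have "\<epsilon> \<le> H y - 2 * \<epsilon>" using HB by (auto simp: N_def)
          then have "\<epsilon>\<^sup>2 \<le> \<phi> y"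
            using \<epsilon> True by (simp add: \<phi>_def sqpos_def power_mono)
          moreover have "0 < \<kappa> y" using yN \<epsilon> by (intro \<kappa>pos) (auto simp: N_def)
          ultimately show ?thesis using True yN by (simp add: mult.commute[of "\<kappa> y"])
        next
          case False
          have "0 \<le> \<kappa> y * \<phi> y"
          proof (cases "H y \<le> 2 * \<epsilon>")
            case True
            then have "\<phi> y = 0" by (simp add: \<phi>_def sqpos_eq_0_iff)
            then show ?thesis by simp
          next
            case False
            then have "0 < s * (u y - w y)" using HB \<epsilon> by linarith
            then have "0 < \<kappa> y" using True K by (intro \<kappa>pos) auto
            then show ?thesis using \<phi>nn[of y] by simp
          qed
          then show ?thesis using True False by simp
        qed
      next
        case False
        then have "y \<notin> N" using N(2) by auto
        then show ?thesis using False by simp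
      qed
    qed (use N\<kappa>i i5 in auto)
    finally show ?thesis using Fint by simp
  qed
  have gd_eq: "M' x = (LINT z|lborel. k z *\<^sub>R g (z + x))" if "x \<in> K" for x
    using M'g that B by auto
  have \<eta>b: "0 \<le> \<eta> x" "\<eta> x \<le> B0" for x
  proof -
    show "0 \<le> \<eta> x" by (simp add: \<eta>_def)
    show "\<eta> x \<le> B0"
    proof (cases "x \<in> K")
      case True
      have "\<bar>H x - s * (u x - w x)\<bar> \<le> \<epsilon>" using HuB B True by auto
      moreover have "\<bar>s * (u x - w x)\<bar> \<le> Cuw" using Cuw[OF True] sabs by (simp add: abs_mult)
      ultimately have "H x - 2 * \<epsilon> \<le> Cuw + \<epsilon>" using \<epsilon> by linarith
      then have "max 0 (H x - 2 * \<epsilon>) \<le> Cuw + \<epsilon>" using Cuw0 \<epsilon> by simp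
      then have "2 * max 0 (H x - 2 * \<epsilon>) \<le> 2 * (Cuw + \<epsilon>)"
        by (rule mult_left_mono) simp
      also have "\<dots> \<le> B0" by (simp add: B0_def)
      finally have "2 * max 0 (H x - 2 * \<epsilon>) \<le> B0" .
      then show ?thesis using True by (simp only: \<eta>_def if_True)
    qed (use B0 in \<open>simp add: \<eta>_def\<close>)
  qed
  have Fpt: "F x \<le> B0 * (a x * norm ((LINT z|lborel. k z *\<^sub>R g (z + x)) - g x))" for x
  proof (cases "x \<in> K")
    case True
    then have xU: "x \<in> U" using K by auto
    have \<phi>'e: "\<phi>' x = (s * \<eta> x) *\<^sub>R ((M' x - g x) + (g x - w' x))"
      using True by (simp add: \<phi>'_def \<eta>_def H'_def mult.commute)
    have "F x = - (s * s) * \<eta> x * ((A x - V x) \<bullet> (M' x - g x) + (A x - V x) \<bullet> (g x - w' x))"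
      using True unfolding F_def \<phi>'e by (simp add: inner_diff_left inner_add_right algebra_simps)
    also have "\<dots> \<le> - \<eta> x * ((A x - V x) \<bullet> (M' x - g x))"
      using p_laplace_monotone[OF p, of "g x" "w' x"] \<eta>b(1)[of x] s V[OF xU]
      by (simp add: A_def distrib_left)
    also have "\<dots> \<le> \<eta> x * (norm (A x - V x) * norm (M' x - g x))"
    proof -
      have "- ((A x - V x) \<bullet> (M' x - g x)) \<le> norm (A x - V x) * norm (M' x - g x)"
        using Cauchy_Schwarz_ineq2[of "A x - V x" "M' x - g x"] by linarith
      from mult_left_mono[OF this \<eta>b(1)[of x]] show ?thesis by simp
    qed
    also have "\<dots> \<le> B0 * (norm (A x - V x) * norm (M' x - g x))"
      using \<eta>b(2) by (intro mult_right_mono) auto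
    finally show ?thesis using True by (simp add: a_def gd_eq)
  next
    case False
    then have "F x = 0" using \<phi>0[OF False] by (simp add: F_def)
    then show ?thesis using B0 by (simp add: a_def)
  qed
  have upper: "(LINT x|lebesgue. F x) \<le> B0 * e"
  proof (rule integral_le_of_nn_integral_le[OF _ _ Fi])
    have meas: "(\<lambda>x. a x * norm ((LINT z|lborel. k z *\<^sub>R g (z + x)) - g x)) \<in> borel_measurable lborel"
    proof -
      have [measurable]: "k \<in> borel_measurable borel" using k(2) by (rule borel_measurable_continuous_onI)
      show ?thesis by measurable
    qed
    have "(\<integral>\<^sup>+x. F x \<partial>lebesgue) \<le> (\<integral>\<^sup>+x. ennreal B0 * ennreal (a x * norm ((LINT z|lborel. k z *\<^sub>R g (z + x)) - g x)) \<partial>lebesgue)"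
    proof (rule nn_integral_mono)
      fix x
      have "ennreal (F x) \<le> ennreal (B0 * (a x * norm ((LINT z|lborel. k z *\<^sub>R g (z + x)) - g x)))"
        by (rule ennreal_leI[OF Fpt])
      then show "ennreal (F x) \<le> ennreal B0 * ennreal (a x * norm ((LINT z|lborel. k z *\<^sub>R g (z + x)) - g x))"
        using B0 by (simp add: ennreal_mult')
    qed
    also have "\<dots> = (\<integral>\<^sup>+x. ennreal B0 * ennreal (a x * norm ((LINT z|lborel. k z *\<^sub>R g (z + x)) - g x)) \<partial>lborel)"
      by (rule nn_integral_completion)
    also have "\<dots> = ennreal B0 * (\<integral>\<^sup>+x. a x * norm ((LINT z|lborel. k z *\<^sub>R g (z + x)) - g x) \<partial>lborel)"
      by (rule nn_integral_cmult) (rule measurable_compose[OF meas measurable_ennreal])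
    also have "\<dots> \<le> ennreal B0 * ennreal e"
    proof (rule mult_left_mono)
      show "(\<integral>\<^sup>+x. a x * norm ((LINT z|lborel. k z *\<^sub>R g (z + x)) - g x) \<partial>lborel) \<le> ennreal e"
      proof (rule weighted_mollification_error[OF g_int am _ k(2,4,5,6,8)])
        show "0 \<le> a x" for x by (simp add: a_def)
        show "(\<integral>\<^sup>+x. a x * norm (g (z + x) - g x) \<partial>lborel) \<le> ennreal e" if "norm z < d" for z
          using d1(2)[of z] that d by auto
      qed
    qed simp
    also have "\<dots> = ennreal (B0 * e)" using B0 by (simp add: ennreal_mult')
    finally show "(\<integral>\<^sup>+x. F x \<partial>lebesgue) \<le> ennreal (B0 * e)" .
  qed (use B0 e in auto)
  have "B0 * e = \<epsilon>\<^sup>2 * c0 / 2" using B0 by (simp add: e_def)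
  moreover have "0 < \<epsilon>\<^sup>2 * c0" using \<epsilon> c0 by simp
  ultimately show False using lower upper by linarith
qed

section \<open>Radial barriers\<close>

lemma dead_core_comparison:
  fixes u w :: "'a::euclidean_space \<Rightarrow> real" and w' V :: "'a \<Rightarrow> 'a"
  assumes p: "2 \<le> p" and q: "0 \<le> q" and \<Omega>: "open \<Omega>"
    and lam: "set_borel_measurable lebesgue \<Omega> lam" "\<And>x. x \<in> \<Omega> \<Longrightarrow> \<bar>lam x\<bar> \<le> \<Lambda>"
    and sol: "dead_core_solution \<Omega> lam g p q u"
    and U: "open U" "U \<subseteq> \<Omega>" and K: "compact K" "K \<subseteq> U"
    and w: "\<And>x. x \<in> U \<Longrightarrow> GDERIV w x :> w' x" "continuous_on U w'"
    and V: "\<And>x. x \<in> U \<Longrightarrow> V x = norm (w' x) powr (p - 2) *\<^sub>R w' x"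
    and DV: "\<And>b x. b \<in> Basis \<Longrightarrow> x \<in> U \<Longrightarrow> GDERIV (\<lambda>x. V x \<bullet> b) x :> DV b x"
      "\<And>b. b \<in> Basis \<Longrightarrow> continuous_on U (DV b)"
    and s: "s * s = (1::real)"
    and off: "\<And>x. x \<in> U - K \<Longrightarrow> s * (u x - w x) \<le> 0"
    and strict: "\<And>x. x \<in> U \<Longrightarrow> 0 < s * (u x - w x) \<Longrightarrow>
      s * ((\<Sum>b\<in>Basis. DV b x \<bullet> b) - lam x * max (u x) 0 powr q) < 0"
    and x: "x \<in> U"
  shows "s * (u x - w x) \<le> 0"
proof -
  obtain G where G: "W1p_loc p \<Omega> u G" and eq: "\<And>\<phi>. \<phi> \<in> C1_0 \<Omega> \<Longrightarrow> (\<And>x. 0 \<le> \<phi> x) \<Longrightarrow>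
      (LINT x:\<Omega>|lebesgue. norm (G x) powr (p - 2) * (G x \<bullet> grad \<phi> x)) =
           - (LINT x:\<Omega>|lebesgue. lam x * max (u x) 0 powr q * \<phi> x)"
    using sol unfolding dead_core_solution_def weak_solution_def by blast
  have u: "continuous_on \<Omega> u"
    using sol closure_subset unfolding dead_core_solution_def by (auto intro: continuous_on_subset)
  have um: "(\<lambda>x. indicat_real \<Omega> x *\<^sub>R u x) \<in> borel_measurable lebesgue"
    using \<Omega> u by (intro borel_measurable_lebesgueI borel_measurable_continuous_on_indicator) auto
  have fm: "set_borel_measurable lebesgue \<Omega> (\<lambda>x. lam x * max (u x) 0 powr q)"
  proof -
    have "(\<lambda>x. (indicat_real \<Omega> x *\<^sub>R lam x) * max (indicat_real \<Omega> x *\<^sub>R u x) 0 powr q) \<in> borel_measurable lebesgue"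
      using lam(1) um unfolding set_borel_measurable_def
      by (intro borel_measurable_times powr_real_measurable borel_measurable_max borel_measurable_const)
    moreover have "(\<lambda>x. (indicat_real \<Omega> x *\<^sub>R lam x) * max (indicat_real \<Omega> x *\<^sub>R u x) 0 powr q) =
        (\<lambda>x. indicat_real \<Omega> x *\<^sub>R (lam x * max (u x) 0 powr q))"
      by (auto simp: fun_eq_iff indicator_def)
    ultimately show ?thesis by (simp add: set_borel_measurable_def)
  qed
  have fb: "bounded ((\<lambda>x. lam x * max (u x) 0 powr q) ` K)" if K: "compact K" "K \<subseteq> \<Omega>" for K
  proof -
    obtain C where C: "\<And>x. x \<in> K \<Longrightarrow> \<bar>u x\<bar> \<le> C"
      using compact_imp_bounded[OF compact_continuous_image[OF continuous_on_subset[OF u K(2)] K(1)]]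
      by (auto simp: bounded_iff)
    have "norm (lam x * max (u x) 0 powr q) \<le> \<Lambda> * max C 0 powr q" if "x \<in> K" for x
    proof -
      have "max (u x) 0 powr q \<le> max C 0 powr q"
        using C[OF that] q by (intro powr_mono2) auto
      moreover have "\<bar>lam x\<bar> \<le> \<Lambda>" using lam(2) that K by auto
      ultimately show ?thesis by (auto simp: abs_mult intro!: mult_mono)
    qed
    then show ?thesis by (auto simp: bounded_iff)
  qed
  show ?thesis
    by (rule weak_comparison[OF p \<Omega> G eq u fm fb U K w V DV s off strict x])
qed

text \<open>For a radial function \<open>w(x) = \<omega> t\<close>, \<open>t = \<bar>x - y\<bar>\<^sup>2\<close>, the flux \<open>\<bar>\<nabla>w\<bar>\<^bsup>p-2\<^esup> \<nabla>w\<close> is \<open>\<kappa> t (x - y)\<close> and its divergence is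
  \<open>2 t \<kappa>' t + N \<kappa> t\<close>.  Using the squared distance as the variable keeps everything differentiable at \<open>y\<close>.\<close>

lemma radial_comparison:
  fixes u :: "'a::euclidean_space \<Rightarrow> real" and \<omega> \<omega>' \<kappa> \<kappa>' :: "real \<Rightarrow> real"
  assumes p: "2 \<le> p" and q: "0 \<le> q" and \<Omega>: "open \<Omega>"
    and lam: "set_borel_measurable lebesgue \<Omega> lam" "\<And>x. x \<in> \<Omega> \<Longrightarrow> \<bar>lam x\<bar> \<le> \<Lambda>"
    and sol: "dead_core_solution \<Omega> lam g p q u"
    and U: "open U" "U \<subseteq> \<Omega>" and K: "compact K" "K \<subseteq> U"
    and T: "\<And>x. x \<in> U \<Longrightarrow> (x - y) \<bullet> (x - y) \<in> T"
    and \<omega>: "\<And>t. t \<in> T \<Longrightarrow> DERIV \<omega> t :> \<omega>' t" "continuous_on T \<omega>'"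
    and \<kappa>: "\<And>t. t \<in> T \<Longrightarrow> DERIV \<kappa> t :> \<kappa>' t" "continuous_on T \<kappa>'"
    and flux: "\<And>t. t \<in> T \<Longrightarrow> 0 \<le> t \<Longrightarrow> \<kappa> t = (2 * \<bar>\<omega>' t\<bar> * sqrt t) powr (p - 2) * (2 * \<omega>' t)"
    and s: "s * s = (1::real)"
    and off: "\<And>x. x \<in> U - K \<Longrightarrow> s * (u x - \<omega> ((x - y) \<bullet> (x - y))) \<le> 0"
    and strict: "\<And>x t. x \<in> U \<Longrightarrow> t = (x - y) \<bullet> (x - y) \<Longrightarrow> 0 < s * (u x - \<omega> t) \<Longrightarrow>
      s * ((2 * t * \<kappa>' t + real DIM('a) * \<kappa> t) - lam x * max (u x) 0 powr q) < 0"
    and x: "x \<in> U"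
  shows "s * (u x - \<omega> ((x - y) \<bullet> (x - y))) \<le> 0"
proof -
  define \<tau> where "\<tau> x = (x - y) \<bullet> (x - y)" for x
  have d\<tau>: "GDERIV \<tau> x :> 2 *\<^sub>R (x - y)" for x
    unfolding \<tau>_def[abs_def] gderiv_def by (auto intro!: derivative_eq_intros simp: inner_commute)
  have c\<tau>: "continuous_on U \<tau>" unfolding \<tau>_def[abs_def] by (intro continuous_intros)
  have T': "\<tau> x \<in> T" if "x \<in> U" for x using T[OF that] by (simp add: \<tau>_def)
  have comp: "continuous_on U (\<lambda>x. f (\<tau> x))" if "continuous_on T f" for f :: "real \<Rightarrow> real"
    by (rule continuous_on_compose2[OF that c\<tau>]) (use T' in auto)
  have ck: "continuous_on T \<kappa>"
    using \<kappa>(1) by (intro continuous_at_imp_continuous_on) (auto intro: DERIV_isCont)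
  define w' where "w' x = \<omega>' (\<tau> x) *\<^sub>R (2 *\<^sub>R (x - y))" for x
  define V where "V x = \<kappa> (\<tau> x) *\<^sub>R (x - y)" for x
  define DV where "DV b x = \<kappa> (\<tau> x) *\<^sub>R b + ((x - y) \<bullet> b) *\<^sub>R (\<kappa>' (\<tau> x) *\<^sub>R (2 *\<^sub>R (x - y)))" for b x
  have div: "(\<Sum>b\<in>Basis. DV b x \<bullet> b) = 2 * \<tau> x * \<kappa>' (\<tau> x) + real DIM('a) * \<kappa> (\<tau> x)" for x
  proof -
    have "(\<Sum>b\<in>Basis. DV b x \<bullet> b) = (\<Sum>b\<in>(Basis::'a set). \<kappa> (\<tau> x) + 2 * \<kappa>' (\<tau> x) * (((x - y) \<bullet> b) * ((x - y) \<bullet> b)))"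
      by (intro sum.cong) (auto simp: DV_def inner_add_left)
    also have "\<dots> = real DIM('a) * \<kappa> (\<tau> x) + 2 * \<kappa>' (\<tau> x) * (\<Sum>b\<in>Basis. ((x - y) \<bullet> b) * ((x - y) \<bullet> b))"
      by (simp add: sum.distrib sum_distrib_left)
    also have "(\<Sum>b\<in>Basis. ((x - y) \<bullet> b) * ((x - y) \<bullet> b)) = \<tau> x"
      unfolding \<tau>_def by (rule euclidean_inner[symmetric])
    finally show ?thesis by simp
  qed
  have "s * (u x - \<omega> (\<tau> x)) \<le> 0"
  proof (rule dead_core_comparison[OF p q \<Omega> lam sol U K _ _ _ _ _ s _ _ x, of "\<lambda>x. \<omega> (\<tau> x)" w' V DV])
    show "GDERIV (\<lambda>x. \<omega> (\<tau> x)) x :> w' x" if "x \<in> U" for x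
      unfolding w'_def by (rule GDERIV_DERIV_compose[OF d\<tau> \<omega>(1)[OF T'[OF that]]])
    show "continuous_on U w'"
      unfolding w'_def[abs_def] by (intro continuous_intros comp \<omega>(2))
    show "V x = norm (w' x) powr (p - 2) *\<^sub>R w' x" if "x \<in> U" for x
    proof -
      have "norm (w' x) = 2 * \<bar>\<omega>' (\<tau> x)\<bar> * sqrt (\<tau> x)"
        by (simp add: w'_def \<tau>_def norm_eq_sqrt_inner[of "x - y"] abs_mult)
      moreover have "0 \<le> \<tau> x" by (simp add: \<tau>_def)
      ultimately show ?thesis
        using flux[OF T'[OF that]] by (simp add: V_def w'_def)
    qed
    show "GDERIV (\<lambda>x. V x \<bullet> b) x :> DV b x" if "b \<in> Basis" "x \<in> U" for b x
    proof -
      have "GDERIV (\<lambda>x. (x - y) \<bullet> b) x :> b"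
        unfolding gderiv_def by (auto intro!: derivative_eq_intros)
      from GDERIV_mult[OF GDERIV_DERIV_compose[OF d\<tau> \<kappa>(1)[OF T'[OF that(2)]]] this]
      show ?thesis by (simp add: V_def[abs_def] DV_def)
    qed
    show "continuous_on U (DV b)" for b
      unfolding DV_def[abs_def] by (intro continuous_intros comp ck \<kappa>(2))
    show "s * (u x - \<omega> (\<tau> x)) \<le> 0" if "x \<in> U - K" for x
      using off[OF that] by (simp add: \<tau>_def)
    show "s * ((\<Sum>b\<in>Basis. DV b x \<bullet> b) - lam x * max (u x) 0 powr q) < 0"
      if "x \<in> U" "0 < s * (u x - \<omega> (\<tau> x))" for x
      using strict[OF that(1) refl] that(2) unfolding div by (simp add: \<tau>_def)
  qed
  then show ?thesis by (simp add: \<tau>_def)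
qed

text \<open>The cut-off \<open>max 0 t\<close> makes the power differentiable on both sides of \<open>0\<close>, which is needed at the centre
  of the barrier in \<open>power_barrier\<close>.\<close>

lemma DERIV_pos_powr:
  fixes e :: real
  assumes "1 < e"
  shows "DERIV (\<lambda>t. max 0 t powr e) t :> e * max 0 t powr (e - 1)"
proof -
  consider "t < 0" | "t = 0" | "0 < t" by linarith
  then show ?thesis
  proof cases
    case 1
    have "DERIV (\<lambda>t. 0) t :> (e * max 0 t powr (e - 1))" using 1 by (simp add: max_def)
    then show ?thesis
      by (rule has_field_derivative_transform_within_open[of _ _ _ "{..<0}"])
        (use 1 in \<open>auto simp: max_def\<close>)
  next
    case 2
    have "(\<lambda>h. max 0 h powr e / h) \<midarrow>0\<rightarrow> 0"
    proof (rule Lim_null_comparison[where g = "\<lambda>h. \<bar>h\<bar> powr (e - 1)"])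
      show "eventually (\<lambda>h. norm (max 0 h powr e / h) \<le> \<bar>h\<bar> powr (e - 1)) (at 0)"
      proof (intro always_eventually allI)
        fix h :: real
        show "norm (max 0 h powr e / h) \<le> \<bar>h\<bar> powr (e - 1)"
        proof (cases "0 < h")
          case True
          then show ?thesis using powr_diff[of h e 1] by simp
        qed (simp add: max_def)
      qed
      have "((\<lambda>h::real. \<bar>h\<bar> powr (e - 1)) \<longlongrightarrow> \<bar>0\<bar> powr (e - 1)) (at 0)"
        using assms by (intro tendsto_powr2 tendsto_intros) auto
      then show "((\<lambda>h::real. \<bar>h\<bar> powr (e - 1)) \<longlongrightarrow> 0) (at 0)" by simp
    qed
    then show ?thesis
      unfolding DERIV_def 2 by simp
  next
    case 3
    have "DERIV (\<lambda>t. t powr e) t :> (e * max 0 t powr (e - 1))"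
      using 3 by (auto intro!: derivative_eq_intros)
    then show ?thesis
      by (rule has_field_derivative_transform_within_open[of _ _ _ "{0<..}"])
        (use 3 in \<open>auto simp: max_def\<close>)
  qed
qed

lemma square_powr:
  fixes x c :: real assumes "0 \<le> x" shows "(x\<^sup>2) powr c = x powr (2 * c)"
proof (cases "x = 0")
  case False
  then have "x\<^sup>2 = x powr 2" using assms by (simp add: powr_realpow[of x 2, simplified])
  then show ?thesis by (simp only: powr_powr)
qed simp

text \<open>With \<open>\<alpha> = N / (p - 1)\<close> the flux of the bent cone is \<open>- a\<^bsup>p-1\<^esup> \<bar>x - y\<bar>\<^bsup>-N-1\<^esup> (x - y)\<close>, a little more singular
  than the divergence-free field \<open>\<bar>x - y\<bar>\<^bsup>-N\<^esup> (x - y)\<close>, so its divergence \<open>a\<^bsup>p-1\<^esup> \<bar>x - y\<bar>\<^bsup>-N-1\<^esup>\<close> is positive; the assumption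
  \<open>large\<close> says that on the sphere of radius \<open>R\<close> it beats the reaction term.  The centre, where the cone is not
  smooth, is harmless because the cone lies below \<open>u\<close> there.\<close>

lemma cone_barrier:
  fixes u :: "'a::euclidean_space \<Rightarrow> real" and y :: 'a
  assumes p: "2 \<le> p" and q: "0 \<le> q" and \<Omega>: "open \<Omega>"
    and lam: "set_borel_measurable lebesgue \<Omega> lam" "\<And>x. x \<in> \<Omega> \<Longrightarrow> \<bar>lam x\<bar> \<le> \<Lambda>"
    and sol: "dead_core_solution \<Omega> lam g p q u"
    and R: "0 < R" "cball y (2 * R) \<subseteq> \<Omega>" and M: "0 < M" "M < u y"
    and \<alpha>: "\<alpha> = real DIM('a) / (p - 1)" "\<alpha> < 1"
    and large: "\<Lambda> * R * M powr q < ((1 - \<alpha>) * M / R) powr (p - 1)"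
    and x: "x \<in> ball y (2 * R)" "x \<noteq> y"
  shows "M - M * (dist y x / R) powr (1 - \<alpha>) \<le> u x"
proof -
  define n where "n = real DIM('a)"
  define b where "b = M / R powr (1 - \<alpha>)"
  define a where "a = (1 - \<alpha>) * b"
  have p1: "0 < p - 1" using p by simp
  have ap: "\<alpha> * (p - 1) = n" using p1 by (simp add: \<alpha> n_def)
  have \<alpha>0: "0 \<le> \<alpha>" using p1 by (simp add: \<alpha>)
  have b: "0 < b" using M R by (simp add: b_def)
  have a: "0 < a" using b \<alpha> by (simp add: a_def)
  define \<omega> where "\<omega> t = M - b * t powr ((1 - \<alpha>) / 2)" for t :: real
  define \<omega>' where "\<omega>' t = - (a / 2) * t powr (- (1 + \<alpha>) / 2)" for t :: real
  define \<kappa> where "\<kappa> t = - (a powr (p - 1)) * t powr (- (n + 1) / 2)" for t :: real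
  define \<kappa>' where "\<kappa>' t = a powr (p - 1) * ((n + 1) / 2) * t powr (- (n + 1) / 2 - 1)" for t :: real
  have d\<omega>: "DERIV \<omega> t :> \<omega>' t" if "0 < t" for t
  proof -
    have e: "(1 - \<alpha>) / 2 - 1 = - (1 + \<alpha>) / 2" by (simp add: field_simps)
    have "0 - b * ((1 - \<alpha>) / 2 * z) = - (a / 2) * z" for z by (simp add: a_def)
    then show ?thesis
      unfolding \<omega>_def[abs_def] \<omega>'_def e[symmetric]
      by (intro DERIV_cong[OF DERIV_diff[OF DERIV_const DERIV_cmult[OF has_real_derivative_powr[OF that]]]])
  qed
  have d\<kappa>: "DERIV \<kappa> t :> \<kappa>' t" if "0 < t" for t
  proof -
    have "- (a powr (p - 1)) * (- (n + 1) / 2 * z) = a powr (p - 1) * ((n + 1) / 2) * z" for z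
      by (simp add: field_simps)
    then show ?thesis
      unfolding \<kappa>_def[abs_def] \<kappa>'_def
      by (intro DERIV_cong[OF DERIV_cmult[OF has_real_derivative_powr[OF that]]])
  qed
  have flux: "\<kappa> t = (2 * \<bar>\<omega>' t\<bar> * sqrt t) powr (p - 2) * (2 * \<omega>' t)" if t: "0 < t" for t
  proof -
    have "2 * \<bar>\<omega>' t\<bar> * sqrt t = a * (t powr (- (1 + \<alpha>) / 2) * t powr (1 / 2))"
      using a t by (simp add: \<omega>'_def abs_mult powr_half_sqrt)
    also have "t powr (- (1 + \<alpha>) / 2) * t powr (1 / 2) = t powr (- \<alpha> / 2)"
      unfolding powr_add[symmetric] by (simp add: field_simps)
    finally have "(2 * \<bar>\<omega>' t\<bar> * sqrt t) powr (p - 2) = a powr (p - 2) * t powr (- \<alpha> / 2 * (p - 2))"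
      using a t by (simp add: powr_mult powr_powr)
    then have "(2 * \<bar>\<omega>' t\<bar> * sqrt t) powr (p - 2) * (2 * \<omega>' t) =
       - (a powr (p - 2) * a) * (t powr (- \<alpha> / 2 * (p - 2)) * t powr (- (1 + \<alpha>) / 2))"
      by (simp add: \<omega>'_def)
    also have "a powr (p - 2) * a = a powr (p - 1)"
      using a powr_add[of a "p - 2" 1] by simp
    also have "t powr (- \<alpha> / 2 * (p - 2)) * t powr (- (1 + \<alpha>) / 2) = t powr (- (n + 1) / 2)"
    proof -
      have "- \<alpha> / 2 * (p - 2) + - (1 + \<alpha>) / 2 = - (\<alpha> * (p - 1) + 1) / 2" by (simp add: field_simps)
      then show ?thesis by (simp only: powr_add[symmetric] ap)
    qed
    finally show ?thesis by (simp add: \<kappa>_def)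
  qed
  have div: "2 * t * \<kappa>' t + n * \<kappa> t = a powr (p - 1) * t powr (- (n + 1) / 2)" if t: "0 < t" for t
  proof -
    have "t * t powr (- (n + 1) / 2 - 1) = t powr (- (n + 1) / 2)"
      using t powr_add[of t 1 "- (n + 1) / 2 - 1"] by simp
    then have "2 * t * \<kappa>' t = a powr (p - 1) * (n + 1) * t powr (- (n + 1) / 2)"
      by (simp add: \<kappa>'_def)
    then show ?thesis by (simp add: \<kappa>_def algebra_simps)
  qed
  have tR: "(dist y x)\<^sup>2 = (x - y) \<bullet> (x - y)" for x
    by (simp add: dist_norm norm_minus_commute power2_norm_eq_inner)
  have \<omega>dist: "\<omega> ((x - y) \<bullet> (x - y)) = M - M * (dist y x / R) powr (1 - \<alpha>)" for x
  proof -
    have "((dist y x)\<^sup>2) powr ((1 - \<alpha>) / 2) = dist y x powr (1 - \<alpha>)"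
    proof -
      have "2 * ((1 - \<alpha>) / 2) = 1 - \<alpha>" by simp
      then show ?thesis by (simp only: square_powr[OF zero_le_dist])
    qed
    then show ?thesis
      using R by (simp add: \<omega>_def tR[symmetric] b_def powr_divide)
  qed
  have neg_far: "\<omega> ((x - y) \<bullet> (x - y)) \<le> 0" if "R \<le> dist y x" for x
  proof -
    have "1 powr (1 - \<alpha>) \<le> (dist y x / R) powr (1 - \<alpha>)"
      using that R \<alpha> by (intro powr_mono2) auto
    then show ?thesis unfolding \<omega>dist using M by (simp add: mult_le_cancel_left1)
  qed
  have \<omega>M: "\<omega> t \<le> M" for t using b by (simp add: \<omega>_def)
  define U where "U = ball y (2 * R) - {y}"
  define K where "K = {x \<in> cball y R. u x \<le> \<omega> ((x - y) \<bullet> (x - y))}"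
  have U\<Omega>: "U \<subseteq> \<Omega>" unfolding U_def using R(2) ball_subset_cball by blast
  have cR: "cball y R \<subseteq> \<Omega>" using R by auto
  have u: "continuous_on \<Omega> u" and u0: "\<And>x. x \<in> \<Omega> \<Longrightarrow> 0 \<le> u x"
    using sol closure_subset unfolding dead_core_solution_def by (auto intro: continuous_on_subset)
  have Kc: "compact K"
  proof -
    have "continuous_on (cball y R) (\<lambda>x. \<omega> ((x - y) \<bullet> (x - y)))"
      unfolding \<omega>_def using \<alpha> by (intro continuous_intros continuous_on_powr') auto
    then have "closed {x \<in> cball y R. u x \<le> \<omega> ((x - y) \<bullet> (x - y))}"
      using continuous_on_subset[OF u cR] by (intro continuous_on_closed_Collect_le) auto
    moreover have "bounded K" unfolding K_def by (rule bounded_subset[OF bounded_cball]) auto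
    ultimately show ?thesis by (simp add: K_def compact_eq_bounded_closed)
  qed
  have yK: "y \<notin> K" using M by (simp add: K_def \<omega>_def)
  have "(-1) * (u x - \<omega> ((x - y) \<bullet> (x - y))) \<le> 0"
  proof (rule radial_comparison[OF p q \<Omega> lam sol _ U\<Omega> Kc, where T = "{0<..}" and \<omega>' = \<omega>' and \<kappa> = \<kappa> and \<kappa>' = \<kappa>'])
    show "open U" by (simp add: U_def open_Diff)
    show "K \<subseteq> U" using yK R by (auto simp: U_def K_def)
    show "(x - y) \<bullet> (x - y) \<in> {0<..}" if "x \<in> U" for x using that by (simp add: U_def)
    show "DERIV \<omega> t :> \<omega>' t" if "t \<in> {0<..}" for t using d\<omega> that by simp
    show "DERIV \<kappa> t :> \<kappa>' t" if "t \<in> {0<..}" for t using d\<kappa> that by simp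
    show "continuous_on {0<..} \<omega>'" unfolding \<omega>'_def[abs_def] by (intro continuous_intros) auto
    show "continuous_on {0<..} \<kappa>'" unfolding \<kappa>'_def[abs_def] by (intro continuous_intros) auto
    show "\<kappa> t = (2 * \<bar>\<omega>' t\<bar> * sqrt t) powr (p - 2) * (2 * \<omega>' t)" if "t \<in> {0<..}" "0 \<le> t" for t
      using flux that by simp
    show "(-1) * (u x - \<omega> ((x - y) \<bullet> (x - y))) \<le> 0" if "x \<in> U - K" for x
    proof (cases "dist y x \<le> R")
      case True then show ?thesis using that by (simp add: K_def)
    next
      case False
      then show ?thesis using neg_far[of x] u0[of x] that U\<Omega> by auto
    qed
    show "x \<in> U" using x by (simp add: U_def)
    show "(-1) * (2 * t * \<kappa>' t + real DIM('a) * \<kappa> t - lam x * max (u x) 0 powr q) < 0"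
      if xU: "x \<in> U" and t: "t = (x - y) \<bullet> (x - y)" and pos: "0 < (-1) * (u x - \<omega> t)" for x t
    proof -
      have x\<Omega>: "x \<in> \<Omega>" using xU U\<Omega> by auto
      have ux: "0 \<le> u x" "u x < \<omega> t" using u0[OF x\<Omega>] pos by auto
      have t0: "0 < t" using xU t by (simp add: U_def)
      have dR: "dist y x < R" using neg_far[of x] ux t by force
      have "t < R\<^sup>2" using dR unfolding t tR[symmetric] by (intro power_strict_mono) auto
      have "R powr (- (n + 1)) = (R\<^sup>2) powr (- (n + 1) / 2)"
      proof -
        have "2 * (- (n + 1) / 2) = - (n + 1)" by simp
        then show ?thesis using R by (simp only: square_powr[OF less_imp_le])
      qed
      also have "\<dots> \<le> t powr (- (n + 1) / 2)"
        using \<open>t < R\<^sup>2\<close> t0 by (intro powr_mono2') (auto simp: n_def)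
      finally have "a powr (p - 1) * R powr (- (n + 1)) \<le> 2 * t * \<kappa>' t + n * \<kappa> t"
        unfolding div[OF t0] by (intro mult_left_mono) auto
      moreover have "a powr (p - 1) * R powr (- (n + 1)) = ((1 - \<alpha>) * M / R) powr (p - 1) / R"
      proof -
        have aeq: "a = ((1 - \<alpha>) * M / R) * R powr \<alpha>"
          using R by (simp add: a_def b_def powr_diff)
        have z: "0 \<le> (1 - \<alpha>) * M / R" using R M \<alpha> by simp
        have "a powr (p - 1) = ((1 - \<alpha>) * M / R) powr (p - 1) * (R powr \<alpha>) powr (p - 1)"
          unfolding aeq by (rule powr_mult)
        then have "a powr (p - 1) = ((1 - \<alpha>) * M / R) powr (p - 1) * R powr n"
          by (simp only: powr_powr ap)
        moreover have "R powr n * R powr (- (n + 1)) = 1 / R"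
          unfolding powr_add[symmetric] using R by (simp add: powr_minus_divide)
        ultimately show ?thesis by (simp add: mult.assoc)
      qed
      moreover have "lam x * max (u x) 0 powr q \<le> \<Lambda> * M powr q"
      proof (rule mult_mono)
        show "lam x \<le> \<Lambda>" using lam(2)[OF x\<Omega>] by simp
        show "max (u x) 0 powr q \<le> M powr q"
          using ux \<omega>M[of t] q by (intro powr_mono2) auto
        show "0 \<le> \<Lambda>" using lam(2)[OF x\<Omega>] by linarith
      qed simp
      moreover have "\<Lambda> * M powr q < ((1 - \<alpha>) * M / R) powr (p - 1) / R"
        using large R by (simp add: field_simps)
      ultimately show ?thesis by (simp add: n_def)
    qed
  qed simp_all
  then show ?thesis by (simp add: \<omega>dist)
qed

text \<open>The exponent \<open>\<beta>\<close> is the one for which the divergence of the flux and the reaction term of \<open>k \<bar>x - y\<bar>\<^bsup>\<beta>\<^esup>\<close>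
  scale alike, since \<open>(\<beta> - 1) (p - 1) - 1 = \<beta> q\<close>; the assumption \<open>large\<close> compares the constants.  The shift
  by \<open>\<tau>\<^sup>2\<close> makes the barrier smooth at the centre, where it has to be compared with \<open>u\<close>.\<close>

lemma power_barrier:
  fixes u :: "'a::euclidean_space \<Rightarrow> real" and y :: 'a
  assumes p: "4 < p" and q: "0 \<le> q" "q < p - 1" and \<Omega>: "open \<Omega>"
    and lam: "set_borel_measurable lebesgue \<Omega> lam" "\<And>x. x \<in> \<Omega> \<Longrightarrow> \<bar>lam x\<bar> \<le> \<Lambda>"
      "\<And>x. x \<in> \<Omega> \<Longrightarrow> m \<le> lam x" "0 < m"
    and sol: "dead_core_solution \<Omega> lam g p q u"
    and \<rho>: "0 < \<rho>" "cball y \<rho> \<subseteq> \<Omega>" and k: "0 < k" and \<tau>: "0 < \<tau>"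
    and \<beta>: "\<beta> = p / (p - 1 - q)"
    and large: "(k * \<beta>) powr (p - 1) * (real DIM('a) + p + \<beta> * p) < m * k powr q"
    and sphere: "\<And>x. dist y x = \<rho> \<Longrightarrow> u x < k * \<rho> powr \<beta>"
  shows "u y \<le> k * \<tau> powr \<beta>"
proof -
  define n where "n = real DIM('a)"
  have \<beta>0: "0 < \<beta>" using p q by (simp add: \<beta>)
  have \<beta>q: "\<beta> * q = \<beta> * (p - 1) - p" using p q by (simp add: \<beta> field_simps)
  define e where "e = (p - 2) / 2"
  define c where "c = (\<beta> / 2 - 1) * (p - 1)"
  define C where "C = (k * \<beta>) powr (p - 1)"
  have e: "1 < e" using p by (simp add: e_def)
  have C: "0 < C" using k \<beta>0 by (simp add: C_def)
  define \<omega> where "\<omega> t = k * (t + \<tau>\<^sup>2) powr (\<beta> / 2)" for t :: real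
  define \<omega>' where "\<omega>' t = k * (\<beta> / 2) * (t + \<tau>\<^sup>2) powr (\<beta> / 2 - 1)" for t :: real
  define \<kappa> where "\<kappa> t = C * ((t + \<tau>\<^sup>2) powr c * max 0 t powr e)" for t :: real
  define \<kappa>' where "\<kappa>' t = C * (c * (t + \<tau>\<^sup>2) powr (c - 1) * max 0 t powr e +
     (t + \<tau>\<^sup>2) powr c * (e * max 0 t powr (e - 1)))" for t :: real
  define T where "T = {- \<tau>\<^sup>2 <..}"
  have T: "0 < t + \<tau>\<^sup>2" if "t \<in> T" for t using that by (simp add: T_def)
  have d\<omega>: "DERIV \<omega> t :> \<omega>' t" if "t \<in> T" for t
    unfolding \<omega>_def[abs_def] \<omega>'_def using T[OF that]
    by (auto intro!: derivative_eq_intros)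
  have d\<kappa>: "DERIV \<kappa> t :> \<kappa>' t" if "t \<in> T" for t
  proof -
    have "DERIV (\<lambda>t. (t + \<tau>\<^sup>2) powr c) t :> c * (t + \<tau>\<^sup>2) powr (c - 1)"
      using T[OF that] by (auto intro!: derivative_eq_intros)
    from DERIV_cmult[OF DERIV_mult[OF this DERIV_pos_powr[OF e]], of C]
    show ?thesis
      unfolding \<kappa>_def[abs_def] \<kappa>'_def by (simp add: add.commute mult.commute mult.left_commute)
  qed
  have flux: "\<kappa> t = (2 * \<bar>\<omega>' t\<bar> * sqrt t) powr (p - 2) * (2 * \<omega>' t)" if t: "0 \<le> t" for t
  proof -
    have s: "0 < t + \<tau>\<^sup>2" using t \<tau> by (simp add: add_nonneg_pos)
    define z where "z = 2 * \<omega>' t"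
    have z: "z = (k * \<beta>) * (t + \<tau>\<^sup>2) powr (\<beta> / 2 - 1)" "0 < z"
      using k \<beta>0 s by (auto simp: z_def \<omega>'_def)
    have "(2 * \<bar>\<omega>' t\<bar> * sqrt t) powr (p - 2) * (2 * \<omega>' t) = (z * sqrt t) powr (p - 2) * z"
      using z by (simp add: z_def abs_mult)
    also have "\<dots> = (z powr (p - 2) * z) * sqrt t powr (p - 2)"
      using z t by (simp add: powr_mult)
    also have "z powr (p - 2) * z = z powr (p - 1)"
      using z powr_add[of z "p - 2" 1] by simp
    also have "z powr (p - 1) = C * (t + \<tau>\<^sup>2) powr c"
      unfolding z using k \<beta>0 s by (simp add: powr_mult powr_powr C_def c_def)
    also have "sqrt t powr (p - 2) = max 0 t powr e"
      using t by (simp add: powr_half_sqrt[symmetric] powr_powr e_def)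
    finally show ?thesis by (simp add: \<kappa>_def)
  qed
  have div: "2 * t * \<kappa>' t + n * \<kappa> t \<le> C * (n + p + \<beta> * p) * (t + \<tau>\<^sup>2) powr (\<beta> * q / 2)" if t: "0 \<le> t" for t
  proof -
    have s: "0 < t + \<tau>\<^sup>2" using t \<tau> by (simp add: add_nonneg_pos)
    have te: "t * max 0 t powr (e - 1) = max 0 t powr e"
      using t powr_add[of t 1 "e - 1"] by (cases "t = 0") auto
    have tc: "t * (t + \<tau>\<^sup>2) powr (c - 1) = (t / (t + \<tau>\<^sup>2)) * (t + \<tau>\<^sup>2) powr c"
      using s powr_diff[of "t + \<tau>\<^sup>2" c 1] by simp
    define PT where "PT = (t + \<tau>\<^sup>2) powr c * max 0 t powr e"
    have PT: "0 \<le> PT" by (simp add: PT_def)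
    have "2 * t * \<kappa>' t = C * (2 * c * (t * (t + \<tau>\<^sup>2) powr (c - 1)) * max 0 t powr e +
        2 * e * (t + \<tau>\<^sup>2) powr c * (t * max 0 t powr (e - 1)))"
      by (simp add: \<kappa>'_def algebra_simps)
    also have "\<dots> = C * (2 * c * (t / (t + \<tau>\<^sup>2)) + 2 * e) * PT"
      unfolding te tc by (simp add: PT_def algebra_simps)
    finally have "2 * t * \<kappa>' t + n * \<kappa> t = C * (n + 2 * e + 2 * c * (t / (t + \<tau>\<^sup>2))) * PT"
      by (simp add: \<kappa>_def PT_def algebra_simps)
    also have "\<dots> \<le> C * (n + p + \<beta> * p) * PT"
    proof (intro mult_right_mono mult_left_mono)
      have fr: "0 \<le> t / (t + \<tau>\<^sup>2)" "t / (t + \<tau>\<^sup>2) \<le> 1" using t s by auto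
      have "2 * c \<le> \<beta> * p"
      proof -
        have "2 * c = \<beta> * p - \<beta> - 2 * p + 2" by (simp add: c_def field_simps)
        then show ?thesis using \<beta>0 p by linarith
      qed
      then have "2 * c * (t / (t + \<tau>\<^sup>2)) \<le> \<beta> * p * (t / (t + \<tau>\<^sup>2))"
        by (rule mult_right_mono) (rule fr)
      also have "\<dots> \<le> \<beta> * p * 1"
        using fr \<beta>0 p by (intro mult_left_mono) auto
      finally have "2 * c * (t / (t + \<tau>\<^sup>2)) \<le> \<beta> * p" by simp
      moreover have "2 * e = p - 2" by (simp add: e_def)
      ultimately show "n + 2 * e + 2 * c * (t / (t + \<tau>\<^sup>2)) \<le> n + p + \<beta> * p"
        by linarith
    qed (use C PT in auto)
    also have "\<dots> \<le> C * (n + p + \<beta> * p) * (t + \<tau>\<^sup>2) powr (\<beta> * q / 2)"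
    proof (rule mult_left_mono)
      have "PT \<le> (t + \<tau>\<^sup>2) powr c * (t + \<tau>\<^sup>2) powr e"
        unfolding PT_def using t e by (intro mult_left_mono powr_mono2) auto
      also have "\<dots> = (t + \<tau>\<^sup>2) powr (c + e)" by (rule powr_add[symmetric])
      also have "c + e = \<beta> * q / 2"
        unfolding \<beta>q by (simp add: c_def e_def field_simps)
      finally show "PT \<le> (t + \<tau>\<^sup>2) powr (\<beta> * q / 2)" .
    qed (use C \<beta>0 p in \<open>auto simp: n_def\<close>)
    finally show ?thesis .
  qed
  have \<omega>pos: "0 < \<omega> t" if "0 \<le> t" for t
  proof -
    have "0 < t + \<tau>\<^sup>2" using that \<tau> by (simp add: add_nonneg_pos)
    then show ?thesis using k by (simp add: \<omega>_def)
  qed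
  define U where "U = ball y \<rho>"
  define K where "K = {x \<in> cball y \<rho>. \<omega> ((x - y) \<bullet> (x - y)) \<le> u x}"
  have U\<Omega>: "U \<subseteq> \<Omega>" using \<rho> by (auto simp: U_def)
  have u: "continuous_on \<Omega> u" and u0: "\<And>x. x \<in> \<Omega> \<Longrightarrow> 0 \<le> u x"
    using sol closure_subset unfolding dead_core_solution_def by (auto intro: continuous_on_subset)
  have Kc: "compact K"
  proof -
    have "continuous_on (cball y \<rho>) (\<lambda>x. \<omega> ((x - y) \<bullet> (x - y)))"
      unfolding \<omega>_def using \<beta>0 \<tau> by (intro continuous_intros continuous_on_powr') (auto simp: add_nonneg_eq_0_iff)
    then have "closed {x \<in> cball y \<rho>. \<omega> ((x - y) \<bullet> (x - y)) \<le> u x}"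
      using continuous_on_subset[OF u \<rho>(2)] by (intro continuous_on_closed_Collect_le) auto
    moreover have "bounded K" unfolding K_def by (rule bounded_subset[OF bounded_cball]) auto
    ultimately show ?thesis by (simp add: K_def compact_eq_bounded_closed)
  qed
  have K_ball: "K \<subseteq> U"
  proof
    fix x assume x: "x \<in> K"
    have "dist y x \<noteq> \<rho>"
    proof
      assume d: "dist y x = \<rho>"
      have "\<rho> powr \<beta> = (\<rho>\<^sup>2) powr (\<beta> / 2)"
        using \<rho> by (simp add: square_powr)
      also have "\<dots> \<le> ((x - y) \<bullet> (x - y) + \<tau>\<^sup>2) powr (\<beta> / 2)"
      proof (rule powr_mono2)
        have "(x - y) \<bullet> (x - y) = \<rho>\<^sup>2"
          using d by (simp add: dist_norm norm_minus_commute power2_norm_eq_inner[symmetric])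
        then show "\<rho>\<^sup>2 \<le> (x - y) \<bullet> (x - y) + \<tau>\<^sup>2" by simp
      qed (use \<beta>0 in auto)
      finally have "k * \<rho> powr \<beta> \<le> \<omega> ((x - y) \<bullet> (x - y))"
        using k by (simp add: \<omega>_def)
      then show False using sphere[OF d] x by (simp add: K_def)
    qed
    then show "x \<in> U" using x by (auto simp: K_def U_def)
  qed
  have p2: "2 \<le> p" using p by simp
  have "1 * (u y - \<omega> ((y - y) \<bullet> (y - y))) \<le> 0"
  proof (rule radial_comparison[OF p2 q(1) \<Omega> lam(1,2) sol _ U\<Omega> Kc K_ball, where T = T and \<omega>' = \<omega>' and \<kappa> = \<kappa> and \<kappa>' = \<kappa>'])
    show "open U" by (simp add: U_def)
    show "(x - y) \<bullet> (x - y) \<in> T" if "x \<in> U" for x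
      using \<tau> by (simp add: T_def less_le_trans[of "- \<tau>\<^sup>2" 0])
    show "DERIV \<omega> t :> \<omega>' t" if "t \<in> T" for t using d\<omega> that by simp
    show "DERIV \<kappa> t :> \<kappa>' t" if "t \<in> T" for t using d\<kappa> that by simp
    show "continuous_on T \<omega>'" unfolding \<omega>'_def[abs_def]
      by (intro continuous_intros) (use T in force)
    show "continuous_on T \<kappa>'" unfolding \<kappa>'_def[abs_def]
      by (intro continuous_intros continuous_on_powr') (use T e in \<open>force simp: less_imp_le\<close>)+
    show "\<kappa> t = (2 * \<bar>\<omega>' t\<bar> * sqrt t) powr (p - 2) * (2 * \<omega>' t)" if "t \<in> T" "0 \<le> t" for t
      using flux that by simp
    show "1 * (u x - \<omega> ((x - y) \<bullet> (x - y))) \<le> 0" if "x \<in> U - K" for x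
      using that by (auto simp: U_def K_def)
    show "y \<in> U" using \<rho> by (simp add: U_def)
    show "1 * (2 * t * \<kappa>' t + real DIM('a) * \<kappa> t - lam x * max (u x) 0 powr q) < 0"
      if xU: "x \<in> U" and t: "t = (x - y) \<bullet> (x - y)" and pos: "0 < 1 * (u x - \<omega> t)" for x t
    proof -
      have x\<Omega>: "x \<in> \<Omega>" using xU U\<Omega> by auto
      have t0: "0 \<le> t" by (simp add: t)
      have s: "0 < t + \<tau>\<^sup>2" using t0 \<tau> by (simp add: add_nonneg_pos)
      have "m * (k powr q * (t + \<tau>\<^sup>2) powr (\<beta> * q / 2)) = m * \<omega> t powr q"
        using k s by (simp add: \<omega>_def powr_mult powr_powr)
      also have "\<dots> \<le> lam x * max (u x) 0 powr q"
        using lam(3)[OF x\<Omega>] lam(4) pos \<omega>pos[OF t0] q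
        by (intro mult_mono powr_mono2) auto
      finally have f: "m * k powr q * (t + \<tau>\<^sup>2) powr (\<beta> * q / 2) \<le> lam x * max (u x) 0 powr q"
        by simp
      have "2 * t * \<kappa>' t + n * \<kappa> t \<le> C * (n + p + \<beta> * p) * (t + \<tau>\<^sup>2) powr (\<beta> * q / 2)"
        by (rule div[OF t0])
      also have "\<dots> < m * k powr q * (t + \<tau>\<^sup>2) powr (\<beta> * q / 2)"
        using large s by (intro mult_strict_right_mono) (auto simp: C_def n_def)
      finally show ?thesis using f by (simp add: n_def)
    qed
  qed simp_all
  then have "u y \<le> k * (\<tau>\<^sup>2) powr (\<beta> / 2)" by (simp add: \<omega>_def)
  also have "(\<tau>\<^sup>2) powr (\<beta> / 2) = \<tau> powr \<beta>"
    using \<tau> by (simp add: square_powr)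
  finally show ?thesis .
qed

section \<open>Nondegeneracy and growth of limit solutions\<close>

text \<open>Take logarithms and divide by \<open>P j\<close>: in the limit the condition becomes \<open>ln (M / R) > l ln M\<close>, which is
  the hypothesis on \<open>M\<close>.\<close>

lemma eventually_cone_condition:
  fixes P Q :: "nat \<Rightarrow> real"
  assumes P: "filterlim P at_top sequentially" and Q: "(\<lambda>j. Q j / P j) \<longlonglongrightarrow> l"
    and pos: "0 < \<Lambda>" "0 < M" "0 < R" and l: "l < 1" and M: "R < M powr (1 - l)"
  shows "eventually (\<lambda>j. n / (P j - 1) < 1 \<and>
      \<Lambda> * R * M powr Q j < ((1 - n / (P j - 1)) * M / R) powr (P j - 1)) sequentially"
proof -
  define \<alpha> where "\<alpha> j = n / (P j - 1)" for j
  have P1: "filterlim (\<lambda>j. P j - 1) at_top sequentially"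
    using filterlim_tendsto_add_at_top[OF tendsto_const[of "-1"] P] by simp
  have \<alpha>: "\<alpha> \<longlonglongrightarrow> 0"
    unfolding \<alpha>_def[abs_def] by (rule real_tendsto_divide_at_top[OF tendsto_const P1])
  have c0: "(\<lambda>j. c / P j) \<longlonglongrightarrow> 0" for c
    by (rule real_tendsto_divide_at_top[OF tendsto_const P])
  define F where "F j = (1 - 1 / P j) * ln ((1 - \<alpha> j) * M / R) - Q j / P j * ln M - ln (\<Lambda> * R) / P j" for j
  have "F \<longlonglongrightarrow> (1 - 0) * ln ((1 - 0) * M / R) - l * ln M - 0"
    unfolding F_def[abs_def] using pos by (intro tendsto_intros c0 \<alpha> Q) auto
  moreover have "0 < (1 - 0) * ln ((1 - 0) * M / R) - l * ln M - 0"
  proof -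
    have "ln R < ln (M powr (1 - l))" using M pos by (subst ln_less_cancel_iff) auto
    then show ?thesis using pos by (simp add: ln_div ln_powr algebra_simps)
  qed
  ultimately have F0: "eventually (\<lambda>j. 0 < F j) sequentially"
    by (rule order_tendstoD(1))
  have A1: "eventually (\<lambda>j. \<alpha> j < 1) sequentially"
    by (rule order_tendstoD(2)[OF \<alpha>]) simp
  have P2: "eventually (\<lambda>j. 1 < P j) sequentially"
    using P by (simp add: filterlim_at_top_dense)
  show ?thesis
    using F0 A1 P2
  proof eventually_elim
    case (elim j)
    have "0 < P j * F j" using elim by simp
    also have "P j * F j = (P j - 1) * ln ((1 - \<alpha> j) * M / R) - Q j * ln M - ln (\<Lambda> * R)"
      using elim by (simp add: F_def field_simps)
    finally have "ln (\<Lambda> * R) + Q j * ln M < (P j - 1) * ln ((1 - \<alpha> j) * M / R)" by simp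
    then have "exp (ln (\<Lambda> * R) + Q j * ln M) < exp ((P j - 1) * ln ((1 - \<alpha> j) * M / R))" by simp
    moreover have "exp (ln (\<Lambda> * R) + Q j * ln M) = \<Lambda> * R * M powr Q j"
      using pos by (simp add: exp_add powr_def)
    moreover have "exp ((P j - 1) * ln ((1 - \<alpha> j) * M / R)) = ((1 - \<alpha> j) * M / R) powr (P j - 1)"
      using pos elim by (simp add: powr_def)
    ultimately show ?case using elim by (simp add: \<alpha>_def)
  qed
qed

lemma tendsto_barrier_exponent:
  fixes P Q :: "nat \<Rightarrow> real"
  assumes P: "filterlim P at_top sequentially" and Q: "(\<lambda>j. Q j / P j) \<longlonglongrightarrow> l" and l: "l < 1"
  shows "(\<lambda>j. P j / (P j - 1 - Q j)) \<longlonglongrightarrow> 1 / (1 - l)"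
proof -
  have c0: "(\<lambda>j. 1 / P j) \<longlonglongrightarrow> 0"
    by (rule real_tendsto_divide_at_top[OF tendsto_const P])
  have "(\<lambda>j. 1 / (1 - 1 / P j - Q j / P j)) \<longlonglongrightarrow> 1 / (1 - 0 - l)"
    using l by (intro tendsto_intros c0 Q) auto
  moreover have "eventually (\<lambda>j. 1 / (1 - 1 / P j - Q j / P j) = P j / (P j - 1 - Q j)) sequentially"
  proof -
    have "eventually (\<lambda>j. 0 < P j) sequentially" using P by (simp add: filterlim_at_top_dense)
    then show ?thesis
    proof eventually_elim
      case (elim j)
      then have "1 - 1 / P j - Q j / P j = (P j - 1 - Q j) / P j" by (simp add: field_simps)
      then show ?case by simp
    qed
  qed
  ultimately show ?thesis by (simp add: tendsto_cong)
qed

text \<open>As before, after taking logarithms and dividing by \<open>P j\<close> the limit is \<open>ln (k / (1 - l)) < l ln k\<close>; the factor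
  polynomial in \<open>P j\<close> disappears.\<close>

lemma eventually_power_condition:
  fixes P Q :: "nat \<Rightarrow> real"
  assumes P: "filterlim P at_top sequentially" and Q: "(\<lambda>j. Q j / P j) \<longlonglongrightarrow> l"
    and pos: "0 < m" "0 < k" and l: "l < 1" and k: "k powr (1 - l) < 1 - l"
  shows "eventually (\<lambda>j. (k * (P j / (P j - 1 - Q j))) powr (P j - 1) *
      (n + P j + P j / (P j - 1 - Q j) * P j) < m * k powr Q j) sequentially"
proof -
  define \<beta> where "\<beta> j = P j / (P j - 1 - Q j)" for j
  have \<beta>: "\<beta> \<longlonglongrightarrow> 1 / (1 - l)"
    unfolding \<beta>_def[abs_def] by (rule tendsto_barrier_exponent[OF P Q l])
  have c0: "(\<lambda>j. c / P j) \<longlonglongrightarrow> 0" for c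
    by (rule real_tendsto_divide_at_top[OF tendsto_const P])
  have lnP: "(\<lambda>j. ln (P j) / P j) \<longlonglongrightarrow> 0"
    by (rule filterlim_compose[OF ln_x_over_x_tendsto_0 P])
  have lim1: "(\<lambda>j. n / P j + 1 + \<beta> j) \<longlonglongrightarrow> 0 + 1 + 1 / (1 - l)"
    by (intro tendsto_intros c0 \<beta>)
  have l1: "0 < 0 + 1 + 1 / (1 - l)" using l by (simp add: add_pos_pos)
  have "(\<lambda>j. ln (n / P j + 1 + \<beta> j) * (1 / P j)) \<longlonglongrightarrow> ln (0 + 1 + 1 / (1 - l)) * 0"
    using l1 by (intro tendsto_intros lim1 c0) auto
  then have lim2: "(\<lambda>j. ln (n / P j + 1 + \<beta> j) / P j) \<longlonglongrightarrow> 0" by simp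
  define F where "F j = ln m / P j + Q j / P j * ln k - (1 - 1 / P j) * ln (k * \<beta> j) -
      (ln (P j) / P j + ln (n / P j + 1 + \<beta> j) / P j)" for j
  have "F \<longlonglongrightarrow> 0 + l * ln k - (1 - 0) * ln (k * (1 / (1 - l))) - (0 + 0)"
    unfolding F_def[abs_def] using pos l by (intro tendsto_intros c0 \<beta> Q lnP lim2) auto
  moreover have "0 < 0 + l * ln k - (1 - 0) * ln (k * (1 / (1 - l))) - (0 + 0)"
  proof -
    have "ln (k powr (1 - l)) < ln (1 - l)" using k pos l by (subst ln_less_cancel_iff) auto
    then show ?thesis using pos l by (simp add: ln_div ln_powr algebra_simps)
  qed
  ultimately have F0: "eventually (\<lambda>j. 0 < F j) sequentially"
    by (rule order_tendstoD(1))
  have P2: "eventually (\<lambda>j. 1 < P j) sequentially"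
    using P by (simp add: filterlim_at_top_dense)
  have B0: "eventually (\<lambda>j. 0 < \<beta> j) sequentially"
    by (rule order_tendstoD(1)[OF \<beta>]) (use l in simp)
  have L0: "eventually (\<lambda>j. 0 < n / P j + 1 + \<beta> j) sequentially"
    by (rule order_tendstoD(1)[OF lim1 l1])
  show ?thesis
    using F0 P2 B0 L0
  proof eventually_elim
    case (elim j)
    have e: "n + P j + \<beta> j * P j = P j * (n / P j + 1 + \<beta> j)"
      using elim by (simp add: field_simps)
    have "0 < P j * F j" using elim by simp
    also have "P j * F j = ln m + Q j * ln k - (P j - 1) * ln (k * \<beta> j) - (ln (P j) + ln (n / P j + 1 + \<beta> j))"
    proof -
      have "P j * (x / P j) = x" "P j * (x / P j * y) = x * y" "P j * ((1 - 1 / P j) * y) = (P j - 1) * y" for x y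
        using elim by (auto simp: field_simps)
      then show ?thesis unfolding F_def by (simp only: right_diff_distrib distrib_left)
    qed
    finally have "(P j - 1) * ln (k * \<beta> j) + (ln (P j) + ln (n / P j + 1 + \<beta> j)) < ln m + Q j * ln k" by simp
    then have "exp ((P j - 1) * ln (k * \<beta> j) + (ln (P j) + ln (n / P j + 1 + \<beta> j))) < exp (ln m + Q j * ln k)" by simp
    moreover have "exp (ln m + Q j * ln k) = m * k powr Q j"
      using pos by (simp add: exp_add powr_def)
    moreover have "exp ((P j - 1) * ln (k * \<beta> j) + (ln (P j) + ln (n / P j + 1 + \<beta> j))) =
        (k * \<beta> j) powr (P j - 1) * (n + P j + \<beta> j * P j)"
      unfolding e using pos elim by (simp add: exp_add powr_def)
    ultimately show ?case by (simp add: \<beta>_def)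
  qed
qed

lemma limit_solutionE:
  assumes "limit_solution \<Omega> lam g q v" and q: "\<forall>p\<ge>2. 0 \<le> q p \<and> q p < p - 1"
    and ql: "((\<lambda>p. q p / p) \<longlongrightarrow> l) at_top"
  obtains P u where "\<And>j. 2 \<le> P j" "filterlim P at_top sequentially"
    "\<And>j. 0 \<le> q (P j)" "\<And>j. q (P j) < P j - 1" "(\<lambda>j. q (P j) / P j) \<longlonglongrightarrow> l"
    "\<And>j. dead_core_solution \<Omega> lam g (P j) (q (P j)) (u j)"
    "uniform_limit (closure \<Omega>) u v sequentially"
proof -
  obtain P :: "nat \<Rightarrow> real" and u where P: "\<And>j. 2 \<le> P j" "filterlim P at_top sequentially"
    and u: "\<And>j. dead_core_solution \<Omega> lam g (P j) (q (P j)) (u (P j))"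
      "uniform_limit (closure \<Omega>) (\<lambda>j. u (P j)) v sequentially"
    using assms(1) unfolding limit_solution_def by blast
  show thesis
    using that[of P "\<lambda>j. u (P j)"] P q filterlim_compose[OF ql P(2)] u by auto
qed

lemma limit_solution_continuous:
  assumes "limit_solution \<Omega> lam g q v"
  shows "continuous_on (closure \<Omega>) v"
proof -
  obtain P :: "nat \<Rightarrow> real" and u where u: "\<And>j. dead_core_solution \<Omega> lam g (P j) (q (P j)) (u (P j))"
      "uniform_limit (closure \<Omega>) (\<lambda>j. u (P j)) v sequentially"
    using assms unfolding limit_solution_def by blast
  show ?thesis
    by (rule uniform_limit_theorem[OF _ u(2)]) (use u(1) in \<open>auto simp: dead_core_solution_def\<close>)
qed

text \<open>The cones of \<open>cone_barrier\<close> converge to the straight cone of height \<open>M\<close> over \<open>B\<^sub>R(y)\<close>, which is positive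
  inside that ball.\<close>

lemma limit_positive_in_ball:
  fixes \<Omega> :: "'a::euclidean_space set"
  assumes \<Omega>: "open \<Omega>"
    and lam: "set_borel_measurable lebesgue \<Omega> lam" "\<And>x. x \<in> \<Omega> \<Longrightarrow> \<bar>lam x\<bar> \<le> \<Lambda>" "0 < \<Lambda>"
    and q: "\<forall>p\<ge>2. 0 \<le> q p \<and> q p < p - 1" "((\<lambda>p. q p / p) \<longlongrightarrow> l) at_top" and l: "l < 1"
    and v: "limit_solution \<Omega> lam g q v"
    and R: "0 < R" "cball y (2 * R) \<subseteq> \<Omega>" and M: "0 < M" "M < v y" "R < M powr (1 - l)"
    and x: "x \<in> ball y R"
  shows "0 < v x"
proof (cases "x = y")
  case True then show ?thesis using M by simp
next
  case False
  obtain P u where P: "\<And>j. 2 \<le> P j" "filterlim P at_top sequentially"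
    and Q: "\<And>j. 0 \<le> q (P j)" "\<And>j. q (P j) < P j - 1" "(\<lambda>j. q (P j) / P j) \<longlonglongrightarrow> l"
    and u: "\<And>j. dead_core_solution \<Omega> lam g (P j) (q (P j)) (u j)"
      "uniform_limit (closure \<Omega>) u v sequentially"
    using limit_solutionE[OF v q] by blast
  define n where "n = real DIM('a)"
  define \<alpha> where "\<alpha> j = n / (P j - 1)" for j
  have xy: "x \<in> closure \<Omega>" "y \<in> closure \<Omega>"
    using x R closure_subset[of \<Omega>] by (auto simp: subset_iff)
  have "(\<lambda>j. u j y) \<longlonglongrightarrow> v y" by (rule tendsto_uniform_limitI[OF u(2) xy(2)])
  then have e1: "eventually (\<lambda>j. M < u j y) sequentially"
    using M(2) by (rule order_tendstoD(1))
  have e2: "eventually (\<lambda>j. \<alpha> j < 1 \<and>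
      \<Lambda> * R * M powr q (P j) < ((1 - \<alpha> j) * M / R) powr (P j - 1)) sequentially"
    unfolding \<alpha>_def by (rule eventually_cone_condition[OF P(2) Q(3) lam(3) M(1) R(1) l M(3)])
  have ev: "eventually (\<lambda>j. M - M * (dist y x / R) powr (1 - \<alpha> j) \<le> u j x) sequentially"
    using e1 e2
  proof eventually_elim
    case (elim j)
    show ?case
    proof (rule cone_barrier[OF P(1) Q(1) \<Omega> lam(1,2) u(1) R M(1)])
      show "x \<in> ball y (2 * R)" using x R by simp
    qed (use elim False in \<open>auto simp: \<alpha>_def n_def\<close>)
  qed
  have P1: "filterlim (\<lambda>j. P j - 1) at_top sequentially"
    using filterlim_tendsto_add_at_top[OF tendsto_const[of "-1"] P(2)] by simp
  have \<alpha>: "\<alpha> \<longlonglongrightarrow> 0"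
    unfolding \<alpha>_def[abs_def] by (rule real_tendsto_divide_at_top[OF tendsto_const P1])
  have "(\<lambda>j. M - M * (dist y x / R) powr (1 - \<alpha> j)) \<longlonglongrightarrow> M - M * (dist y x / R) powr (1 - 0)"
    using False R by (intro tendsto_intros \<alpha>) auto
  then have "M - M * (dist y x / R) powr (1 - 0) \<le> v x"
    by (rule tendsto_le[OF _ tendsto_uniform_limitI[OF u(2) xy(1)] _ ev, rotated]) simp
  moreover have "0 < M - M * (dist y x / R) powr (1 - 0)"
    using x R M by (simp add: field_simps)
  ultimately show ?thesis by linarith
qed

text \<open>Otherwise the barriers \<open>k (\<bar>x - y\<bar>\<^sup>2 + \<tau>\<^sup>2)\<^bsup>\<beta>/2\<^esup>\<close> lie above the approximating solutions on the sphere for large \<open>p\<close>,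
  which bounds \<open>v y\<close> by \<open>k \<tau>\<^bsup>1/(1-l)\<^esup>\<close> for every \<open>\<tau> > 0\<close>.\<close>

lemma limit_nondegenerate:
  fixes \<Omega> :: "'a::euclidean_space set"
  assumes \<Omega>: "open \<Omega>"
    and lam: "set_borel_measurable lebesgue \<Omega> lam" "\<And>x. x \<in> \<Omega> \<Longrightarrow> \<bar>lam x\<bar> \<le> \<Lambda>"
      "\<And>x. x \<in> \<Omega> \<Longrightarrow> m \<le> lam x" "0 < m"
    and q: "\<forall>p\<ge>2. 0 \<le> q p \<and> q p < p - 1" "((\<lambda>p. q p / p) \<longlongrightarrow> l) at_top" and l: "l < 1"
    and v: "limit_solution \<Omega> lam g q v"
    and \<rho>: "0 < \<rho>" "cball y \<rho> \<subseteq> \<Omega>" and k: "0 < k" "k powr (1 - l) < 1 - l" and y: "0 < v y"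
  obtains z where "dist y z = \<rho>" "k * \<rho> powr (1 / (1 - l)) \<le> v z"
proof (rule ccontr)
  assume "\<not> thesis"
  with that have small: "v z < k * \<rho> powr (1 / (1 - l))" if "dist y z = \<rho>" for z
    using not_le \<open>dist y z = \<rho>\<close> by blast
  obtain P u where P: "\<And>j. 2 \<le> P j" "filterlim P at_top sequentially"
    and Q: "\<And>j. 0 \<le> q (P j)" "\<And>j. q (P j) < P j - 1" "(\<lambda>j. q (P j) / P j) \<longlonglongrightarrow> l"
    and u: "\<And>j. dead_core_solution \<Omega> lam g (P j) (q (P j)) (u j)"
      "uniform_limit (closure \<Omega>) u v sequentially"
    using limit_solutionE[OF v q] by blast
  define B where "B = 1 / (1 - l)"
  have B: "0 < B" using l by (simp add: B_def)
  define \<beta> where "\<beta> j = P j / (P j - 1 - q (P j))" for j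
  have \<beta>: "\<beta> \<longlonglongrightarrow> B"
    unfolding \<beta>_def[abs_def] B_def by (rule tendsto_barrier_exponent[OF P(2) Q(3) l])
  have cl: "cball y \<rho> \<subseteq> closure \<Omega>" using \<rho> closure_subset by blast
  have yc: "y \<in> closure \<Omega>" using cl \<rho> by auto
  have cv: "continuous_on (sphere y \<rho>) v"
    using limit_solution_continuous[OF v] by (rule continuous_on_subset) (use cl sphere_cball in blast)
  \<comment> \<open>The margin \<open>3 \<eta>\<close> absorbs the uniform distance to the limit and the change of the exponent from \<open>B\<close> to \<open>\<beta> j\<close>.\<close>
  obtain \<eta> where \<eta>: "0 < \<eta>" "\<And>z. dist y z = \<rho> \<Longrightarrow> v z \<le> k * \<rho> powr B - 3 * \<eta>"
  proof (cases "sphere y \<rho> = {}")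
    case True
    then show thesis using that[of 1] by (auto simp: sphere_def)
  next
    case False
    then obtain z0 where z0: "z0 \<in> sphere y \<rho>" "\<And>z. z \<in> sphere y \<rho> \<Longrightarrow> v z \<le> v z0"
      using continuous_attains_sup[OF compact_sphere False cv] by blast
    show thesis
    proof (rule that[of "(k * \<rho> powr B - v z0) / 3"])
      show "0 < (k * \<rho> powr B - v z0) / 3" using small[of z0] z0(1) by (simp add: B_def)
      show "v z \<le> k * \<rho> powr B - 3 * ((k * \<rho> powr B - v z0) / 3)" if "dist y z = \<rho>" for z
        using z0(2)[of z] that by (simp add: field_simps)
    qed
  qed
  have e1: "eventually (\<lambda>j. \<forall>z\<in>closure \<Omega>. dist (u j z) (v z) < \<eta>) sequentially"
    using u(2) \<eta>(1) by (rule uniform_limitD)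
  have kb: "(\<lambda>j. k * \<rho> powr \<beta> j) \<longlonglongrightarrow> k * \<rho> powr B"
    using \<rho> by (intro tendsto_intros \<beta>) auto
  have e2: "eventually (\<lambda>j. k * \<rho> powr B - \<eta> < k * \<rho> powr \<beta> j) sequentially"
    by (rule order_tendstoD(1)[OF kb]) (use \<eta> in simp)
  have e3: "eventually (\<lambda>j. (k * \<beta> j) powr (P j - 1) * (real DIM('a) + P j + \<beta> j * P j) < m * k powr q (P j)) sequentially"
    unfolding \<beta>_def by (rule eventually_power_condition[OF P(2) Q(3) lam(4) k(1) l k(2)])
  have e4: "eventually (\<lambda>j. 4 < P j) sequentially"
    using P(2) by (simp add: filterlim_at_top_dense)
  have bound: "v y \<le> k * \<tau> powr B" if \<tau>: "0 < \<tau>" for \<tau>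
  proof -
    have "eventually (\<lambda>j. u j y \<le> k * \<tau> powr \<beta> j) sequentially"
      using e1 e2 e3 e4
    proof eventually_elim
      case (elim j)
      show ?case
      proof (rule power_barrier[OF elim(4) Q(1) Q(2) \<Omega> lam u(1) \<rho> k(1) \<tau>])
        show "\<beta> j = P j / (P j - 1 - q (P j))" by (simp add: \<beta>_def)
        show "(k * \<beta> j) powr (P j - 1) * (real DIM('a) + P j + \<beta> j * P j) < m * k powr q (P j)"
          by (rule elim(3))
        show "u j z < k * \<rho> powr \<beta> j" if "dist y z = \<rho>" for z
        proof -
          have "z \<in> closure \<Omega>" using cl that by auto
          then have "dist (u j z) (v z) < \<eta>" using elim(1) by blast
          then have "u j z < v z + \<eta>" by (simp add: dist_real_def)
          then show ?thesis using \<eta>(1) \<eta>(2)[OF that] elim(2) by linarith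
        qed
      qed
    qed
    moreover have "(\<lambda>j. k * \<tau> powr \<beta> j) \<longlonglongrightarrow> k * \<tau> powr B"
      using \<tau> by (intro tendsto_intros \<beta>) auto
    ultimately show ?thesis
      using tendsto_le[OF _ _ tendsto_uniform_limitI[OF u(2) yc]] by (metis sequentially_bot)
  qed
  \<comment> \<open>For this \<open>\<tau>\<close> the bound reads \<open>v y \<le> v y / 2\<close>.\<close>
  define \<tau> where "\<tau> = (v y / (2 * k)) powr (1 / B)"
  have "0 < \<tau>" using y k by (simp add: \<tau>_def)
  moreover have "\<tau> powr B = v y / (2 * k)"
    unfolding \<tau>_def powr_powr using y k B by simp
  ultimately have "v y \<le> k * (v y / (2 * k))" using bound by metis
  then show False using y k by simp
qed

text \<open>Choose \<open>y\<close> with \<open>v y > 0\<close> near \<open>x\<close>, then \<open>z\<close> at distance \<open>r/4\<close> from \<open>y\<close> by nondegeneracy, with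
  \<open>k\<^bsup>1-l\<^esup> = (1 - l) / 2\<close>; since \<open>v z\<close> is of order \<open>r\<^bsup>1/(1-l)\<^esup>\<close>, the cone at \<open>z\<close> shows that \<open>v\<close> is positive on a ball
  of radius \<open>R = (1 - l) r / 32\<close>, which therefore misses the free boundary.\<close>

theorem free_boundary_porous:
  fixes \<Omega> :: "'a::euclidean_space set"
  assumes \<Omega>: "open \<Omega>"
    and lam: "set_borel_measurable lebesgue \<Omega> lam" "\<And>x. x \<in> \<Omega> \<Longrightarrow> \<bar>lam x\<bar> \<le> \<Lambda>"
      "\<And>x. x \<in> \<Omega> \<Longrightarrow> m \<le> lam x" "0 < m"
    and q: "\<forall>p\<ge>2. 0 \<le> q p \<and> q p < p - 1" "((\<lambda>p. q p / p) \<longlongrightarrow> l) at_top" and l: "0 \<le> l" "l < 1"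
    and v: "limit_solution \<Omega> lam g q v"
    and x: "x \<in> frontier {x \<in> \<Omega>. 0 < v x}" and r: "0 < r" "cball x r \<subseteq> \<Omega>"
  obtains z where "ball z ((1 - l) / 32 * r) \<subseteq> ball x r"
    "ball z ((1 - l) / 32 * r) \<inter> frontier {x \<in> \<Omega>. 0 < v x} = {}"
proof -
  define S where "S = {x \<in> \<Omega>. 0 < v x}"
  define B where "B = 1 / (1 - l)"
  have B: "0 < B" "B * (1 - l) = 1" using l by (auto simp: B_def)
  have \<Lambda>: "0 < \<Lambda>" 
  proof -
    have "x \<in> \<Omega>" using r by auto
    then show ?thesis using lam(2)[of x] lam(3)[of x] lam(4) by linarith
  qed
  have "x \<in> closure S" using x by (simp add: S_def frontier_def)
  then obtain y where y: "y \<in> S" "dist y x < r / 4"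
    using r by (meson closure_approachable divide_pos_pos zero_less_numeral)
  define k where "k = ((1 - l) / 2) powr B"
  have k: "0 < k" "k powr (1 - l) < 1 - l"
    using l B by (auto simp: k_def powr_powr)
  have cyr: "cball y (r / 4) \<subseteq> \<Omega>"
  proof
    fix w assume "w \<in> cball y (r / 4)"
    then have "dist x w \<le> r" using y r dist_triangle[of x w y] dist_commute[of x y] by simp
    then show "w \<in> \<Omega>" using r by auto
  qed
  obtain z where z: "dist y z = r / 4" "k * (r / 4) powr B \<le> v z"
    using limit_nondegenerate[OF \<Omega> lam q l(2) v _ cyr k] y r unfolding B_def S_def by auto
  define R where "R = (1 - l) / 32 * r"
  have R: "0 < R" "R \<le> r / 32" using l r by (auto simp: R_def mult_left_le_one_le)
  have xz: "dist x z < r / 2"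
    using y z dist_triangle[of x z y] by (simp add: dist_commute)
  \<comment> \<open>Halving the base in the lower bound for \<open>v z\<close> gives \<open>M < v z\<close>, and still \<open>M\<^bsup>1-l\<^esup> = 2 R\<close>.\<close>
  define M where "M = ((1 - l) / 4 * (r / 4)) powr B"
  have base: "0 < (1 - l) / 4 * (r / 4)" using l r by simp
  have M0: "0 < M" using l r by (simp add: M_def)
  have "M < ((1 - l) / 2 * (r / 4)) powr B"
    unfolding M_def using l r B by (intro powr_less_mono2) (auto intro!: mult_strict_right_mono)
  also have "\<dots> = k * (r / 4) powr B" by (simp only: k_def powr_mult)
  finally have M1: "M < v z" using z by simp
  have "M powr (1 - l) = (1 - l) / 4 * (r / 4)"
    unfolding M_def powr_powr B(2) using l r by simp
  moreover have "0 < (1 - l) * r" using l r by simp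
  ultimately have M2: "R < M powr (1 - l)"
    by (simp add: R_def)
  have c2: "cball z (2 * R) \<subseteq> \<Omega>"
  proof
    fix w assume "w \<in> cball z (2 * R)"
    then have "dist x w \<le> r" using xz R dist_triangle[of x w z] by simp
    then show "w \<in> \<Omega>" using r by auto
  qed
  have pos: "0 < v w" if "w \<in> ball z R" for w
    by (rule limit_positive_in_ball[OF \<Omega> lam(1,2) \<Lambda> q l(2) v R(1) c2 M0 M1 M2 that])
  have sub: "ball z R \<subseteq> S"
    using pos c2 R by (force simp: S_def)
  have "ball z R \<subseteq> ball x r"
  proof
    fix w assume "w \<in> ball z R"
    then show "w \<in> ball x r" using xz R dist_triangle[of x w z] by simp
  qed
  moreover have "ball z R \<inter> frontier S = {}"
    using interior_maximal[OF sub open_ball] by (auto simp: frontier_def)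
  ultimately show thesis using that by (simp add: R_def S_def)
qed

section \<open>Porous sets, grids and Hausdorff measure\<close>

text \<open>The index of the half-open cube of side \<open>m\<^bsup>-k\<^esup>\<close> that contains \<open>x\<close>.  Representing cubes by integer
  functions makes passing to the parent cube a division by \<open>m\<close>.\<close>

definition grid_cell :: "nat \<Rightarrow> nat \<Rightarrow> real ^ 'n \<Rightarrow> 'n \<Rightarrow> int" where
  "grid_cell m k x = (\<lambda>i. \<lfloor>real m ^ k * x $ i\<rfloor>)"

lemma grid_cell_parent:
  assumes "0 < m" shows "grid_cell m k x = (\<lambda>i. grid_cell m (Suc k) x i div int m)"
proof
  fix i
  have "real m ^ k * x $ i = real m ^ Suc k * x $ i / real_of_int (int m)" using assms by simp
  then show "grid_cell m k x i = grid_cell m (Suc k) x i div int m"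
    unfolding grid_cell_def by (simp only: floor_divide_real_eq_div[of "int m"])
qed

lemma grid_cell_coord:
  assumes "0 < m" "grid_cell m k x = grid_cell m k y"
  shows "\<bar>x $ i - y $ i\<bar> < 1 / real m ^ k"
proof -
  have "\<lfloor>real m ^ k * x $ i\<rfloor> = \<lfloor>real m ^ k * y $ i\<rfloor>"
    using assms(2) by (auto simp: grid_cell_def fun_eq_iff)
  then have "\<bar>real m ^ k * x $ i - real m ^ k * y $ i\<bar> < 1" by linarith
  then have "real m ^ k * \<bar>x $ i - y $ i\<bar> < 1"
    by (simp add: abs_mult flip: right_diff_distrib)
  then show ?thesis using assms(1) by (simp add: field_simps)
qed

lemma dist_le_of_coords:
  fixes x y :: "real ^ 'n"
  assumes "\<And>i. \<bar>x $ i - y $ i\<bar> \<le> h"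
  shows "dist x y \<le> real CARD('n) * h"
proof -
  have "dist x y \<le> (\<Sum>i\<in>UNIV. \<bar>(x - y) $ i\<bar>)" unfolding dist_norm by (rule norm_le_l1_cart)
  also have "\<dots> \<le> (\<Sum>i\<in>(UNIV::'n set). h)" by (rule sum_mono) (use assms in simp)
  finally show ?thesis by simp
qed

lemma grid_cell_dist:
  fixes x y :: "real ^ 'n"
  assumes "0 < m" "grid_cell m k x = grid_cell m k y"
  shows "dist x y \<le> real CARD('n) / real m ^ k"
  using dist_le_of_coords[of x y "1 / real m ^ k"] grid_cell_coord[OF assms] by (auto intro: less_imp_le)

lemma finite_grid_cells:
  fixes E :: "(real ^ 'n) set"
  assumes "bounded E" shows "finite (grid_cell m k ` E)"
proof -
  obtain B where B: "\<And>x. x \<in> E \<Longrightarrow> norm x \<le> B" using assms by (auto simp: bounded_iff)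
  define C where "C = \<lceil>real m ^ k * B\<rceil>"
  have "grid_cell m k ` E \<subseteq> PiE UNIV (\<lambda>i. {-C..C})"
  proof (rule image_subsetI)
    fix x assume "x \<in> E"
    show "grid_cell m k x \<in> PiE UNIV (\<lambda>i. {-C..C})"
    proof (rule PiE_I)
      fix i
      have "\<bar>x $ i\<bar> \<le> B" using component_le_norm_cart[of x i] B[OF \<open>x \<in> E\<close>] by linarith
      then have "real m ^ k * \<bar>x $ i\<bar> \<le> real m ^ k * B" by (intro mult_left_mono) auto
      then have "\<bar>real m ^ k * x $ i\<bar> \<le> real m ^ k * B" by (simp add: abs_mult)
      then have "real m ^ k * x $ i \<le> of_int C" "of_int (- C) \<le> real m ^ k * x $ i"
        unfolding C_def by linarith+
      then show "grid_cell m k x i \<in> {-C..C}"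
        unfolding grid_cell_def by (simp add: floor_le_iff le_floor_iff)
    qed simp
  qed
  then show ?thesis by (rule finite_subset) (intro finite_PiE, auto)
qed

lemma card_children:
  assumes "0 < m"
  shows "finite {w :: 'n::finite \<Rightarrow> int. \<forall>i. w i div int m = z i}"
    "card {w :: 'n \<Rightarrow> int. \<forall>i. w i div int m = z i} = m ^ CARD('n)"
proof -
  have div_iff: "a div int m = b \<longleftrightarrow> a \<in> {int m * b..<int m * b + int m}" for a b
  proof
    assume "a div int m = b"
    then have "a = int m * b + a mod int m" by (metis mult_div_mod_eq)
    moreover have "0 \<le> a mod int m" "a mod int m < int m" using assms by auto
    ultimately show "a \<in> {int m * b..<int m * b + int m}" by auto
  next
    assume a: "a \<in> {int m * b..<int m * b + int m}"
    have "a = int m * b + (a - int m * b)" by simp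
    moreover have "(a - int m * b) div int m = 0" using a by (intro div_pos_pos_trivial) auto
    ultimately show "a div int m = b" using assms
      by (metis add.right_neutral div_mult_self2 add.commute of_nat_0_less_iff less_irrefl add_0)
  qed
  have eq: "{w :: 'n \<Rightarrow> int. \<forall>i. w i div int m = z i} = PiE UNIV (\<lambda>i. {int m * z i..<int m * z i + int m})"
    unfolding div_iff PiE_UNIV_domain Pi_def by auto
  show "finite {w :: 'n \<Rightarrow> int. \<forall>i. w i div int m = z i}"
    unfolding eq by (intro finite_PiE) auto
  show "card {w :: 'n \<Rightarrow> int. \<forall>i. w i div int m = z i} = m ^ CARD('n)"
    unfolding eq by (subst card_PiE) auto
qed

text \<open>A cube has \<open>m\<^sup>N\<close> children.  One of them is lost unless the cube belongs to the exceptional set \<open>Z\<close>, and each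
  exceptional cube contributes one more.\<close>

lemma cell_count_step:
  fixes E :: "(real ^ 'n) set"
  assumes m: "0 < m" and E: "bounded E"
    and good: "\<And>x. x \<in> E \<Longrightarrow> grid_cell m k x \<notin> Z \<Longrightarrow>
      \<exists>y. grid_cell m k y = grid_cell m k x \<and> grid_cell m (Suc k) y \<notin> grid_cell m (Suc k) ` E"
    and Z: "Z \<subseteq> grid_cell m k ` E"
  shows "card (grid_cell m (Suc k) ` E) \<le> (m ^ CARD('n) - 1) * card (grid_cell m k ` E) + card Z"
proof -
  let ?A = "grid_cell m k ` E" and ?B = "grid_cell m (Suc k) ` E"
  define D where "D = m ^ CARD('n) - 1"
  have D: "m ^ CARD('n) = D + 1" using m by (simp add: D_def)
  define fib where "fib z = {w \<in> ?B. \<forall>i. w i div int m = z i}" for z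
  have fin: "finite ?A" "finite ?B" using finite_grid_cells[OF E] by auto
  have "?B \<subseteq> (\<Union>z\<in>?A. fib z)"
  proof (rule image_subsetI)
    fix x assume x: "x \<in> E"
    have "grid_cell m (Suc k) x i div int m = grid_cell m k x i" for i
      by (simp only: grid_cell_parent[OF m, of k x])
    then have "grid_cell m (Suc k) x \<in> fib (grid_cell m k x)"
      using x by (simp add: fib_def)
    then show "grid_cell m (Suc k) x \<in> (\<Union>z\<in>?A. fib z)" using x by blast
  qed
  moreover have "finite (\<Union>z\<in>?A. fib z)"
    by (rule finite_subset[OF _ fin(2)]) (auto simp: fib_def)
  ultimately have "card ?B \<le> card (\<Union>z\<in>?A. fib z)"
    by (rule card_mono[rotated])
  also have "\<dots> \<le> (\<Sum>z\<in>?A. card (fib z))"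
    by (rule card_UN_le[OF fin(1)])
  also have "\<dots> \<le> (\<Sum>z\<in>?A. D + (if z \<in> Z then 1 else 0))"
  proof (rule sum_mono)
    fix z assume z: "z \<in> ?A"
    have sub: "fib z \<subseteq> {w. \<forall>i. w i div int m = z i}" by (auto simp: fib_def)
    show "card (fib z) \<le> D + (if z \<in> Z then 1 else 0)"
    proof (cases "z \<in> Z")
      case True
      then show ?thesis
        using card_mono[OF card_children(1)[OF m] sub] card_children(2)[OF m, of z] D by simp
    next
      case False
      obtain x where x: "x \<in> E" "z = grid_cell m k x" using z by auto
      obtain y where y: "grid_cell m k y = z" "grid_cell m (Suc k) y \<notin> ?B"
        using good[OF x(1)] False x(2) by auto
      have "fib z \<subseteq> {w. \<forall>i. w i div int m = z i} - {grid_cell m (Suc k) y}"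
      proof -
        have "fib z \<subseteq> ?B" unfolding fib_def by blast
        then show ?thesis using sub y(2) by blast
      qed
      then have "card (fib z) \<le> card ({w. \<forall>i. w i div int m = z i} - {grid_cell m (Suc k) y})"
        by (intro card_mono) (use card_children(1)[OF m] in auto)
      also have "\<dots> = m ^ CARD('n) - 1"
        using card_children[OF m, of z] y(1) grid_cell_parent[OF m, of k y]
        by (subst card_Diff_singleton) (auto simp: fun_eq_iff)
      finally show ?thesis using False by (simp add: D_def)
    qed
  qed
  also have "\<dots> = D * card ?A + card Z"
  proof -
    have "(\<Sum>z\<in>?A. if z \<in> Z then 1 else 0) = card (?A \<inter> Z)"
      using fin(1) by (simp add: sum.If_cases)
    moreover have "?A \<inter> Z = Z" using Z by auto
    ultimately show ?thesis by (simp add: sum.distrib)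
  qed
  finally show ?thesis by (simp add: D_def)
qed

text \<open>With \<open>B = C / (D - q)\<close> the stronger bound \<open>a k \<le> (a 0 + B) D\<^sup>k - B q\<^sup>k\<close> is preserved by the recursion.\<close>

lemma linear_recursion_bound:
  fixes a b :: "nat \<Rightarrow> real"
  assumes step: "\<And>k. a (Suc k) \<le> D * a k + b k" and b: "\<And>k. b k \<le> C * q ^ k"
    and q: "0 \<le> q" "q < D" and C: "0 \<le> C"
  shows "a k \<le> (a 0 + C / (D - q)) * D ^ k"
proof -
  define B where "B = C / (D - q)"
  have B: "0 \<le> B" "C = B * (D - q)" using q C by (auto simp: B_def)
  have "a k \<le> (a 0 + B) * D ^ k - B * q ^ k"
  proof (induction k)
    case (Suc k)
    have "a (Suc k) \<le> D * ((a 0 + B) * D ^ k - B * q ^ k) + C * q ^ k"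
      using step[of k] b[of k] mult_left_mono[OF Suc, of D] q by linarith
    also have "\<dots> = (a 0 + B) * D ^ Suc k - B * q ^ Suc k"
      unfolding B(2) by (simp add: algebra_simps)
    finally show ?case .
  qed simp
  moreover have "0 \<le> B * q ^ k" using B q by simp
  ultimately show ?thesis by (simp add: B_def)
qed

text \<open>The cubes at level \<open>k\<close> cover \<open>E\<close>, and \<open>D\<^sup>k\<close> times the \<open>s\<close>-th power of their side is \<open>1\<close>.\<close>

lemma hausdorff_measure_finite_of_cell_count:
  fixes E :: "(real ^ 'n) set"
  assumes m: "1 < m" and E: "bounded E" and s: "0 < s" "real m powr s = D"
    and count: "\<And>k. real (card (grid_cell m k ` E)) \<le> A * D ^ k"
  shows "hausdorff_measure s E < \<infinity>"
proof -
  define n where "n = real CARD('n)"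
  define c where "c = unit_ball_vol s * (n / 2) powr s"
  have D: "0 < D" using s m by auto
  have c: "0 \<le> c" using s by (simp add: c_def)
  have A: "0 \<le> A" using count[of 0] order_trans[of 0 "real (card (grid_cell m 0 ` E))" A] by simp
  have "hausdorff_content s \<delta> E \<le> ennreal (A * c)" if \<delta>: "0 < \<delta>" for \<delta>
  proof -
    have "(\<lambda>k. n * inverse (real m) ^ k) \<longlonglongrightarrow> n * 0"
      using m by (intro tendsto_intros LIMSEQ_realpow_zero) (auto simp: inverse_less_1_iff)
    then have "eventually (\<lambda>k. n * inverse (real m) ^ k < \<delta>) sequentially"
      using \<delta> by (intro order_tendstoD(2)) auto
    then obtain k where "n * inverse (real m) ^ k < \<delta>" by (auto simp: eventually_sequentially)
    then have k: "n / real m ^ k \<le> \<delta>" by (simp add: power_inverse divide_inverse)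
    define N where "N = card (grid_cell m k ` E)"
    obtain e where e: "bij_betw e {0..<N} (grid_cell m k ` E)"
      using ex_bij_betw_nat_finite[OF finite_grid_cells[OF E]] unfolding N_def by blast
    define S where "S i = (if i < N then {x \<in> E. grid_cell m k x = e i} else {})" for i
    have diam: "diameter (S i) \<le> n / real m ^ k" for i
      unfolding n_def
    proof (rule diameter_le)
      show "norm (x - y) \<le> real CARD('n) / real m ^ k" if "x \<in> S i" "y \<in> S i" for x y
        using grid_cell_dist[of m k x y] that m by (auto simp: S_def dist_norm split: if_splits)
    qed auto
    have bS: "bounded (S i)" for i using E by (rule bounded_subset) (auto simp: S_def)
    have "E \<subseteq> (\<Union>i. S i)"
    proof
      fix x assume x: "x \<in> E"
      then obtain i where "i \<in> {0..<N}" "grid_cell m k x = e i"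
        using bij_betw_imp_surj_on[OF e] by (metis imageE imageI)
      then have "x \<in> S i" using x by (simp add: S_def)
      then show "x \<in> (\<Union>i. S i)" by blast
    qed
    then have "hausdorff_content s \<delta> E \<le> (\<Sum>i. hausdorff_gauge s (S i))"
      unfolding hausdorff_content_def
      by (intro INF_lower) (use bS diam k in \<open>auto intro: order_trans\<close>)
    also have "\<dots> = (\<Sum>i<N. hausdorff_gauge s (S i))"
      by (rule suminf_finite) (auto simp: S_def hausdorff_gauge_def)
    also have "\<dots> \<le> (\<Sum>i<N. ennreal (c / D ^ k))"
    proof (rule sum_mono)
      fix i
      have "unit_ball_vol s * (diameter (S i) / 2) powr s \<le> unit_ball_vol s * ((n / 2) / real m ^ k) powr s"
        using diam[of i] diameter_ge_0[OF bS[of i]] s by (intro mult_left_mono powr_mono2) auto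
      also have "((n / 2) / real m ^ k) powr s = (n / 2) powr s / (real m ^ k) powr s"
        by (rule powr_divide)
      also have "(real m ^ k) powr s = D ^ k"
        using m by (simp add: s(2)[symmetric] powr_powr powr_realpow[symmetric] mult.commute)
      finally have "unit_ball_vol s * (diameter (S i) / 2) powr s \<le> c / D ^ k"
        by (simp add: c_def)
      then show "hausdorff_gauge s (S i) \<le> ennreal (c / D ^ k)"
        using s by (auto simp: hausdorff_gauge_def ennreal_leI)
    qed
    also have "\<dots> = ennreal (real N * (c / D ^ k))"
      using c D by (simp add: ennreal_of_nat_eq_real_of_nat flip: ennreal_mult)
    also have "\<dots> \<le> ennreal (A * c)"
    proof (rule ennreal_leI)
      have "real N * (c / D ^ k) \<le> (A * D ^ k) * (c / D ^ k)"
        using count[of k] c D by (intro mult_right_mono) (auto simp: N_def)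
      then show "real N * (c / D ^ k) \<le> A * c" using D by simp
    qed
    finally show ?thesis .
  qed
  then have "hausdorff_measure s E \<le> ennreal (A * c)"
    unfolding hausdorff_measure_def by (intro SUP_least) auto
  then show ?thesis by (rule le_less_trans) simp
qed

lemma frontier_point_on_graph:
  fixes \<Omega> :: "'a::euclidean_space set"
  assumes \<Omega>: "open \<Omega>" and b: "b \<in> frontier \<Omega>" "b \<in> ball z r"
    and \<gamma>: "continuous_on UNIV \<gamma>"
    and eq: "\<Omega> \<inter> ball z r = {x \<in> ball z r. \<gamma> (x - (x \<bullet> e) *\<^sub>R e) < x \<bullet> e}"
  shows "b \<bullet> e = \<gamma> (b - (b \<bullet> e) *\<^sub>R e)"
proof (rule antisym)
  have "b \<notin> \<Omega>" using \<Omega> b(1) by (simp add: frontier_def interior_open)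
  then show "b \<bullet> e \<le> \<gamma> (b - (b \<bullet> e) *\<^sub>R e)" using eq b(2) by (auto simp: not_less[symmetric])
  show "\<gamma> (b - (b \<bullet> e) *\<^sub>R e) \<le> b \<bullet> e"
  proof (rule ccontr)
    assume less: "\<not> \<gamma> (b - (b \<bullet> e) *\<^sub>R e) \<le> b \<bullet> e"
    define W where "W = ball z r \<inter> {x. x \<bullet> e < \<gamma> (x - (x \<bullet> e) *\<^sub>R e)}"
    have "continuous_on UNIV (\<lambda>x. \<gamma> (x - (x \<bullet> e) *\<^sub>R e))"
      by (rule continuous_on_compose2[OF \<gamma>]) (auto intro!: continuous_intros)
    then have "open W"
      unfolding W_def by (intro open_Int open_ball open_Collect_less) (auto intro!: continuous_intros)
    moreover have "b \<in> W" using less b(2) by (simp add: W_def)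
    moreover have "b \<in> closure \<Omega>" using b(1) by (simp add: frontier_def)
    ultimately have "W \<inter> \<Omega> \<noteq> {}" using open_Int_closure_eq_empty[of W \<Omega>] by blast
    then obtain x where x: "x \<in> W" "x \<in> \<Omega>" by blast
    then have "x \<in> \<Omega> \<inter> ball z r" by (simp add: W_def)
    then have "\<gamma> (x - (x \<bullet> e) *\<^sub>R e) < x \<bullet> e" unfolding eq by simp
    then show False using x(1) by (simp add: W_def)
  qed
qed

text \<open>Translates of the layer by multiples of \<open>3 t e\<close> are disjoint, because translation along \<open>e\<close> changes the height above
  the graph but not the projection.  About \<open>1 / t\<close> of them fit into a fixed ball, so each of them has measure
  \<open>O(t)\<close>.\<close>

lemma graph_layer_measure:
  fixes e c :: "'a::euclidean_space" and \<gamma> :: "'a \<Rightarrow> real" and \<rho> :: real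
  assumes e: "norm e = 1" and \<gamma>: "continuous_on UNIV \<gamma>" and t: "0 < t" "t \<le> T"
  defines "S \<equiv> {y \<in> ball c \<rho>. \<bar>y \<bullet> e - \<gamma> (y - (y \<bullet> e) *\<^sub>R e)\<bar> \<le> t}"
  shows "S \<in> sets borel" "measure lborel S \<le> measure lborel (ball c (\<rho> + 3 + 3 * T)) * t"
proof -
  have ee: "e \<bullet> e = 1" using e by (simp add: norm_eq_1)
  have c\<gamma>: "continuous_on UNIV (\<lambda>x. \<gamma> (x - (x \<bullet> e) *\<^sub>R e))"
    by (rule continuous_on_compose2[OF \<gamma>]) (auto intro!: continuous_intros)
  have "S = ball c \<rho> \<inter> {y. \<bar>y \<bullet> e - \<gamma> (y - (y \<bullet> e) *\<^sub>R e)\<bar> \<le> t}" by (auto simp: S_def)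
  moreover have "closed {y. \<bar>y \<bullet> e - \<gamma> (y - (y \<bullet> e) *\<^sub>R e)\<bar> \<le> t}"
    by (intro closed_Collect_le continuous_on_rabs continuous_on_diff c\<gamma> continuous_on_inner
        continuous_on_id continuous_on_const)
  ultimately show Sm: "S \<in> sets borel" by simp
  define J where "J = nat \<lceil>1 / t\<rceil>"
  have J: "1 / t \<le> real J" "real J \<le> 1 / t + 1" 
  proof -
    have "0 < 1 / t" using t by simp
    then have "0 \<le> \<lceil>1 / t\<rceil>" by linarith
    then have "real J = of_int \<lceil>1 / t\<rceil>" by (simp add: J_def)
    then show "1 / t \<le> real J" "real J \<le> 1 / t + 1" by linarith+
  qed
  define tr where "tr j x = (3 * t * real j) *\<^sub>R e + x" for j x
  define A where "A j = tr j ` S" for j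
  have Ae: "A j = (\<lambda>x. - ((3 * t * real j) *\<^sub>R e) + x) -` S" for j
    unfolding A_def tr_def by (auto simp: image_iff algebra_simps intro!: bexI[of _ "_ - _"])
  have A_meas: "A j \<in> sets borel" for j
  proof -
    have "(\<lambda>x. - ((3 * t * real j) *\<^sub>R e) + x) \<in> borel_measurable borel" by simp
    from measurable_sets[OF this Sm] show ?thesis by (simp only: Ae space_borel Int_UNIV_right)
  qed
  have A_eq: "emeasure lborel (A j) = emeasure lborel S" for j
  proof -
    have "emeasure lborel (A j) = emeasure (distr lborel borel ((+) (- ((3 * t * real j) *\<^sub>R e)))) S"
      unfolding Ae using Sm by (subst emeasure_distr) auto
    then show ?thesis by (simp add: lborel_distr_plus)
  qed
  have level: "\<bar>x \<bullet> e - \<gamma> (x - (x \<bullet> e) *\<^sub>R e) - 3 * t * real j\<bar> \<le> t" if xA: "x \<in> A j" for x j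
  proof -
    obtain y where y: "y \<in> S" "x = (3 * t * real j) *\<^sub>R e + y" using xA by (auto simp: A_def tr_def)
    have "x \<bullet> e = 3 * t * real j + y \<bullet> e" by (simp add: y inner_add_left ee)
    moreover have "x - (x \<bullet> e) *\<^sub>R e = y - (y \<bullet> e) *\<^sub>R e" by (simp add: y inner_add_left ee algebra_simps)
    ultimately show ?thesis using y(1) by (simp add: S_def)
  qed
  have disj: "disjoint_family_on A {..<J}"
    unfolding disjoint_family_on_def
  proof (intro ballI impI equals0I)
    fix i j x assume ij: "i \<noteq> j" and x: "x \<in> A i \<inter> A j"
    define v where "v = x \<bullet> e - \<gamma> (x - (x \<bullet> e) *\<^sub>R e)"
    have "\<bar>v - 3 * t * real i\<bar> \<le> t" "\<bar>v - 3 * t * real j\<bar> \<le> t" using level x by (auto simp: v_def)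
    then have "\<bar>3 * t * real i - 3 * t * real j\<bar> \<le> 2 * t" by linarith
    moreover have "\<bar>3 * t * real i - 3 * t * real j\<bar> = 3 * t * \<bar>real i - real j\<bar>"
      using t by (simp add: abs_mult flip: right_diff_distrib)
    moreover have "1 \<le> \<bar>real i - real j\<bar>" using ij by linarith
    then have "3 * t * 1 \<le> 3 * t * \<bar>real i - real j\<bar>" using t by (intro mult_left_mono) auto
    ultimately show False using t by linarith
  qed
  have bound: "A j \<subseteq> ball c (\<rho> + 3 + 3 * T)" if "j < J" for j
  proof
    fix x assume "x \<in> A j"
    then obtain y where y: "y \<in> S" "x = (3 * t * real j) *\<^sub>R e + y" by (auto simp: A_def tr_def)
    have "t * real j \<le> t * (1 / t + 1)" using that J t by (intro mult_left_mono) auto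
    also have "\<dots> = 1 + t" using t by (simp add: field_simps)
    finally have "3 * t * real j \<le> 3 + 3 * T" using t by linarith
    moreover have "dist c x \<le> dist c y + 3 * t * real j"
      using dist_triangle[of c x y] t e by (simp add: y dist_norm)
    ultimately show "x \<in> ball c (\<rho> + 3 + 3 * T)" using y(1) by (simp add: S_def)
  qed
  have finS: "emeasure lborel (A j) \<noteq> \<infinity>" if "j < J" for j
    using emeasure_mono[OF bound[OF that], of lborel] emeasure_lborel_ball_finite[of c "\<rho> + 3 + 3 * T"]
    by (auto simp: top_unique)
  have "real J * measure lborel S = (\<Sum>j<J. measure lborel (A j))"
    by (simp add: measure_def A_eq)
  also have "\<dots> = measure lborel (\<Union>j<J. A j)"
    by (rule measure_finite_Union[symmetric]) (use A_meas disj finS in auto)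
  also have "\<dots> \<le> measure lborel (ball c (\<rho> + 3 + 3 * T))"
  proof (rule measure_mono_fmeasurable)
    show "(\<Union>j<J. A j) \<subseteq> ball c (\<rho> + 3 + 3 * T)" using bound by blast
    show "(\<Union>j<J. A j) \<in> sets lborel" using A_meas by auto
    show "ball c (\<rho> + 3 + 3 * T) \<in> fmeasurable lborel"
      using emeasure_lborel_ball_finite[of c "\<rho> + 3 + 3 * T"] by (simp add: fmeasurable_def)
  qed
  finally have "real J * measure lborel S \<le> measure lborel (ball c (\<rho> + 3 + 3 * T))" .
  moreover have "(1 / t) * measure lborel S \<le> real J * measure lborel S"
    using J by (intro mult_right_mono) auto
  ultimately have "(1 / t) * measure lborel S \<le> measure lborel (ball c (\<rho> + 3 + 3 * T))" by linarith
  then show "measure lborel S \<le> measure lborel (ball c (\<rho> + 3 + 3 * T)) * t"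
    using t by (simp add: field_simps)
qed

text \<open>The cubes are disjoint and each has volume \<open>m\<^bsup>-kN\<^esup>\<close>; open boxes inside them have the same volume.\<close>

lemma cell_count_of_measure:
  fixes S :: "(real ^ 'n) set"
  assumes m: "0 < m" and Z: "finite Z" and S: "S \<in> sets borel" "emeasure lborel S < \<infinity>"
    and sub: "\<And>y. grid_cell m k y \<in> Z \<Longrightarrow> y \<in> S"
  shows "real (card Z) \<le> measure lborel S * (real m ^ k) ^ CARD('n)"
proof -
  define h where "h = 1 / real m ^ k"
  have h: "0 < h" using m by (simp add: h_def)
  define lo hi where "lo z = (\<chi> i. real_of_int (z i) * h)" and "hi z = (\<chi> i. (real_of_int (z i) + 1) * h)"
    for z :: "'n \<Rightarrow> int"
  have in_box: "grid_cell m k y = z" if "y \<in> box (lo z) (hi z)" for y z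
  proof
    fix i
    have "real_of_int (z i) * h < y $ i" "y $ i < (real_of_int (z i) + 1) * h"
      using that by (auto simp: mem_box_cart lo_def hi_def)
    then have "real_of_int (z i) < real m ^ k * y $ i" "real m ^ k * y $ i < real_of_int (z i) + 1"
      using m by (auto simp: h_def field_simps)
    then show "grid_cell m k y i = z i" unfolding grid_cell_def by linarith
  qed
  have vol: "measure lborel (box (lo z) (hi z)) = h ^ CARD('n)" for z
  proof -
    have d: "(hi z - lo z) \<bullet> b = h" if "b \<in> Basis" for b
      using that by (auto simp: Basis_vec_def inner_axis lo_def hi_def algebra_simps)
    have "measure lborel (box (lo z) (hi z)) = (\<Prod>b\<in>Basis. (hi z - lo z) \<bullet> b)"
    proof (rule measure_lborel_box)
      show "lo z \<bullet> b \<le> hi z \<bullet> b" if "b \<in> Basis" for b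
        using d[OF that] h by (simp add: inner_diff_left)
    qed
    also have "\<dots> = h ^ card (Basis :: (real ^ 'n) set)" using d by simp
    finally show ?thesis by simp
  qed
  have "real (card Z) * h ^ CARD('n) = (\<Sum>z\<in>Z. measure lborel (box (lo z) (hi z)))"
    by (simp add: vol)
  also have "\<dots> = measure lborel (\<Union>z\<in>Z. box (lo z) (hi z))"
  proof (rule measure_finite_Union[symmetric])
    show "disjoint_family_on (\<lambda>z. box (lo z) (hi z)) Z"
      unfolding disjoint_family_on_def using in_box by blast
    show "emeasure lborel (box (lo z) (hi z)) \<noteq> \<infinity>" for z
      using emeasure_lborel_box_finite[of "lo z" "hi z"] by auto
  qed (use Z in auto)
  also have "\<dots> \<le> measure lborel S"
  proof (rule measure_mono_fmeasurable)
    show "(\<Union>z\<in>Z. box (lo z) (hi z)) \<subseteq> S" using in_box sub by blast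
    show "(\<Union>z\<in>Z. box (lo z) (hi z)) \<in> sets lborel" using Z by auto
    show "S \<in> fmeasurable lborel" using S by (simp add: fmeasurable_def)
  qed
  finally show ?thesis using m by (simp add: h_def power_one_over field_simps)
qed

text \<open>Near a boundary point, the cubes in question lie in a layer of thickness \<open>O(m\<^bsup>-k\<^esup>)\<close> about a Lipschitz graph,
  and \<open>graph_layer_measure\<close> bounds their total volume; finitely many such neighbourhoods cover the boundary.\<close>

lemma boundary_cell_count:
  fixes \<Omega> E :: "(real ^ 'n) set"
  assumes \<Omega>: "regular_bounded_domain \<Omega>" and m: "0 < m" and E: "bounded E" and a: "0 < a"
  obtains C where "0 \<le> C" "\<And>k. real (card {z \<in> grid_cell m k ` E. \<exists>x\<in>E. \<exists>b\<in>frontier \<Omega>.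
      grid_cell m k x = z \<and> dist x b \<le> a / real m ^ k}) \<le> C * (real m ^ (CARD('n) - 1)) ^ k"
proof -
  define n where "n = real CARD('n)"
  have n1: "1 \<le> n" using one_le_card_finite[where 'a='n] by (simp add: n_def)
  have op: "open \<Omega>" and bd: "bounded \<Omega>" and lip: "lipschitz_boundary \<Omega>"
    using \<Omega> by (auto simp: regular_bounded_domain_def)
  define B where "B b k = {z \<in> grid_cell m k ` E. \<exists>x\<in>E. grid_cell m k x = z \<and> dist x b \<le> a / real m ^ k}" for b k
  have local: "\<exists>U C. open U \<and> z0 \<in> U \<and> 0 \<le> C \<and>
      (\<forall>k. real (card (\<Union>b\<in>frontier \<Omega> \<inter> U. B b k)) \<le> C * (real m ^ (CARD('n) - 1)) ^ k)"
    if z0: "z0 \<in> frontier \<Omega>" for z0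
  proof -
    obtain e r L and \<gamma> :: "real ^ 'n \<Rightarrow> real" where e: "norm e = 1" and r: "0 < r" and L: "L-lipschitz_on UNIV \<gamma>"
      and eq: "\<Omega> \<inter> ball z0 r = {x \<in> ball z0 r. \<gamma> (x - (x \<bullet> e) *\<^sub>R e) < x \<bullet> e}"
      using lip z0 unfolding lipschitz_boundary_def by blast
    have L0: "0 \<le> L" using L by (rule lipschitz_on_nonneg)
    have c\<gamma>: "continuous_on UNIV \<gamma>" using L by (rule lipschitz_on_continuous_on)
    define T where "T = (1 + 2 * L) * (a + n)"
    have T: "0 < T" using L0 a n1 by (simp add: T_def)
    define \<rho> where "\<rho> = r + a + n"
    define V where "V = measure lborel (ball z0 (\<rho> + 3 + 3 * T))"
    have "real (card (\<Union>b\<in>frontier \<Omega> \<inter> ball z0 r. B b k)) \<le> (V * T) * (real m ^ (CARD('n) - 1)) ^ k" for k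
    proof -
      define h where "h = 1 / real m ^ k"
      have h: "0 < h" "h \<le> 1" using m by (auto simp: h_def)
      define S where "S = {y \<in> ball z0 \<rho>. \<bar>y \<bullet> e - \<gamma> (y - (y \<bullet> e) *\<^sub>R e)\<bar> \<le> T * h}"
      have Th: "0 < T * h" "T * h \<le> T" using T h by (auto simp: mult_left_le)
      have Sm: "S \<in> sets borel" "measure lborel S \<le> V * (T * h)"
        using graph_layer_measure[OF e c\<gamma> Th, of z0 \<rho>] by (auto simp: S_def V_def)
      have Sf: "emeasure lborel S < \<infinity>"
      proof (rule le_less_trans)
        show "emeasure lborel S \<le> emeasure lborel (ball z0 \<rho>)"
          by (rule emeasure_mono) (auto simp: S_def)
      qed (use emeasure_lborel_ball_finite[of z0 \<rho>] in simp)
      have inS: "y \<in> S" if y: "grid_cell m k y \<in> (\<Union>b\<in>frontier \<Omega> \<inter> ball z0 r. B b k)" for y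
      proof -
        obtain b x where b: "b \<in> frontier \<Omega>" "b \<in> ball z0 r" and x: "grid_cell m k x = grid_cell m k y" "dist x b \<le> a * h"
          using y by (auto simp: B_def h_def)
        have "dist y x \<le> n * h" using grid_cell_dist[OF m x(1)] by (simp add: n_def h_def dist_commute)
        then have yb: "dist y b \<le> (a + n) * h"
          using dist_triangle[of y b x] x(2) by (simp add: algebra_simps)
        have "(a + n) * h \<le> a + n" using h a n1 by (simp add: mult_left_le)
        then have y1: "y \<in> ball z0 \<rho>"
          using dist_triangle[of z0 y b] b(2) yb by (simp add: \<rho>_def dist_commute)
        have g: "b \<bullet> e = \<gamma> (b - (b \<bullet> e) *\<^sub>R e)"
          by (rule frontier_point_on_graph[OF op b c\<gamma> eq])
        have i: "\<bar>y \<bullet> e - b \<bullet> e\<bar> \<le> dist y b"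
          using Cauchy_Schwarz_ineq2[of "y - b" e] e by (simp add: inner_diff_left dist_norm)
        have "dist (y - (y \<bullet> e) *\<^sub>R e) (b - (b \<bullet> e) *\<^sub>R e) \<le> 2 * dist y b"
        proof -
          have "(y - (y \<bullet> e) *\<^sub>R e) - (b - (b \<bullet> e) *\<^sub>R e) = (y - b) - (y \<bullet> e - b \<bullet> e) *\<^sub>R e"
            by (simp add: algebra_simps)
          then have "dist (y - (y \<bullet> e) *\<^sub>R e) (b - (b \<bullet> e) *\<^sub>R e) \<le> norm (y - b) + norm ((y \<bullet> e - b \<bullet> e) *\<^sub>R e)"
            unfolding dist_norm by (metis norm_triangle_ineq4)
          then show ?thesis using i e by (simp add: dist_norm)
        qed
        then have "\<bar>\<gamma> (y - (y \<bullet> e) *\<^sub>R e) - \<gamma> (b - (b \<bullet> e) *\<^sub>R e)\<bar> \<le> L * (2 * dist y b)"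
          using lipschitz_onD[OF L, of "y - (y \<bullet> e) *\<^sub>R e" "b - (b \<bullet> e) *\<^sub>R e"] L0
          by (simp add: dist_real_def) (meson mult_left_mono order_trans)
        then have "\<bar>y \<bullet> e - \<gamma> (y - (y \<bullet> e) *\<^sub>R e)\<bar> \<le> dist y b + L * (2 * dist y b)"
          using i g by linarith
        also have "\<dots> = (1 + 2 * L) * dist y b" by (simp add: algebra_simps)
        also have "\<dots> \<le> (1 + 2 * L) * ((a + n) * h)" using yb L0 by (intro mult_left_mono) auto
        finally show ?thesis using y1 by (simp add: S_def T_def mult.assoc)
      qed
      have "(\<Union>b\<in>frontier \<Omega> \<inter> ball z0 r. B b k) \<subseteq> grid_cell m k ` E" by (auto simp: B_def)
      then have fin: "finite (\<Union>b\<in>frontier \<Omega> \<inter> ball z0 r. B b k)"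
        using finite_grid_cells[OF E] by (rule finite_subset)
      have "real (card (\<Union>b\<in>frontier \<Omega> \<inter> ball z0 r. B b k)) \<le> measure lborel S * (real m ^ k) ^ CARD('n)"
        by (rule cell_count_of_measure[OF m fin Sm(1) Sf inS])
      also have "\<dots> \<le> (V * (T * h)) * (real m ^ k) ^ CARD('n)"
        using Sm(2) by (intro mult_right_mono) auto
      also have "(real m ^ k) ^ CARD('n) = real m ^ k * (real m ^ (CARD('n) - 1)) ^ k"
      proof -
        have "CARD('n) = Suc (CARD('n) - 1)" by simp
        then have "(real m ^ k) ^ CARD('n) = real m ^ k * (real m ^ k) ^ (CARD('n) - 1)"
          by (metis power_Suc)
        then show ?thesis by (simp add: power_mult[symmetric] mult.commute)
      qed
      finally show ?thesis using m by (simp add: h_def)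
    qed
    moreover have "0 \<le> V * T" using T by (simp add: V_def)
    ultimately show ?thesis using r by (intro exI[of _ "ball z0 r"] exI[of _ "V * T"]) auto
  qed
  then obtain U C where U: "\<And>z. z \<in> frontier \<Omega> \<Longrightarrow> open (U z) \<and> z \<in> U z \<and> 0 \<le> C z \<and>
      (\<forall>k. real (card (\<Union>b\<in>frontier \<Omega> \<inter> U z. B b k)) \<le> C z * (real m ^ (CARD('n) - 1)) ^ k)"
    by metis
  have "compact (frontier \<Omega>)" using bd by (rule compact_frontier_bounded)
  then obtain I where I: "I \<subseteq> frontier \<Omega>" "finite I" "frontier \<Omega> \<subseteq> (\<Union>z\<in>I. U z)"
    by (rule compactE_image[of _ "frontier \<Omega>" U]) (use U in auto)
  show thesis
  proof (rule that[of "\<Sum>z\<in>I. C z"])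
    show "0 \<le> (\<Sum>z\<in>I. C z)" using I U by (intro sum_nonneg) auto
    fix k
    let ?q = "(real m ^ (CARD('n) - 1)) ^ k"
    have "{z \<in> grid_cell m k ` E. \<exists>x\<in>E. \<exists>b\<in>frontier \<Omega>. grid_cell m k x = z \<and> dist x b \<le> a / real m ^ k}
        \<subseteq> (\<Union>z\<in>I. \<Union>b\<in>frontier \<Omega> \<inter> U z. B b k)"
      using I(3) by (fastforce simp: B_def)
    moreover have "finite (\<Union>z\<in>I. \<Union>b\<in>frontier \<Omega> \<inter> U z. B b k)"
      by (rule finite_subset[OF _ finite_grid_cells[OF E, of m k]]) (auto simp: B_def)
    ultimately have "card {z \<in> grid_cell m k ` E. \<exists>x\<in>E. \<exists>b\<in>frontier \<Omega>. grid_cell m k x = z \<and> dist x b \<le> a / real m ^ k}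
        \<le> card (\<Union>z\<in>I. \<Union>b\<in>frontier \<Omega> \<inter> U z. B b k)"
      by (intro card_mono)
    also have "\<dots> \<le> (\<Sum>z\<in>I. card (\<Union>b\<in>frontier \<Omega> \<inter> U z. B b k))"
      by (rule card_UN_le[OF I(2)])
    finally have "real (card {z \<in> grid_cell m k ` E. \<exists>x\<in>E. \<exists>b\<in>frontier \<Omega>. grid_cell m k x = z \<and> dist x b \<le> a / real m ^ k})
        \<le> (\<Sum>z\<in>I. real (card (\<Union>b\<in>frontier \<Omega> \<inter> U z. B b k)))"
      by (simp flip: of_nat_sum)
    also have "\<dots> \<le> (\<Sum>z\<in>I. C z * ?q)"
      using I(1) U by (intro sum_mono) auto
    finally show "real (card {z \<in> grid_cell m k ` E. \<exists>x\<in>E. \<exists>b\<in>frontier \<Omega>. grid_cell m k x = z \<and> dist x b \<le> a / real m ^ k})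
        \<le> (\<Sum>z\<in>I. C z) * ?q"
      by (simp add: sum_distrib_right)
  qed
qed

text \<open>Consider the child that contains the centre \<open>c\<close> of the cube.  If it misses \<open>E\<close>, it is the child sought.
  Otherwise a point \<open>x\<close> of \<open>E\<close> lies so close to \<open>c\<close> that a ball about \<open>x\<close> of radius a quarter of the side stays in the
  cube, and the hole in that ball is larger than a child.\<close>

lemma porous_cell_has_free_child:
  fixes E F :: "(real ^ 'n) set"
  assumes m: "4 < m" "4 * real CARD('n) < \<delta> * real m" and EF: "E \<subseteq> F" and x0: "x0 \<in> E"
    and porous: "\<And>x. x \<in> E \<Longrightarrow> grid_cell m k x = grid_cell m k x0 \<Longrightarrow>
      \<exists>z. ball z (\<delta> * (1 / real m ^ k / 4)) \<subseteq> ball x (1 / real m ^ k / 4) \<and>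
          ball z (\<delta> * (1 / real m ^ k / 4)) \<inter> F = {}"
  shows "\<exists>y. grid_cell m k y = grid_cell m k x0 \<and> grid_cell m (Suc k) y \<notin> grid_cell m (Suc k) ` E"
proof -
  define h where "h = 1 / real m ^ k"
  have m0: "0 < m" using m by simp
  have h: "0 < h" using m by (simp add: h_def)
  define c where "c = (\<chi> i. (real_of_int (grid_cell m k x0 i) + 1 / 2) * h)"
  have near: "grid_cell m k y = grid_cell m k x0" if "\<And>i. \<bar>y $ i - c $ i\<bar> < h / 2" for y
  proof
    fix i
    define w where "w = grid_cell m k x0 i"
    have "\<bar>y $ i - (real_of_int w + 1 / 2) * h\<bar> < h / 2" using that[of i] by (simp add: c_def w_def)
    moreover have "(real_of_int w + 1 / 2) * h = real_of_int w * h + h / 2"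
      by (simp add: distrib_right)
    ultimately have "\<bar>y $ i - (real_of_int w * h + h / 2)\<bar> < h / 2" by (simp only:)
    then have "real_of_int w * h < y $ i" "y $ i < real_of_int w * h + h"
      unfolding abs_less_iff by linarith+
    then have "real_of_int w * h < y $ i" "y $ i < (real_of_int w + 1) * h"
      by (simp_all add: distrib_right)
    then have "real_of_int w < real m ^ k * y $ i" "real m ^ k * y $ i < real_of_int w + 1"
      using m by (auto simp: h_def field_simps)
    then have "grid_cell m k y i = w" unfolding grid_cell_def by linarith
    then show "grid_cell m k y i = grid_cell m k x0 i" by (simp add: w_def)
  qed
  have cc: "grid_cell m k c = grid_cell m k x0" by (rule near) (use h in simp)
  show ?thesis
  proof (cases "grid_cell m (Suc k) c \<in> grid_cell m (Suc k) ` E")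
    case False
    then show ?thesis using cc by blast
  next
    case True
    then obtain x where x: "x \<in> E" "grid_cell m (Suc k) x = grid_cell m (Suc k) c" by auto
    have hm: "1 / real m ^ Suc k = h / real m" by (simp add: h_def)
    have xc: "\<bar>x $ i - c $ i\<bar> < h / 4" for i
    proof -
      have "\<bar>x $ i - c $ i\<bar> < h / real m" using grid_cell_coord[OF m0 x(2)] unfolding hm .
      also have "\<dots> \<le> h / 4" using m h by (intro divide_left_mono) auto
      finally show ?thesis .
    qed
    have "grid_cell m k x = grid_cell m k x0"
    proof (rule near)
      show "\<bar>x $ i - c $ i\<bar> < h / 2" for i using xc[of i] h by linarith
    qed
    from porous[OF x(1) this] obtain y where y: "ball y (\<delta> * (h / 4)) \<subseteq> ball x (h / 4)"
      "ball y (\<delta> * (h / 4)) \<inter> F = {}" unfolding h_def by blast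
    have \<delta>: "0 < \<delta>" using m by (smt (verit) of_nat_0_le_iff zero_less_mult_iff mult_nonneg_nonneg)
    have "y \<in> ball y (\<delta> * (h / 4))" using \<delta> h by simp
    from subsetD[OF y(1) this] have yx: "dist x y < h / 4" by simp
    have "grid_cell m k y = grid_cell m k x0"
    proof (rule near)
      fix i
      have "\<bar>y $ i - x $ i\<bar> \<le> dist x y"
        using component_le_norm_cart[of "y - x" i] by (simp add: dist_norm norm_minus_commute)
      then show "\<bar>y $ i - c $ i\<bar> < h / 2" using yx xc[of i] by linarith
    qed
    moreover have "grid_cell m (Suc k) y \<notin> grid_cell m (Suc k) ` E"
    proof
      assume "grid_cell m (Suc k) y \<in> grid_cell m (Suc k) ` E"
      then obtain w where w: "w \<in> E" "grid_cell m (Suc k) y = grid_cell m (Suc k) w" by auto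
      have "dist y w \<le> real CARD('n) * (h / real m)"
        using grid_cell_dist[OF m0 w(2)] by (simp add: h_def mult.commute)
      also have "\<dots> < \<delta> * (h / 4)"
        using m h by (simp add: field_simps)
      finally have "w \<in> ball y (\<delta> * (h / 4))" by simp
      then show False using y(2) w(1) EF by auto
    qed
    ultimately show ?thesis by blast
  qed
qed

text \<open>The constant \<open>\<xi>\<close> is fixed before \<open>\<Omega>\<close>: only \<open>\<delta>\<close> and the dimension enter the choice of the subdivision
  number \<open>m\<close>.  Porosity is assumed only for balls inside \<open>\<Omega>\<close>; the cubes near \<open>\<partial>\<Omega>\<close> are controlled by their
  number.\<close>

theorem porous_hausdorff_measure_finite:
  fixes \<delta> :: real
  assumes \<delta>: "0 < \<delta>"
  shows "\<exists>\<xi>::real. 0 < \<xi> \<and> \<xi> \<le> 1 \<and>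
    (\<forall>(\<Omega> :: (real ^ 'n) set) F E.
       regular_bounded_domain \<Omega> \<longrightarrow> F \<subseteq> closure \<Omega> \<longrightarrow> E \<subseteq> F \<longrightarrow> bounded E \<longrightarrow>
       (\<forall>x r. x \<in> F \<longrightarrow> 0 < r \<longrightarrow> cball x r \<subseteq> \<Omega> \<longrightarrow>
          (\<exists>z. ball z (\<delta> * r) \<subseteq> ball x r \<and> ball z (\<delta> * r) \<inter> F = {})) \<longrightarrow>
       hausdorff_measure (real CARD('n) - \<xi>) E < \<infinity>)"
proof -
  define N where "N = CARD('n)"
  have N: "1 \<le> N" using one_le_card_finite[where 'a='n] by (simp add: N_def)
  obtain m0 :: nat where m0: "4 * real N / \<delta> < real m0" using reals_Archimedean2 by blast
  \<comment> \<open>\<open>m > 4\<close> keeps the ball about a point of the central child, of radius a quarter of the side, in the cube;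
    the bound by \<open>m0\<close> makes a child smaller than the hole in that ball.\<close>
  define m where "m = max m0 5"
  have m: "4 < m" "4 * real N < \<delta> * real m"
  proof -
    show "4 < m" by (simp add: m_def)
    have "4 * real N / \<delta> < real m" using m0 by (simp add: m_def)
    then show "4 * real N < \<delta> * real m" using \<delta> by (simp add: field_simps)
  qed
  define q where "q = real m ^ (N - 1)"
  define D where "D = real m ^ N - 1"
  have mq: "real m ^ N = real m * q"
    using N by (metis Suc_diff_1 less_le_trans power_Suc q_def zero_less_one)
  have q1: "1 \<le> q" using m by (simp add: q_def)
  have "5 * q \<le> real m * q" using q1 m by (intro mult_right_mono) auto
  then have D: "q < D" "1 < D" "D < real m ^ N" unfolding D_def mq using q1 by linarith+
  define s where "s = log (real m) D"
  have m1: "1 < real m" using m by simp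
  have ms: "real m powr s = D" using m1 D by (simp add: s_def)
  have s0: "0 < s" using m1 D by (simp add: s_def)
  define \<xi> where "\<xi> = real N - s"
  have "s < real N"
  proof -
    have "real m powr s < real m powr real N" using D m1 by (simp add: ms powr_realpow)
    then show ?thesis using m1 by simp
  qed
  then have \<xi>0: "0 < \<xi>" by (simp add: \<xi>_def)
  have "real N - 1 \<le> s"
  proof -
    have "real m powr (real N - 1) = q" using N m1 by (simp add: q_def powr_realpow[symmetric] of_nat_diff)
    then have "real m powr (real N - 1) \<le> real m powr s" using D by (simp add: ms)
    then show ?thesis using m1 by simp
  qed
  then have \<xi>1: "\<xi> \<le> 1" by (simp add: \<xi>_def)
  show ?thesis
  proof (intro exI[of _ \<xi>] conjI allI impI \<xi>0 \<xi>1)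
    fix \<Omega> F E :: "(real ^ 'n) set"
    assume \<Omega>: "regular_bounded_domain \<Omega>" and F: "F \<subseteq> closure \<Omega>" and E: "E \<subseteq> F" "bounded E"
      and porous: "\<forall>x r. x \<in> F \<longrightarrow> 0 < r \<longrightarrow> cball x r \<subseteq> \<Omega> \<longrightarrow>
         (\<exists>z. ball z (\<delta> * r) \<subseteq> ball x r \<and> ball z (\<delta> * r) \<inter> F = {})"
    have mpos: "0 < m" using m by simp
    define Z where "Z k = {z \<in> grid_cell m k ` E. \<exists>x\<in>E. \<exists>b\<in>frontier \<Omega>.
      grid_cell m k x = z \<and> dist x b \<le> 1 / real m ^ k}" for k
    obtain C where C: "0 \<le> C" "\<And>k. real (card (Z k)) \<le> C * q ^ k"
      using boundary_cell_count[OF \<Omega> mpos E(2), of 1] unfolding Z_def q_def N_def by auto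
    define a where "a k = real (card (grid_cell m k ` E))" for k
    have step: "a (Suc k) \<le> D * a k + real (card (Z k))" for k
    proof -
      have "card (grid_cell m (Suc k) ` E) \<le> (m ^ CARD('n) - 1) * card (grid_cell m k ` E) + card (Z k)"
      proof (rule cell_count_step[OF mpos E(2)])
        show "Z k \<subseteq> grid_cell m k ` E" by (auto simp: Z_def)
        fix x0 assume x0: "x0 \<in> E" and good: "grid_cell m k x0 \<notin> Z k"
        show "\<exists>y. grid_cell m k y = grid_cell m k x0 \<and> grid_cell m (Suc k) y \<notin> grid_cell m (Suc k) ` E"
        proof (rule porous_cell_has_free_child[OF m(1) m(2)[unfolded N_def] E(1) x0])
          fix x assume x: "x \<in> E" "grid_cell m k x = grid_cell m k x0"
          define h where "h = 1 / real m ^ k"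
          have h: "0 < h" using m by (simp add: h_def)
          have far: "h < dist x b" if "b \<in> frontier \<Omega>" for b
          proof (rule ccontr)
            assume "\<not> h < dist x b"
            then have "grid_cell m k x0 \<in> Z k"
              using x x0 that unfolding Z_def h_def by force
            then show False using good by simp
          qed
          have "x \<in> closure \<Omega>" using x E F by auto
          moreover have "x \<notin> frontier \<Omega>" using far[of x] h by auto
          ultimately have x\<Omega>: "x \<in> \<Omega>"
            using interior_subset by (auto simp: frontier_def)
          have "cball x (h / 4) \<subseteq> \<Omega>"
          proof (rule ccontr)
            assume "\<not> cball x (h / 4) \<subseteq> \<Omega>"
            then have i1: "cball x (h / 4) - \<Omega> \<noteq> {}" by blast
            have "x \<in> cball x (h / 4) \<inter> \<Omega>" using x\<Omega> h by simp
            then have i2: "cball x (h / 4) \<inter> \<Omega> \<noteq> {}" by blast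
            have "cball x (h / 4) \<inter> frontier \<Omega> \<noteq> {}"
              by (rule connected_Int_frontier[OF convex_connected[OF convex_cball] i2 i1])
            then obtain b where "b \<in> frontier \<Omega>" "dist x b \<le> h / 4" by auto
            then show False using far[of b] h by linarith
          qed
          then show "\<exists>z. ball z (\<delta> * (1 / real m ^ k / 4)) \<subseteq> ball x (1 / real m ^ k / 4) \<and>
              ball z (\<delta> * (1 / real m ^ k / 4)) \<inter> F = {}"
            using porous[rule_format, of x "h / 4"] x E h unfolding h_def by auto
        qed
      qed
      then have "real (card (grid_cell m (Suc k) ` E)) \<le>
          real ((m ^ CARD('n) - 1) * card (grid_cell m k ` E) + card (Z k))"
        by (simp only: of_nat_le_iff)
      also have "real ((m ^ CARD('n) - 1) * card (grid_cell m k ` E) + card (Z k)) = D * a k + real (card (Z k))"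
        using mpos by (simp add: a_def D_def N_def of_nat_diff)
      finally show ?thesis by (simp add: a_def)
    qed
    have "a k \<le> (a 0 + C / (D - q)) * D ^ k" for k
      by (rule linear_recursion_bound[OF step C(2) _ D(1) C(1)]) (use q1 in simp)
    then have "hausdorff_measure s E < \<infinity>"
      using m by (intro hausdorff_measure_finite_of_cell_count[OF _ E(2) s0 ms]) (auto simp: a_def)
    then show "hausdorff_measure (real CARD('n) - \<xi>) E < \<infinity>"
      by (simp add: \<xi>_def N_def)
  qed
qed

section \<open>The free boundary\<close>

text \<open>The porosity constant depends on \<open>l\<close> only, so the dimension does too, for given \<open>N\<close>.\<close>

theorem corollary4p7:
  fixes l :: real
  assumes "0 \<le> l" and "l < 1"
  shows "\<exists>\<xi>::real. 0 < \<xi> \<and> \<xi> \<le> 1 \<and>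
    (\<forall>(\<Omega> :: (real ^ 'n) set) (lam :: real ^ 'n \<Rightarrow> real) (g :: real ^ 'n \<Rightarrow> real)
      (q :: real \<Rightarrow> real) (u_inf :: real ^ 'n \<Rightarrow> real).
       regular_bounded_domain \<Omega> \<longrightarrow>
       set_borel_measurable lebesgue \<Omega> lam \<longrightarrow>
       bounded (lam ` \<Omega>) \<longrightarrow> 0 < (INF x\<in>\<Omega>. lam x) \<longrightarrow>
       (\<exists>L. L-lipschitz_on (frontier \<Omega>) g) \<longrightarrow> (\<forall>x\<in>frontier \<Omega>. 0 \<le> g x) \<longrightarrow>
       (\<forall>p\<ge>2. 0 \<le> q p \<and> q p < p - 1) \<longrightarrow> ((\<lambda>p. q p / p) \<longlongrightarrow> l) at_top \<longrightarrow>
       limit_solution \<Omega> lam g q u_inf \<longrightarrow>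
       hausdorff_measure (real CARD('n) - \<xi>)
         (frontier {x \<in> \<Omega>. 0 < u_inf x} \<inter> ball 0 (1/2)) < \<infinity>)"
proof -
  have "0 < (1 - l) / 32" using assms by simp
  from porous_hausdorff_measure_finite[OF this, where 'n = 'n] obtain \<xi> :: real
    where \<xi>: "0 < \<xi>" "\<xi> \<le> 1"
    and fin: "\<forall>(\<Omega> :: (real ^ 'n) set) F E.
       regular_bounded_domain \<Omega> \<longrightarrow> F \<subseteq> closure \<Omega> \<longrightarrow> E \<subseteq> F \<longrightarrow> bounded E \<longrightarrow>
       (\<forall>x r. x \<in> F \<longrightarrow> 0 < r \<longrightarrow> cball x r \<subseteq> \<Omega> \<longrightarrow>
          (\<exists>z. ball z ((1 - l) / 32 * r) \<subseteq> ball x r \<and> ball z ((1 - l) / 32 * r) \<inter> F = {})) \<longrightarrow>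
       hausdorff_measure (real CARD('n) - \<xi>) E < \<infinity>"
    by blast
  have "hausdorff_measure (real CARD('n) - \<xi>) (frontier {x \<in> \<Omega>. 0 < u_inf x} \<inter> ball 0 (1/2)) < \<infinity>"
    if dom: "regular_bounded_domain \<Omega>" and lam: "set_borel_measurable lebesgue \<Omega> lam"
      "bounded (lam ` \<Omega>)" "0 < (INF x\<in>\<Omega>. lam x)"
      and q: "\<forall>p\<ge>2. 0 \<le> q p \<and> q p < p - 1" "((\<lambda>p. q p / p) \<longlongrightarrow> l) at_top"
      and sol: "limit_solution \<Omega> lam g q u_inf"
    for \<Omega> :: "(real ^ 'n) set" and lam g q u_inf
  proof (rule fin[rule_format, OF dom])
    have op: "open \<Omega>" using dom by (simp add: regular_bounded_domain_def)
    obtain \<Lambda> where \<Lambda>: "\<And>x. x \<in> \<Omega> \<Longrightarrow> \<bar>lam x\<bar> \<le> \<Lambda>" using lam(2) by (auto simp: bounded_iff)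
    have low: "(INF x\<in>\<Omega>. lam x) \<le> lam x" if "x \<in> \<Omega>" for x
      using bounded_imp_bdd_below[OF lam(2)] that by (rule cINF_lower)
    show "frontier {x \<in> \<Omega>. 0 < u_inf x} \<subseteq> closure \<Omega>"
      unfolding frontier_def using closure_mono[of "{x \<in> \<Omega>. 0 < u_inf x}" \<Omega>] by blast
    show "bounded (frontier {x \<in> \<Omega>. 0 < u_inf x} \<inter> ball 0 (1/2))" by (simp add: bounded_Int)
    fix x r assume x: "x \<in> frontier {x \<in> \<Omega>. 0 < u_inf x}" "0 < r" "cball x r \<subseteq> \<Omega>"
    obtain z where "ball z ((1 - l) / 32 * r) \<subseteq> ball x r"
      "ball z ((1 - l) / 32 * r) \<inter> frontier {x \<in> \<Omega>. 0 < u_inf x} = {}"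
      by (rule free_boundary_porous[OF op lam(1) \<Lambda> low lam(3) q assms sol x])
    then show "\<exists>z. ball z ((1 - l) / 32 * r) \<subseteq> ball x r \<and>
        ball z ((1 - l) / 32 * r) \<inter> frontier {x \<in> \<Omega>. 0 < u_inf x} = {}"
      by blast
  qed simp
  with \<xi> show ?thesis by blast
qed

end
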